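(* Let $\boldsymbol{X}^n$ be the occupancy process of the JSQ$(d_n)$ system described in the context, where $d_n\in\{1,\dots,n\}$, $d_n\to\infty$, $\lambda_n\to\lambda$. Suppose $\lambda=1$ and $\boldsymbol{X}^n(0)=\boldsymbol{x}^n$ with $x^n_1=1$ and $x^n_i=0$ for $i\ge2$, for all $n\in\mathbb{N}$. Fix an integer $j\ge3$ and, for $T\in(0,\infty)$, let $$U^n_j=\{X^n_j(t)>0\text{ for some }t\in[0,T]\},\qquad V^n_j=\{X^n_{j-1}(t)=1\text{ for some }t\in[0,T]\},$$ $$R_j(T)=T\,\ell\!\left(\frac{\frac{j-2}{T}+\sqrt{4+(\frac{j-2}{T})^2}}{2}\right)+T\,\ell\!\left(\frac{-\frac{j-2}{T}+\sqrt{4+(\frac{j-2}{T})^2}}{2}\right).$$ (a) Then, for every $T\in(0,\infty)$, $$\liminf_{n\to\infty}\frac1n\log\mathbb{P}(U^n_j)\ge-R_j(T),\qquad\limsup_{n\to\infty}\frac1n\log\mathbb{P}(V^n_j)\le-R_j(T).$$ (b) Suppose $d_n=n$. Then, for every $T\in(0,\infty)$, $$\lim_{n\to\infty}\frac1n\log\mathbb{P}(U^n_j)=\lim_{n\to\infty}\frac1n\log\mathbb{P}(V^n_j)=-R_j(T),$$ and $$\lim_{T\to\infty}\lim_{n\to\infty}\frac Tn\log\mathbb{P}(U^n_j)=\lim_{T\to\infty}\lim_{n\to\infty}\frac Tn\log\mathbb{P}(V^n_j)=-\frac{(j-2)^2}{4}.$$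
   Context: JSQ$(d_n)$ system: $n$ parallel single-server queues; jobs arrive according to a Poisson process of rate $n\lambda_n$; service times are i.i.d. exponential with mean 1, independent of the arrivals, FIFO at each server; each arriving job samples $d_n$ of the $n$ queues uniformly at random without replacement and joins the shortest of them (ties broken uniformly at random). For $i\ge1$, $X^n_i(t)$ is the proportion of the $n$ queues that have length at least $i$ at time $t$, and $\boldsymbol{X}^n(t)=(X^n_i(t))_{i\ge1}$. $\ell(z)=z\log z-z+1$ for $z\ge0$. *)

theory Defs
  imports "HOL-Probability.Probability" "HOL-Combinatorics.Permutations"
begin

text \<open>
  The random inputs of a JSQ(d) system with servers \<open>0, \<dots>, n - 1\<close>. Arriving jobs are numbered
  from 0: job \<open>k\<close> arrives \<open>arr_gap k\<close> time units after its predecessor (after time 0 if \<open>k = 0\<close>),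
  samples the servers in \<open>sampled k\<close>, brings the service requirement \<open>work k\<close>, and breaks ties
  between shortest queues in favour of the server of least \<open>tie_rank k\<close>.
  \<open>init_work s m\<close> is the (residual) service requirement of the \<open>m\<close>-th job (in FIFO order) that is
  present at server \<open>s\<close> at time 0.
\<close>

record 'w jsq_input =
  arr_gap   :: "nat \<Rightarrow> 'w \<Rightarrow> real"
  sampled   :: "nat \<Rightarrow> 'w \<Rightarrow> nat set"
  tie_rank  :: "nat \<Rightarrow> 'w \<Rightarrow> nat \<Rightarrow> nat"
  work      :: "nat \<Rightarrow> 'w \<Rightarrow> real"
  init_work :: "nat \<Rightarrow> nat \<Rightarrow> 'w \<Rightarrow> real"

text \<open>A job that has entered the system: its server, its arrival time and its departure time.\<close>

type_synonym job = "nat \<times> real \<times> real"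

definition jobs_present :: "job list \<Rightarrow> nat \<Rightarrow> real \<Rightarrow> nat" where
  "jobs_present js s t = length (filter (\<lambda>(s', a, e). s' = s \<and> a \<le> t \<and> t < e) js)"

text \<open>FIFO: service starts on arrival or, if that is later, when the last job queued before departs.\<close>

definition enqueue :: "nat \<Rightarrow> real \<Rightarrow> real \<Rightarrow> job list \<Rightarrow> job list" where
  "enqueue s a v js = js @ [(s, a, v + Max (insert a {e. \<exists>a'. (s, a', e) \<in> set js}))]"

definition shortest_queue :: "job list \<Rightarrow> real \<Rightarrow> nat set \<Rightarrow> (nat \<Rightarrow> nat) \<Rightarrow> nat" where
  "shortest_queue js t D p =
     arg_min_on p {s \<in> D. \<forall>r\<in>D. jobs_present js s t \<le> jobs_present js r t}"

definition arrival_time :: "'w jsq_input \<Rightarrow> nat \<Rightarrow> 'w \<Rightarrow> real" where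
  "arrival_time S k \<omega> = (\<Sum>i\<le>k. arr_gap S i \<omega>)"

text \<open>
  The jobs present at time 0 (\<open>q s\<close> of them at server \<open>s\<close>) followed by the first \<open>k\<close> arrivals.
\<close>

primrec jobs :: "'w jsq_input \<Rightarrow> nat \<Rightarrow> (nat \<Rightarrow> nat) \<Rightarrow> 'w \<Rightarrow> nat \<Rightarrow> job list" where
  "jobs S n q \<omega> 0 =
     fold (\<lambda>(s, m). enqueue s 0 (init_work S s m \<omega>)) [(s, m). s \<leftarrow> [0..<n], m \<leftarrow> [0..<q s]] []"
| "jobs S n q \<omega> (Suc k) =
     (let js = jobs S n q \<omega> k; a = arrival_time S k \<omega>
      in enqueue (shortest_queue js a (sampled S k \<omega>) (tie_rank S k \<omega>)) a (work S k \<omega>) js)"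

text \<open>
  The supremum takes all arrivals into account; those after time \<open>t\<close> contribute nothing. It is
  infinite only on the null event that infinitely many jobs arrive in finite time.
\<close>

definition queue_length ::
    "'w jsq_input \<Rightarrow> nat \<Rightarrow> (nat \<Rightarrow> nat) \<Rightarrow> nat \<Rightarrow> real \<Rightarrow> 'w \<Rightarrow> enat" where
  "queue_length S n q s t \<omega> = (SUP k. enat (jobs_present (jobs S n q \<omega> k) s t))"

definition occupancy ::
    "'w jsq_input \<Rightarrow> nat \<Rightarrow> (nat \<Rightarrow> nat) \<Rightarrow> nat \<Rightarrow> real \<Rightarrow> 'w \<Rightarrow> real" where
  "occupancy S n q i t \<omega> = real (card {s. s < n \<and> enat i \<le> queue_length S n q s t \<omega>}) / real n"

definition samples :: "nat \<Rightarrow> nat \<Rightarrow> nat set set" where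
  "samples n d = {D. D \<subseteq> {..<n} \<and> card D = d}"

definition rankings :: "nat \<Rightarrow> (nat \<Rightarrow> nat) set" where
  "rankings n = {p. p permutes {..<n}}"

datatype source = Gap nat | Sample nat | Tie nat | Work nat | Init nat nat

text \<open>
  The inputs have these random elements as sources; each is described by the \<open>\<sigma>\<close>-algebra that it
  generates. A uniformly random ranking of the servers, independent of everything else, makes the
  choice between tied servers uniform. Arrivals form a Poisson process of rate \<open>n * l\<close>: the
  interarrival times are independent and exponential with that parameter. By lack of memory the
  residual service time of a job that is in service at time 0 is again exponential with mean 1.
\<close>

definition source_events :: "'w measure \<Rightarrow> 'w jsq_input \<Rightarrow> nat \<Rightarrow> nat \<Rightarrow> source \<Rightarrow> 'w set set" where
  "source_events M S n d src = (case src of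
       Gap k \<Rightarrow> sets (vimage_algebra (space M) (arr_gap S k) borel)
     | Sample k \<Rightarrow> sets (vimage_algebra (space M) (sampled S k) (count_space (samples n d)))
     | Tie k \<Rightarrow> sets (vimage_algebra (space M) (tie_rank S k) (count_space (rankings n)))
     | Work k \<Rightarrow> sets (vimage_algebra (space M) (work S k) borel)
     | Init s m \<Rightarrow> sets (vimage_algebra (space M) (init_work S s m) borel))"

definition sources :: "nat \<Rightarrow> (nat \<Rightarrow> nat) \<Rightarrow> source set" where
  "sources n q = range Gap \<union> range Sample \<union> range Tie \<union> range Work \<union> {Init s m |s m. s < n \<and> m < q s}"

locale jsq_system = prob_space M
  for M :: "'w measure" and S :: "'w jsq_input" and n d :: nat and l :: real and q :: "nat \<Rightarrow> nat" +
  assumes arr_gap: "distributed M lborel (arr_gap S k) (exponential_density (real n * l))"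
    and work: "distributed M lborel (work S k) (exponential_density 1)"
    and init_work: "s < n \<Longrightarrow> m < q s \<Longrightarrow> distributed M lborel (init_work S s m) (exponential_density 1)"
    and sampled_measurable: "sampled S k \<in> M \<rightarrow>\<^sub>M count_space (samples n d)"
    and sampled: "distr M (count_space (samples n d)) (sampled S k) = uniform_count_measure (samples n d)"
    and tie_rank_measurable: "tie_rank S k \<in> M \<rightarrow>\<^sub>M count_space (rankings n)"
    and tie_rank: "distr M (count_space (rankings n)) (tie_rank S k) = uniform_count_measure (rankings n)"
    and indep: "indep_sets (source_events M S n d) (sources n q)"

definition event_U :: "'w measure \<Rightarrow> 'w jsq_input \<Rightarrow> nat \<Rightarrow> (nat \<Rightarrow> nat) \<Rightarrow> nat \<Rightarrow> real \<Rightarrow> 'w set" where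
  "event_U M S n q j T = {\<omega> \<in> space M. \<exists>t\<in>{0..T}. occupancy S n q j t \<omega> > 0}"

definition event_V :: "'w measure \<Rightarrow> 'w jsq_input \<Rightarrow> nat \<Rightarrow> (nat \<Rightarrow> nat) \<Rightarrow> nat \<Rightarrow> real \<Rightarrow> 'w set" where
  "event_V M S n q j T = {\<omega> \<in> space M. \<exists>t\<in>{0..T}. occupancy S n q (j - 1) t \<omega> = 1}"

text \<open>Logarithm with \<open>log 0 = -\<infinity>\<close> (the library has \<open>ln 0 = 0\<close>).\<close>

definition eln :: "real \<Rightarrow> ereal" where
  "eln p = (if p = 0 then - \<infinity> else ereal (ln p))"

definition ell :: "real \<Rightarrow> real" where
  "ell z = z * ln z - z + 1"

definition rate :: "nat \<Rightarrow> real \<Rightarrow> real" where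
  "rate j T = (let c = (real j - 2) / T in
     T * ell ((c + sqrt (4 + c\<^sup>2)) / 2) + T * ell ((- c + sqrt (4 + c\<^sup>2)) / 2))"

end

theory Submission
  imports Defs "HOL-Real_Asymp.Real_Asymp"
begin

text \<open>
  Write \<open>R\<close> for the rate and let \<open>a = exp \<theta>\<close> and \<open>1 / a\<close> be the two arguments of
  \<open>ell\<close> in it; then \<open>R = \<theta> (j - 2) - T (exp \<theta> + exp (- \<theta>) - 2)\<close> is the cost for a random walk with jump
  rates \<open>n\<close> up and \<open>n\<close> down to climb by \<open>(j - 2) n\<close> within time \<open>T\<close>.

  Lower bound for \<open>U\<close>: by the pigeonhole principle it suffices that \<open>K\<close> jobs arrive before \<open>T\<close>
  and that fewer than \<open>m + 1 = K - (j - 2) n\<close> jobs leave. The arrivals are Poisson. Revealing the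
  service times in the order in which the jobs enter, the conditional probability that a Poisson
  process run for the remaining capacity of the servers still has few enough points is a submartingale;
  hence the departures are dominated by a Poisson variable with mean \<open>n T\<close>, whatever the policy.

  Upper bound for \<open>V\<close>: given the queue lengths, the residual service times just after an arrival
  are independent and exponential. Therefore, for every \<open>\<delta> > 0\<close>, the process
  \<open>exp (F - n (exp \<theta> + exp (- \<theta>) - 2 + \<delta>) t)\<close>, observed at arrivals, decays geometrically
  in mean, where \<open>F\<close> is \<open>\<theta>\<close> times the number of jobs in excess of one per server minus a concave
  function of the number of idle servers that flattens out once a small fraction of the servers is
  idle. Beyond that point arrivals join idle servers except with a probability that vanishes because
  \<open>d \<rightarrow> \<infinity>\<close>. On \<open>V\<close> the function \<open>F\<close> reaches \<open>\<theta> (j - 2) n\<close>.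

  For \<open>d = n\<close> a queue of length \<open>j\<close> can only form when all queues have length at least \<open>j - 1\<close>, so
  that \<open>U\<close> is almost surely contained in \<open>V\<close> and all limits agree.
\<close>

text \<open>Three choices need a reason. (1) \<open>rate j T\<close> is the minimum of
  \<open>T * ell a + T * ell b\<close> subject to \<open>a - b = (j - 2) / T\<close>; stationarity
  gives \<open>a * b = 1\<close>. So the lower bound aims at about \<open>a T n\<close> arrivals and
  \<open>b T n\<close> departures, and the upper bound tilts by \<theta> = ln a. (2) With \<theta>
  times the total number of jobs as exponent, the one-step decay would fail: if a positive fraction
  of the servers idles, departures are too rare to compensate the arrivals. So idle servers may
  count only up to a small fraction of n. The fading starts at \<epsilon> n idle servers, where a
  sample of growing size finds an idle one with high probability, and is linear over a range
  proportional to n, so that the boundedly many departures typical of one gap hardly change the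
  slope. (3) Conditioning residual times on queue lengths would involve vectors of random size. The
  residuals are instead embedded in an infinite array whose entries past the queue ends are
  artificial exponential fillers. Its law is one fixed product measure, and being fresh given the
  lengths becomes an identity of integrals.\<close>

subsection \<open>Decoupling independent inputs\<close>

text \<open>The identity, read as a map into the two generated sigma-algebras, yields two
  independent variables, so the diagonal point (x, x) has a product law. This replaces conditional
  expectations throughout: freeze one group of inputs and integrate over the other.\<close>

lemma (in prob_space) nn_integral_decouple:
  assumes ind: "indep_sets E (A \<union> B)" and disj: "A \<inter> B = {}"
    and stable: "\<And>i. i \<in> A \<union> B \<Longrightarrow> Int_stable (E i)"
    and h: "(\<lambda>(x, y). h x y) \<in> borel_measurable
      (sigma (space M) (\<Union>i\<in>A. E i) \<Otimes>\<^sub>M sigma (space M) (\<Union>i\<in>B. E i))"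
  shows "(\<integral>\<^sup>+x. h x x \<partial>M) = (\<integral>\<^sup>+x. \<integral>\<^sup>+y. h x y \<partial>M \<partial>M)"
proof -
  let ?FA = "sigma (space M) (\<Union>i\<in>A. E i)" and ?FB = "sigma (space M) (\<Union>i\<in>B. E i)"
  have E: "E i \<subseteq> events" if "i \<in> A \<union> B" for i
    using ind that by (auto simp: indep_sets_def)
  then have EA: "(\<Union>i\<in>A. E i) \<subseteq> Pow (space M)" and EB: "(\<Union>i\<in>B. E i) \<subseteq> Pow (space M)"
    using sets.space_closed by blast+
  have sets: "sets ?FA \<subseteq> events" "sets ?FB \<subseteq> events"
    using E by (auto simp: sets_measure_of[OF EA] sets_measure_of[OF EB] intro!: sets.sigma_sets_subset)
  have space: "space ?FA = space M" "space ?FB = space M"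
    using EA EB by (auto simp: space_measure_of)
  have meas: "(\<lambda>x. x) \<in> M \<rightarrow>\<^sub>M ?FA" "(\<lambda>x. x) \<in> M \<rightarrow>\<^sub>M ?FB"
    using sets space by (auto simp: measurable_def Int_absorb1 dest: sets.sets_into_space)
  have "indep_sets (\<lambda>j. sigma_sets (space M) (\<Union>i\<in>case_bool A B j. E i)) UNIV"
    using disj stable ind
    by (intro indep_sets_collect_sigma) (auto simp: UNIV_bool disjoint_family_on_def Un_commute split: bool.splits)
  also have "(\<lambda>j. sigma_sets (space M) (\<Union>i\<in>case_bool A B j. E i)) =
      case_bool (sigma_sets (space M) (\<Union>i\<in>A. E i)) (sigma_sets (space M) (\<Union>i\<in>B. E i))"
    by (auto split: bool.splits)
  finally have indep: "indep_set (sigma_sets (space M) (\<Union>i\<in>A. E i)) (sigma_sets (space M) (\<Union>i\<in>B. E i))"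
    unfolding indep_set_def .
  \<comment> \<open>\<open>indep_var_eq\<close> asks for the sigma-algebras generated by preimages;
    for the identity these are the given ones.\<close>
  have "sigma_sets (space M) {(\<lambda>x. x) -` X \<inter> space M |X. X \<in> sets F} = sets F"
    if "space F = space M" for F :: "'a measure"
  proof -
    have "{(\<lambda>x. x) -` X \<inter> space M |X. X \<in> sets F} = sets F"
      using sets.sets_into_space[of _ F] that by (auto simp: Int_absorb2)
    then show ?thesis
      using that sets.sigma_sets_eq[of F] by auto
  qed
  from this[OF space(1)] this[OF space(2)]
  have "indep_var ?FA (\<lambda>x. x) ?FB (\<lambda>x. x)"
    using meas indep by (auto simp: indep_var_eq sets_measure_of[OF EA] sets_measure_of[OF EB])
  then have eq: "distr M ?FA (\<lambda>x. x) \<Otimes>\<^sub>M distr M ?FB (\<lambda>x. x) = distr M (?FA \<Otimes>\<^sub>M ?FB) (\<lambda>x. (x, x))"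
    by (simp add: indep_var_distribution_eq)
  interpret A: prob_space "distr M ?FA (\<lambda>x. x)" by (rule prob_space_distr[OF meas(1)])
  interpret B: prob_space "distr M ?FB (\<lambda>x. x)" by (rule prob_space_distr[OF meas(2)])
  have h': "(\<lambda>(x, y). h x y) \<in> borel_measurable (distr M ?FA (\<lambda>x. x) \<Otimes>\<^sub>M distr M ?FB (\<lambda>x. x))"
    using h by (simp cong: measurable_cong_sets)
  have hx: "h x \<in> borel_measurable ?FB" if "x \<in> space M" for x
    using measurable_compose[OF measurable_Pair1' h, of x] that space by simp
  have hm: "(\<lambda>x. \<integral>\<^sup>+y. h x y \<partial>distr M ?FB (\<lambda>x. x)) \<in> borel_measurable ?FA"
    using B.borel_measurable_nn_integral[OF h'] by simp
  have "(\<integral>\<^sup>+x. h x x \<partial>M) = (\<integral>\<^sup>+p. (case p of (x, y) \<Rightarrow> h x y) \<partial>distr M (?FA \<Otimes>\<^sub>M ?FB) (\<lambda>x. (x, x)))"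
    using h meas by (subst nn_integral_distr) auto
  also have "\<dots> = (\<integral>\<^sup>+p. (case p of (x, y) \<Rightarrow> h x y) \<partial>(distr M ?FA (\<lambda>x. x) \<Otimes>\<^sub>M distr M ?FB (\<lambda>x. x)))"
    by (simp add: eq)
  also have "\<dots> = (\<integral>\<^sup>+x. \<integral>\<^sup>+y. h x y \<partial>distr M ?FB (\<lambda>x. x) \<partial>distr M ?FA (\<lambda>x. x))"
    using B.nn_integral_fst[OF h'] by simp
  also have "\<dots> = (\<integral>\<^sup>+x. \<integral>\<^sup>+y. h x y \<partial>distr M ?FB (\<lambda>x. x) \<partial>M)"
    using hm meas by (subst nn_integral_distr) auto
  also have "\<dots> = (\<integral>\<^sup>+x. \<integral>\<^sup>+y. h x y \<partial>M \<partial>M)"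
    using hx meas by (intro nn_integral_cong) (auto simp: nn_integral_distr)
  finally show ?thesis .
qed

subsection \<open>Product measures of exponential service times\<close>

definition expo :: "real measure" where
  "expo = density lborel (exponential_density 1)"

definition seqexp :: "(nat \<Rightarrow> real) measure" where
  "seqexp = PiM UNIV (\<lambda>_. expo)"

text \<open>Entry \<open>i\<close> of row \<open>s\<close> is the residual service time of the
  \<open>i\<close>-th job at server \<open>s\<close>, or a filler. Rows are infinite so that the
  space does not depend on the queue lengths.\<close>

definition famexp :: "(nat \<Rightarrow> nat \<Rightarrow> real) measure" where
  "famexp = PiM UNIV (\<lambda>_. seqexp)"

lemma prob_space_expo: "prob_space expo"
  unfolding expo_def by (rule prob_space_exponential_density) simp

lemma prob_space_seqexp: "prob_space seqexp"
  unfolding seqexp_def by (rule prob_space_PiM) (rule prob_space_expo)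

lemma prob_space_famexp: "prob_space famexp"
  unfolding famexp_def by (rule prob_space_PiM) (rule prob_space_seqexp)

lemma sets_expo [measurable_cong, simp]: "sets expo = sets borel"
  by (simp add: expo_def)

lemma space_expo [simp]: "space expo = UNIV"
  by (simp add: expo_def)

lemma sets_seqexp [measurable_cong]: "sets seqexp = sets (PiM UNIV (\<lambda>_. borel))"
  unfolding seqexp_def by (rule sets_PiM_cong) auto

lemma space_seqexp [simp]: "space seqexp = UNIV"
  by (simp add: seqexp_def space_PiM)

lemma sets_famexp [measurable_cong]: "sets famexp = sets (PiM UNIV (\<lambda>_. PiM UNIV (\<lambda>_. borel)))"
  unfolding famexp_def by (rule sets_PiM_cong) (auto simp: sets_seqexp)

lemma space_famexp [simp]: "space famexp = UNIV"
  by (simp add: famexp_def space_PiM)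

text \<open>Resampling one coordinate of an i.i.d. family preserves its law.\<close>

lemma nn_integral_PiM_upd:
  fixes N :: "'a measure"
  assumes N: "prob_space N" and f: "f \<in> borel_measurable (PiM UNIV (\<lambda>_::nat. N))"
  shows "(\<integral>\<^sup>+x. f x \<partial>PiM UNIV (\<lambda>_. N)) = (\<integral>\<^sup>+x. \<integral>\<^sup>+y. f (x(i := y)) \<partial>N \<partial>PiM UNIV (\<lambda>_. N))"
proof -
  let ?P = "PiM UNIV (\<lambda>_::nat. N)"
  interpret N: prob_space N by fact
  interpret P: prob_space ?P using N by (rule prob_space_PiM)
  interpret NP: pair_prob_space N ?P ..
  have upd [measurable]: "(\<lambda>(x, X). X(i := x)) \<in> N \<Otimes>\<^sub>M ?P \<rightarrow>\<^sub>M ?P"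
    using measurable_fun_upd[of UNIV UNIV i snd "N \<Otimes>\<^sub>M ?P" "\<lambda>_. N" fst]
    by (simp add: split_beta')
  have "distr (N \<Otimes>\<^sub>M ?P) ?P (\<lambda>(x, X). X(i := x)) = ?P"
    using distr_pair_PiM_eq_PiM[of UNIV "\<lambda>_. N" i] N by simp
  then have "(\<integral>\<^sup>+x. f x \<partial>?P) = (\<integral>\<^sup>+x. f x \<partial>distr (N \<Otimes>\<^sub>M ?P) ?P (\<lambda>(x, X). X(i := x)))"
    by simp
  also have "\<dots> = (\<integral>\<^sup>+p. f ((\<lambda>(x, X). X(i := x)) p) \<partial>(N \<Otimes>\<^sub>M ?P))"
    using f by (subst nn_integral_distr[OF upd]) auto
  also have "\<dots> = (\<integral>\<^sup>+X. \<integral>\<^sup>+x. f (X(i := x)) \<partial>N \<partial>?P)"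
    using NP.nn_integral_snd[of "\<lambda>(x, X). f (X(i := x))"] measurable_compose[OF upd f]
    by (simp add: split_beta')
  finally show ?thesis .
qed

lemmas nn_integral_seqexp_upd = nn_integral_PiM_upd[OF prob_space_expo, folded seqexp_def]
lemmas nn_integral_famexp_upd = nn_integral_PiM_upd[OF prob_space_seqexp, folded famexp_def]

text \<open>Separates the job in service from the sequence behind it, matching the recursion of
  \<open>advance\<close>.\<close>

lemma nn_integral_seqexp_iter:
  assumes f [measurable]: "f \<in> borel_measurable (PiM UNIV (\<lambda>_. borel))"
  shows "(\<integral>\<^sup>+x. f x \<partial>seqexp) = (\<integral>\<^sup>+w. \<integral>\<^sup>+x. f (case_nat w x) \<partial>seqexp \<partial>expo)"
proof -
  interpret expo: prob_space expo by (rule prob_space_expo)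
  interpret seq: prob_space seqexp by (rule prob_space_seqexp)
  interpret I: sequence_space expo ..
  interpret P: pair_prob_space expo seqexp ..
  have cn [measurable]: "(\<lambda>(w, x). case_nat w x) \<in> expo \<Otimes>\<^sub>M seqexp \<rightarrow>\<^sub>M seqexp"
    unfolding seqexp_def by (simp add: split_beta') measurable
  have f' [measurable]: "f \<in> borel_measurable seqexp"
    using f by (simp cong: measurable_cong_sets add: sets_seqexp)
  have "(\<integral>\<^sup>+x. f x \<partial>seqexp) = (\<integral>\<^sup>+x. f x \<partial>distr (expo \<Otimes>\<^sub>M seqexp) seqexp (\<lambda>(s, \<omega>). case_nat s \<omega>))"
    using I.PiM_iter by (simp add: seqexp_def)
  also have "\<dots> = (\<integral>\<^sup>+p. f ((\<lambda>(s, \<omega>). case_nat s \<omega>) p) \<partial>(expo \<Otimes>\<^sub>M seqexp))"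
    using f' by (subst nn_integral_distr[OF cn]) auto
  also have "\<dots> = (\<integral>\<^sup>+w. \<integral>\<^sup>+x. f (case_nat w x) \<partial>seqexp \<partial>expo)"
    using measurable_compose[OF cn f'] seq.nn_integral_fst[of "\<lambda>(w, x). f (case_nat w x)" expo]
    by (simp add: split_beta')
  finally show ?thesis .
qed

text \<open>Lack of memory in unnormalised form. A constant \<open>K\<close> gives the tail
  probability, which is how the lemma is often used.\<close>

lemma nn_integral_expo_shift:
  assumes g: "0 \<le> g" and K [measurable]: "K \<in> borel_measurable borel"
  shows "(\<integral>\<^sup>+w. (if g < w then K (w - g) else 0) \<partial>expo) = ennreal (exp (- g)) * (\<integral>\<^sup>+w. K w \<partial>expo)"
proof -
  have "(\<integral>\<^sup>+w. (if g < w then K (w - g) else 0) \<partial>expo) =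
      (\<integral>\<^sup>+w. ennreal (exponential_density 1 w) * (if g < w then K (w - g) else 0) \<partial>lborel)"
    unfolding expo_def by (rule nn_integral_density) (auto simp: exponential_density_def)
  also have "\<dots> = (\<integral>\<^sup>+u. ennreal (exponential_density 1 (g + 1 * u)) * (if g < g + 1 * u then K (g + 1 * u - g) else 0) \<partial>lborel)"
    by (subst nn_integral_real_affine[of _ 1 g]) (auto simp: exponential_density_def)
  \<comment> \<open>The integrands differ only at \<open>u = 0\<close>, where the strict inequality
    fails although the density does not vanish.\<close>
  also have "\<dots> = (\<integral>\<^sup>+u. ennreal (exp (- g)) * (ennreal (exponential_density 1 u) * K u) \<partial>lborel)"
    using g
    by (intro nn_integral_cong_AE eventually_mono[OF AE_lborel_singleton[of 0]])
       (auto simp: exponential_density_def exp_diff exp_minus field_simps ennreal_mult[symmetric] mult.assoc[symmetric])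
  also have "\<dots> = ennreal (exp (- g)) * (\<integral>\<^sup>+u. ennreal (exponential_density 1 u) * K u \<partial>lborel)"
    by (rule nn_integral_cmult) (auto simp: exponential_density_def)
  also have "(\<integral>\<^sup>+u. ennreal (exponential_density 1 u) * K u \<partial>lborel) = (\<integral>\<^sup>+w. K w \<partial>expo)"
    unfolding expo_def by (rule nn_integral_density[symmetric]) (auto simp: exponential_density_def)
  finally show ?thesis .
qed

subsection \<open>Lack of memory of a FIFO server\<close>

text \<open>FIFO service for a time \<open>g\<close> of \<open>m\<close> jobs with requirements
  \<open>x 0\<close>, \<open>x 1\<close> and so on: completed entries are dropped, the rest moves up
  together with the fillers, and the entry in service loses the time already spent. A job that
  completes exactly at \<open>g\<close> has left, as in \<open>jobs_present\<close>.\<close>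

primrec advance :: "nat \<Rightarrow> real \<Rightarrow> (nat \<Rightarrow> real) \<Rightarrow> nat \<times> (nat \<Rightarrow> real)" where
  "advance 0 g x = (0, x)"
| "advance (Suc m) g x =
     (if g < x 0 then (Suc m, x(0 := x 0 - g)) else advance m (g - x 0) (\<lambda>i. x (Suc i)))"

lemma measurable_PiM_nat_iff:
  "f \<in> N \<rightarrow>\<^sub>M PiM UNIV (\<lambda>_::nat. P) \<longleftrightarrow> (\<forall>i. (\<lambda>x. f x i) \<in> N \<rightarrow>\<^sub>M P)"
proof safe
  fix i assume f: "f \<in> N \<rightarrow>\<^sub>M PiM UNIV (\<lambda>_::nat. P)"
  show "(\<lambda>x. f x i) \<in> N \<rightarrow>\<^sub>M P"
    by (rule measurable_compose[OF f]) simp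
qed (auto intro!: measurable_PiM_single' dest: measurable_space simp: space_PiM)

lemma measurable_upd_nat:
  assumes f: "f \<in> N \<rightarrow>\<^sub>M PiM UNIV (\<lambda>_::nat. P)" and g: "g \<in> N \<rightarrow>\<^sub>M P"
  shows "(\<lambda>x. (f x)(i := g x)) \<in> N \<rightarrow>\<^sub>M PiM UNIV (\<lambda>_::nat. P)"
  unfolding measurable_PiM_nat_iff
proof
  fix k show "(\<lambda>x. ((f x)(i := g x)) k) \<in> N \<rightarrow>\<^sub>M P"
    using f g by (cases "k = i") (auto simp: measurable_PiM_nat_iff)
qed

lemma measurable_case_nat_seq:
  assumes f: "f \<in> N \<rightarrow>\<^sub>M P" and g: "g \<in> N \<rightarrow>\<^sub>M PiM UNIV (\<lambda>_::nat. P)"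
  shows "(\<lambda>x. case_nat (f x) (g x)) \<in> N \<rightarrow>\<^sub>M PiM UNIV (\<lambda>_::nat. P)"
  unfolding measurable_PiM_nat_iff
proof
  fix k show "(\<lambda>x. case_nat (f x) (g x) k) \<in> N \<rightarrow>\<^sub>M P"
    using f g by (cases k) (auto simp: measurable_PiM_nat_iff)
qed

lemma measurable_advance:
  assumes "g \<in> borel_measurable N" "x \<in> N \<rightarrow>\<^sub>M PiM UNIV (\<lambda>_. borel)"
  shows "(\<lambda>\<omega>. advance m (g \<omega>) (x \<omega>)) \<in> N \<rightarrow>\<^sub>M count_space UNIV \<Otimes>\<^sub>M PiM UNIV (\<lambda>_. borel)"
  using assms
proof (induction m arbitrary: g x)
  case 0
  then show ?case by simp
next
  case (Suc m)
  have [measurable]: "g \<in> borel_measurable N" by fact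
  have x: "(\<lambda>\<omega>. x \<omega> i) \<in> borel_measurable N" for i
    using Suc.prems(2) by (auto simp: measurable_PiM_nat_iff)
  note x[measurable]
  have "(\<lambda>\<omega>. advance m (g \<omega> - x \<omega> 0) (\<lambda>i. x \<omega> (Suc i))) \<in> N \<rightarrow>\<^sub>M count_space UNIV \<Otimes>\<^sub>M PiM UNIV (\<lambda>_. borel)"
    by (rule Suc.IH) (auto simp: measurable_PiM_nat_iff)
  moreover have "(\<lambda>\<omega>. (x \<omega>)(0 := x \<omega> 0 - g \<omega>)) \<in> N \<rightarrow>\<^sub>M PiM UNIV (\<lambda>_. borel)"
    using Suc.prems(2) by (intro measurable_upd_nat) auto
  ultimately show ?case
    by (auto intro!: measurable_If measurable_Pair)
qed

lemma measurable_fst_advance: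
  assumes "g \<in> borel_measurable N" "x \<in> N \<rightarrow>\<^sub>M PiM UNIV (\<lambda>_. borel)"
  shows "(\<lambda>\<omega>. fst (advance m (g \<omega>) (x \<omega>))) \<in> N \<rightarrow>\<^sub>M count_space UNIV"
  by (rule measurable_compose[OF measurable_advance[OF assms] measurable_fst])

lemma measurable_snd_advance:
  assumes "g \<in> borel_measurable N" "x \<in> N \<rightarrow>\<^sub>M PiM UNIV (\<lambda>_. borel)"
  shows "(\<lambda>\<omega>. snd (advance m (g \<omega>) (x \<omega>))) \<in> N \<rightarrow>\<^sub>M PiM UNIV (\<lambda>_. borel)"
  by (rule measurable_compose[OF measurable_advance[OF assms] measurable_snd])

text \<open>The remaining sequence is again i.i.d. exponential and independent of the remaining
  number of jobs. Either the head survives, and lack of memory renews it, or it completes at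
  \<open>w\<close> and an untouched sequence is served for the time \<open>g - w\<close>, which is
  the induction hypothesis.\<close>

lemma nn_integral_advance:
  fixes H :: "nat \<Rightarrow> (nat \<Rightarrow> real) \<Rightarrow> ennreal"
  assumes H: "(\<lambda>(k, y). H k y) \<in> borel_measurable (count_space UNIV \<Otimes>\<^sub>M PiM UNIV (\<lambda>_. borel))"
    and g: "0 \<le> g"
  shows "(\<integral>\<^sup>+x. H (fst (advance m g x)) (snd (advance m g x)) \<partial>seqexp) =
    (\<integral>\<^sup>+x. \<integral>\<^sup>+y. H (fst (advance m g x)) y \<partial>seqexp \<partial>seqexp)"
  using g
proof (induction m arbitrary: g)
  case 0
  interpret seq: prob_space seqexp by (rule prob_space_seqexp)
  show ?case using seq.emeasure_space_1 by simp
next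
  case (Suc m)
  interpret expo: prob_space expo by (rule prob_space_expo)
  interpret seq: prob_space seqexp by (rule prob_space_seqexp)
  have Hk: "H k \<in> borel_measurable (PiM UNIV (\<lambda>_. borel))" for k
    using measurable_compose[OF measurable_Pair1' H, of k] by simp
  have id: "(\<lambda>x. x) \<in> seqexp \<rightarrow>\<^sub>M PiM UNIV (\<lambda>_. borel)"
    by (rule measurable_ident_sets) (simp add: sets_seqexp)
  define Hb where "Hb k = (\<integral>\<^sup>+y. H k y \<partial>seqexp)" for k
  define A where "A w = (\<integral>\<^sup>+y. Hb (fst (advance m (g - w) y)) \<partial>seqexp)" for w
  have eqs: "advance (Suc m) g (case_nat w y) =
      (if g < w then (Suc m, case_nat (w - g) y) else advance m (g - w) y)" for w y
    by (auto simp: fun_eq_iff split: nat.split)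
  have "(\<lambda>(w, y). Hb (fst (advance m (g - w) y))) \<in> borel_measurable (borel \<Otimes>\<^sub>M seqexp)"
    unfolding split_beta'
    by (rule measurable_compose[OF measurable_fst_advance])
      (auto intro!: measurable_compose[OF measurable_snd id])
  then have A [measurable]: "A \<in> borel_measurable borel"
    unfolding A_def by (rule seq.borel_measurable_nn_integral)
  define K where "K u = (\<integral>\<^sup>+y. H (Suc m) (case_nat u y) \<partial>seqexp)" for u
  have "(\<lambda>(u, y). H (Suc m) (case_nat u y)) \<in> borel_measurable (borel \<Otimes>\<^sub>M seqexp)"
    unfolding split_beta'
    by (rule measurable_compose[OF measurable_case_nat_seq Hk])
      (auto intro!: measurable_compose[OF measurable_snd id])
  then have K [measurable]: "K \<in> borel_measurable borel"
    unfolding K_def by (rule seq.borel_measurable_nn_integral)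
  have "(\<lambda>x. case advance (Suc m) g x of (k, y) \<Rightarrow> H k y) \<in> borel_measurable (PiM UNIV (\<lambda>_. borel))"
    by (rule measurable_compose[OF measurable_advance[OF measurable_const measurable_ident_sets] H]) simp_all
  then have "(\<lambda>x. H (fst (advance (Suc m) g x)) (snd (advance (Suc m) g x))) \<in> borel_measurable (PiM UNIV (\<lambda>_. borel))"
    by (simp only: split_beta')
  then have "(\<integral>\<^sup>+x. H (fst (advance (Suc m) g x)) (snd (advance (Suc m) g x)) \<partial>seqexp) =
      (\<integral>\<^sup>+w. \<integral>\<^sup>+y. H (fst (advance (Suc m) g (case_nat w y))) (snd (advance (Suc m) g (case_nat w y))) \<partial>seqexp \<partial>expo)"
    by (rule nn_integral_seqexp_iter)
  also have "\<dots> = (\<integral>\<^sup>+w. (if g < w then K (w - g) else 0) + (if g < w then 0 else A w) \<partial>expo)"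
  proof (rule nn_integral_cong)
    fix w
    show "(\<integral>\<^sup>+y. H (fst (advance (Suc m) g (case_nat w y))) (snd (advance (Suc m) g (case_nat w y))) \<partial>seqexp) =
      (if g < w then K (w - g) else 0) + (if g < w then 0 else A w)"
      using Suc.IH[of "g - w"] unfolding eqs K_def Hb_def A_def by (cases "g < w") simp_all
  qed
  also have "\<dots> = (\<integral>\<^sup>+w. (if g < w then K (w - g) else 0) \<partial>expo) + (\<integral>\<^sup>+w. (if g < w then 0 else A w) \<partial>expo)"
    by (rule nn_integral_add) auto
  \<comment> \<open>Both sides equal \<open>exp (- g) * Hb (Suc m)\<close>: a renewed head in front
    of a fresh tail is a fresh sequence.\<close>
  also have "(\<integral>\<^sup>+w. (if g < w then K (w - g) else 0) \<partial>expo) = (\<integral>\<^sup>+w. (if g < w then Hb (Suc m) else 0) \<partial>expo)"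
  proof -
    have "(\<integral>\<^sup>+w. K w \<partial>expo) = Hb (Suc m)"
      unfolding K_def Hb_def by (rule nn_integral_seqexp_iter[OF Hk, symmetric])
    moreover have "(\<integral>\<^sup>+w. Hb (Suc m) \<partial>expo) = Hb (Suc m)"
      using expo.emeasure_space_1 by simp
    ultimately show ?thesis
      using nn_integral_expo_shift[OF Suc.prems K] nn_integral_expo_shift[OF Suc.prems, of "\<lambda>_. Hb (Suc m)"]
      by simp
  qed
  also have "\<dots> + (\<integral>\<^sup>+w. (if g < w then 0 else A w) \<partial>expo) =
     (\<integral>\<^sup>+w. (if g < w then Hb (Suc m) else 0) + (if g < w then 0 else A w) \<partial>expo)"
    by (rule nn_integral_add[symmetric]) auto
  also have "\<dots> = (\<integral>\<^sup>+w. \<integral>\<^sup>+y. Hb (fst (advance (Suc m) g (case_nat w y))) \<partial>seqexp \<partial>expo)"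
  proof (rule nn_integral_cong)
    fix w
    show "(if g < w then Hb (Suc m) else 0) + (if g < w then 0 else A w) =
      (\<integral>\<^sup>+y. Hb (fst (advance (Suc m) g (case_nat w y))) \<partial>seqexp)"
      using seq.emeasure_space_1 unfolding eqs A_def by (cases "g < w") simp_all
  qed
  also have "\<dots> = (\<integral>\<^sup>+x. Hb (fst (advance (Suc m) g x)) \<partial>seqexp)"
    by (rule nn_integral_seqexp_iter[symmetric], rule measurable_compose[OF measurable_fst_advance[OF measurable_const measurable_ident_sets]])
       simp_all
  finally show ?case by (simp add: Hb_def)
qed

subsection \<open>Lack of memory of the system\<close>

definition len_space :: "(nat \<Rightarrow> nat) measure" where
  "len_space = PiM UNIV (\<lambda>_. count_space UNIV)"

definition res_space :: "(nat \<Rightarrow> nat \<Rightarrow> real) measure" where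
  "res_space = PiM UNIV (\<lambda>_. PiM UNIV (\<lambda>_. borel))"

lemma space_len_space [simp]: "space len_space = UNIV" and space_res_space [simp]: "space res_space = UNIV"
  by (simp_all add: len_space_def res_space_def space_PiM)

lemma sets_famexp_res [measurable_cong]: "sets famexp = sets res_space"
  by (simp add: sets_famexp res_space_def)

lemma measurable_len_space_iff:
  "f \<in> N \<rightarrow>\<^sub>M len_space \<longleftrightarrow> (\<forall>s. (\<lambda>x. f x s) \<in> N \<rightarrow>\<^sub>M count_space UNIV)"
  by (simp add: len_space_def measurable_PiM_nat_iff)

lemma measurable_res_space_iff:
  "f \<in> N \<rightarrow>\<^sub>M res_space \<longleftrightarrow> (\<forall>s. (\<lambda>x. f x s) \<in> N \<rightarrow>\<^sub>M PiM UNIV (\<lambda>_. borel))"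
  by (simp add: res_space_def measurable_PiM_nat_iff)

lemma measurable_len_upd:
  assumes "m \<in> N \<rightarrow>\<^sub>M len_space" "k \<in> N \<rightarrow>\<^sub>M count_space UNIV"
  shows "(\<lambda>x. (m x)(s := k x)) \<in> N \<rightarrow>\<^sub>M len_space"
  using assms unfolding len_space_def by (rule measurable_upd_nat)

lemma measurable_res_upd:
  assumes "r \<in> N \<rightarrow>\<^sub>M res_space" "y \<in> N \<rightarrow>\<^sub>M PiM UNIV (\<lambda>_. borel)"
  shows "(\<lambda>x. (r x)(s := y x)) \<in> N \<rightarrow>\<^sub>M res_space"
  using assms unfolding res_space_def by (rule measurable_upd_nat)

text \<open>Servers from \<open>n\<close> on stay frozen, so that an induction on \<open>n\<close>
  can add one server at a time.\<close>

definition adv_len :: "nat \<Rightarrow> real \<Rightarrow> (nat \<Rightarrow> nat) \<Rightarrow> (nat \<Rightarrow> nat \<Rightarrow> real) \<Rightarrow> nat \<Rightarrow> nat" where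
  "adv_len n g m r = (\<lambda>s. if s < n then fst (advance (m s) g (r s)) else m s)"

definition adv_res :: "nat \<Rightarrow> real \<Rightarrow> (nat \<Rightarrow> nat) \<Rightarrow> (nat \<Rightarrow> nat \<Rightarrow> real) \<Rightarrow> nat \<Rightarrow> nat \<Rightarrow> real" where
  "adv_res n g m r = (\<lambda>s. if s < n then snd (advance (m s) g (r s)) else r s)"

lemma adv_Suc:
  "adv_len (Suc n) g m r = (adv_len n g m r)(n := fst (advance (m n) g (r n)))"
  "adv_res (Suc n) g m r = (adv_res n g m r)(n := snd (advance (m n) g (r n)))"
  by (auto simp: adv_len_def adv_res_def fun_eq_iff less_Suc_eq)

lemma adv_fun_upd:
  "adv_len n g m (r(n := x)) = adv_len n g m r"
  "adv_res n g m (r(n := x)) = (adv_res n g m r)(n := x)"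
  by (auto simp: adv_len_def adv_res_def fun_eq_iff)

lemma measurable_adv_len:
  assumes "g \<in> borel_measurable N" "m \<in> N \<rightarrow>\<^sub>M len_space" "r \<in> N \<rightarrow>\<^sub>M res_space"
  shows "(\<lambda>\<omega>. adv_len n (g \<omega>) (m \<omega>) (r \<omega>)) \<in> N \<rightarrow>\<^sub>M len_space"
  unfolding measurable_len_space_iff
proof
  fix s
  have "(\<lambda>\<omega>. fst (advance (m \<omega> s) (g \<omega>) (r \<omega> s))) \<in> N \<rightarrow>\<^sub>M count_space UNIV"
    using assms unfolding measurable_len_space_iff measurable_res_space_iff
    by (intro measurable_compose_countable[of "\<lambda>k \<omega>. fst (advance k (g \<omega>) (r \<omega> s))" N _ "\<lambda>\<omega>. m \<omega> s"]
        measurable_fst_advance) auto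
  then show "(\<lambda>\<omega>. adv_len n (g \<omega>) (m \<omega>) (r \<omega>) s) \<in> N \<rightarrow>\<^sub>M count_space UNIV"
    using assms(2) by (cases "s < n") (auto simp: adv_len_def measurable_len_space_iff)
qed

lemma measurable_adv_res:
  assumes "g \<in> borel_measurable N" "m \<in> N \<rightarrow>\<^sub>M len_space" "r \<in> N \<rightarrow>\<^sub>M res_space"
  shows "(\<lambda>\<omega>. adv_res n (g \<omega>) (m \<omega>) (r \<omega>)) \<in> N \<rightarrow>\<^sub>M res_space"
  unfolding measurable_res_space_iff
proof
  fix s
  have "(\<lambda>\<omega>. snd (advance (m \<omega> s) (g \<omega>) (r \<omega> s))) \<in> N \<rightarrow>\<^sub>M PiM UNIV (\<lambda>_. borel)"
    using assms unfolding measurable_len_space_iff measurable_res_space_iff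
    by (intro measurable_compose_countable[of "\<lambda>k \<omega>. snd (advance k (g \<omega>) (r \<omega> s))" N _ "\<lambda>\<omega>. m \<omega> s"]
        measurable_snd_advance) auto
  then show "(\<lambda>\<omega>. adv_res n (g \<omega>) (m \<omega>) (r \<omega>) s) \<in> N \<rightarrow>\<^sub>M PiM UNIV (\<lambda>_. borel)"
    using assms(3) by (cases "s < n") (auto simp: adv_res_def measurable_res_space_iff)
qed

declare measurable_len_upd [measurable (raw)] measurable_res_upd [measurable (raw)]
  measurable_adv_len [measurable (raw)] measurable_adv_res [measurable (raw)]

text \<open>Rows are independent, so the one-server statement is applied to row \<open>n\<close> and
  the induction hypothesis to the rest.\<close>

lemma nn_integral_adv_all:
  fixes H :: "(nat \<Rightarrow> nat) \<times> (nat \<Rightarrow> nat \<Rightarrow> real) \<Rightarrow> ennreal"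
  assumes H: "H \<in> borel_measurable (len_space \<Otimes>\<^sub>M res_space)"
    and g: "0 \<le> g"
  shows "(\<integral>\<^sup>+r. H (adv_len n g m r, adv_res n g m r) \<partial>famexp) =
    (\<integral>\<^sup>+r. \<integral>\<^sup>+r'. H (adv_len n g m r, r') \<partial>famexp \<partial>famexp)"
  using H
proof (induction n arbitrary: H)
  case 0
  interpret fam: prob_space famexp by (rule prob_space_famexp)
  show ?case using fam.emeasure_space_1 by (simp add: adv_len_def adv_res_def)
next
  case (Suc n)
  note [measurable] = Suc.prems
  interpret fam: prob_space famexp by (rule prob_space_famexp)
  interpret seq: prob_space seqexp by (rule prob_space_seqexp)
  interpret sf: pair_sigma_finite seqexp famexp ..
  have id [measurable]: "(\<lambda>x. x) \<in> seqexp \<rightarrow>\<^sub>M PiM UNIV (\<lambda>_. borel)"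
    by (rule measurable_ident_sets) (simp add: sets_seqexp)
  have idf [measurable]: "(\<lambda>x. x) \<in> famexp \<rightarrow>\<^sub>M res_space"
    by (rule measurable_ident_sets) (rule sets_famexp_res)
  define F where "F x = fst (advance (m n) g x)" for x
  define G where "G x = snd (advance (m n) g x)" for x
  have F [measurable]: "F \<in> PiM UNIV (\<lambda>_. borel) \<rightarrow>\<^sub>M count_space UNIV"
    and G [measurable]: "G \<in> PiM UNIV (\<lambda>_. borel) \<rightarrow>\<^sub>M PiM UNIV (\<lambda>_. borel)"
    unfolding F_def[abs_def] G_def[abs_def]
    by (intro measurable_fst_advance measurable_snd_advance; simp)+
  \<comment> \<open>Row \<open>n\<close> is integrated out twice: \<open>x\<close> determines how
    many of its jobs are left, \<open>y\<close> is the fresh row that replaces it.\<close>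
  define H' where "H' p = (\<integral>\<^sup>+x. \<integral>\<^sup>+y. H ((fst p)(n := F x), (snd p)(n := y)) \<partial>seqexp \<partial>seqexp)" for p
  have H' [measurable]: "H' \<in> borel_measurable (len_space \<Otimes>\<^sub>M res_space)"
    unfolding H'_def by measurable
  define a where "a r = adv_len n g m r" for r
  define b where "b r = adv_res n g m r" for r
  have a [measurable]: "a \<in> res_space \<rightarrow>\<^sub>M len_space" and b [measurable]: "b \<in> res_space \<rightarrow>\<^sub>M res_space"
    unfolding a_def[abs_def] b_def[abs_def] by measurable
  have comp [measurable]: "(\<lambda>r. r n) \<in> res_space \<rightarrow>\<^sub>M PiM UNIV (\<lambda>_. borel)"
    unfolding res_space_def by measurable
  have updI: "(\<integral>\<^sup>+r. f r \<partial>famexp) = (\<integral>\<^sup>+r. \<integral>\<^sup>+x. f (r(n := x)) \<partial>seqexp \<partial>famexp)"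
    if "f \<in> borel_measurable res_space" for f :: "_ \<Rightarrow> ennreal"
    using that by (intro nn_integral_famexp_upd)
      (simp add: res_space_def seqexp_def famexp_def sets_famexp_res cong: measurable_cong_sets)
  have single: "(\<integral>\<^sup>+x. H (l(n := F x), r(n := G x)) \<partial>seqexp) =
      (\<integral>\<^sup>+x. \<integral>\<^sup>+y. H (l(n := F x), r(n := y)) \<partial>seqexp \<partial>seqexp)" for l r
  proof -
    have [measurable]: "l \<in> space len_space" "r \<in> space res_space" by simp_all
    have "(\<lambda>(k, y). H (l(n := k), r(n := y))) \<in> borel_measurable (count_space UNIV \<Otimes>\<^sub>M PiM UNIV (\<lambda>_. borel))"
      by measurable
    from nn_integral_advance[OF this g, of "m n"] show ?thesis
      by (simp add: F_def G_def)
  qed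
  have "(\<integral>\<^sup>+r. H (adv_len (Suc n) g m r, adv_res (Suc n) g m r) \<partial>famexp) =
      (\<integral>\<^sup>+r. \<integral>\<^sup>+x. H ((a r)(n := F x), (b r)(n := G x)) \<partial>seqexp \<partial>famexp)"
    by (subst updI) (measurable, simp add: adv_Suc adv_fun_upd a_def b_def F_def G_def)
  also have "\<dots> = (\<integral>\<^sup>+r. H' (a r, b r) \<partial>famexp)"
    by (simp add: single H'_def)
  also have "\<dots> = (\<integral>\<^sup>+r. \<integral>\<^sup>+r'. H' (a r, r') \<partial>famexp \<partial>famexp)"
    unfolding a_def b_def by (rule Suc.IH) (rule H')
  also have "\<dots> = (\<integral>\<^sup>+r. \<integral>\<^sup>+x. \<integral>\<^sup>+r'. \<integral>\<^sup>+y. H ((a r)(n := F x), r'(n := y)) \<partial>seqexp \<partial>famexp \<partial>seqexp \<partial>famexp)"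
    unfolding H'_def fst_conv snd_conv
    by (intro nn_integral_cong sf.Fubini') measurable
  also have "\<dots> = (\<integral>\<^sup>+r. \<integral>\<^sup>+x. \<integral>\<^sup>+r'. H ((a r)(n := F x), r') \<partial>famexp \<partial>seqexp \<partial>famexp)"
    by (intro nn_integral_cong updI[symmetric]) measurable
  also have "\<dots> = (\<integral>\<^sup>+r. \<integral>\<^sup>+r'. H (adv_len (Suc n) g m r, r') \<partial>famexp \<partial>famexp)"
  proof -
    have "(\<lambda>r. \<integral>\<^sup>+r'. H (adv_len (Suc n) g m r, r') \<partial>famexp) \<in> borel_measurable res_space"
      by measurable
    from updI[OF this] show ?thesis
      by (simp add: adv_Suc adv_fun_upd a_def F_def)
  qed
  finally show ?case .
qed

subsection \<open>Job lists\<close>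

lemma jobs_present_Nil [simp]: "jobs_present [] s t = 0"
  by (simp add: jobs_present_def)

lemma jobs_present_snoc:
  "jobs_present (js @ [(s', a, e)]) s t = jobs_present js s t + (if s' = s \<and> a \<le> t \<and> t < e then 1 else 0)"
  by (simp add: jobs_present_def)

definition num_departed :: "real \<Rightarrow> job list \<Rightarrow> nat" where
  "num_departed T js = length (filter (\<lambda>(s, a, e). e \<le> T) js)"

lemma num_departed_Nil [simp]: "num_departed T [] = 0"
  by (simp add: num_departed_def)

lemma num_departed_snoc: "num_departed T (js @ [(s, a, e)]) = num_departed T js + (if e \<le> T then 1 else 0)"
  by (simp add: num_departed_def)

text \<open>For a job joining server \<open>s\<close> at time \<open>t\<close>, this is the start of
  its service; at an idle server it is \<open>t\<close> itself.\<close>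

definition last_departure :: "job list \<Rightarrow> nat \<Rightarrow> real \<Rightarrow> real" where
  "last_departure js s t = Max (insert t {e. \<exists>a. (s, a, e) \<in> set js})"

lemma enqueue_eq: "enqueue s a v js = js @ [(s, a, v + last_departure js s a)]"
  by (simp add: enqueue_def last_departure_def)

lemma finite_departures [simp]: "finite {e. \<exists>a. (s, a, e) \<in> set js}"
proof -
  have "{e. \<exists>a. (s, a, e) \<in> set js} \<subseteq> (snd \<circ> snd) ` set js" by force
  then show ?thesis using finite_surj by blast
qed

lemma last_departure_Nil [simp]: "last_departure [] s t = t"
  by (simp add: last_departure_def)

lemma last_departure_snoc:
  "last_departure (js @ [(s', a, e)]) s t = (if s' = s then max e (last_departure js s t) else last_departure js s t)"
proof -
  have "{e'. \<exists>a'. (s, a', e') \<in> set (js @ [(s', a, e)])} =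
      (if s' = s then insert e {e'. \<exists>a'. (s, a', e') \<in> set js} else {e'. \<exists>a'. (s, a', e') \<in> set js})"
    by auto
  then show ?thesis
    by (simp add: last_departure_def insert_commute)
qed

lemma last_departure_ge: "t \<le> last_departure js s t"
  by (simp add: last_departure_def)

lemma last_departure_max: "t \<le> t' \<Longrightarrow> last_departure js s t' = max t' (last_departure js s t)"
  by (cases "{e. \<exists>a. (s, a, e) \<in> set js} = {}") (simp_all add: last_departure_def Max_insert)

definition pick :: "(nat \<Rightarrow> nat) \<Rightarrow> nat set \<Rightarrow> (nat \<Rightarrow> nat) \<Rightarrow> nat" where
  "pick m D p = arg_min_on p {s \<in> D. \<forall>r\<in>D. m s \<le> m r}"

lemma shortest_queue_pick: "shortest_queue js t D p = pick (\<lambda>s. jobs_present js s t) D p"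
  by (simp add: shortest_queue_def pick_def)

lemma pick_cong: "(\<And>s. s \<in> D \<Longrightarrow> m s = m' s) \<Longrightarrow> pick m D p = pick m' D p"
  unfolding pick_def by (rule arg_cong[where f="arg_min_on p"]) auto

lemma pick_in:
  assumes "finite D" "D \<noteq> {}"
  shows "pick m D p \<in> D" "r \<in> D \<Longrightarrow> m (pick m D p) \<le> m r"
proof -
  let ?A = "{s \<in> D. \<forall>r\<in>D. m s \<le> m r}"
  obtain s where "s \<in> D" "\<forall>r\<in>D. m s \<le> m r"
    using ex_min_if_finite[of "m ` D"] assms by (metis (no_types, lifting) arg_min_if_finite(1,2) linorder_not_le)
  then have "?A \<noteq> {}" "finite ?A" using assms by auto
  then have "pick m D p \<in> ?A"
    unfolding pick_def using arg_min_if_finite(1)[of ?A p] by blast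
  then show "pick m D p \<in> D" "r \<in> D \<Longrightarrow> m (pick m D p) \<le> m r" by auto
qed

lemma finite_samples: "finite (samples n d)" and samplesD: "D \<in> samples n d \<Longrightarrow> finite D \<and> D \<subseteq> {..<n} \<and> card D = d"
  unfolding samples_def by (auto intro: finite_subset[of _ "Pow {..<n}"] finite_subset[of D "{..<n}"])

lemma finite_rankings: "finite (rankings n)"
  unfolding rankings_def by (rule finite_permutations) simp

lemma jobs_Suc_eq:
  "jobs S n q \<omega> (Suc k) = (let js = jobs S n q \<omega> k; a = arrival_time S k \<omega>;
      s = pick (\<lambda>s. jobs_present js s a) (sampled S k \<omega>) (tie_rank S k \<omega>)
    in js @ [(s, a, work S k \<omega> + last_departure js s a)])"
  by (simp add: Let_def enqueue_eq shortest_queue_pick)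

declare jobs.simps(2) [simp del]

lemma jobs_present_jobs_mono:
  "k \<le> k' \<Longrightarrow> jobs_present (jobs S n q \<omega> k) s t \<le> jobs_present (jobs S n q \<omega> k') s t"
  by (induction k' rule: dec_induct) (auto simp: jobs_Suc_eq Let_def jobs_present_snoc intro: le_trans)

subsection \<open>Measurability of job lists\<close>

lemma measurable_pick:
  assumes m: "m \<in> N \<rightarrow>\<^sub>M len_space" and D: "D \<in> N \<rightarrow>\<^sub>M count_space (samples n d)"
    and p: "p \<in> N \<rightarrow>\<^sub>M count_space (rankings n)"
  shows "(\<lambda>\<omega>. pick (m \<omega>) (D \<omega>) (p \<omega>)) \<in> N \<rightarrow>\<^sub>M count_space UNIV"
proof (rule measurable_compose_countable'[OF _ D countable_finite[OF finite_samples]],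
       rule measurable_compose_countable'[OF _ p countable_finite[OF finite_rankings]])
  fix D' p' assume "D' \<in> samples n d"
  then have fin: "finite D'" by (auto dest: samplesD)
  have ms [measurable]: "(\<lambda>\<omega>. m \<omega> s) \<in> N \<rightarrow>\<^sub>M count_space UNIV" for s
    using m by (auto simp: measurable_len_space_iff)
  have "(\<lambda>\<omega>. {s \<in> D'. \<forall>r\<in>D'. m \<omega> s \<le> m \<omega> r}) \<in> N \<rightarrow>\<^sub>M count_space (Pow D')"
  proof (subst measurable_count_space_eq2)
    have "(\<lambda>\<omega>. {s \<in> D'. \<forall>r\<in>D'. m \<omega> s \<le> m \<omega> r}) -` {B} \<inter> space N \<in> sets N" if "B \<in> Pow D'" for B
    proof -
      have "(\<lambda>\<omega>. {s \<in> D'. \<forall>r\<in>D'. m \<omega> s \<le> m \<omega> r}) -` {B} \<inter> space N =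
          {\<omega> \<in> space N. \<forall>s\<in>D'. (s \<in> B \<longleftrightarrow> (\<forall>r\<in>D'. m \<omega> s \<le> m \<omega> r))}"
        using that by auto
      also have "\<dots> \<in> sets N"
      proof (rule sets.sets_Collect_finite_All[OF _ fin])
        fix s assume "s \<in> D'"
        have "{\<omega> \<in> space N. \<forall>r\<in>D'. m \<omega> s \<le> m \<omega> r} \<in> sets N"
        proof (rule sets.sets_Collect_finite_All[OF _ fin])
          fix r
          have "Measurable.pred N (\<lambda>\<omega>. m \<omega> s \<le> m \<omega> r)"
            by (rule measurable_compose_countable[OF _ ms[of s], of "\<lambda>k \<omega>. k \<le> m \<omega> r"]) measurable
          then show "{\<omega> \<in> space N. m \<omega> s \<le> m \<omega> r} \<in> sets N"
            by (simp add: pred_def)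
        qed
        then show "{\<omega> \<in> space N. (s \<in> B) = (\<forall>r\<in>D'. m \<omega> s \<le> m \<omega> r)} \<in> sets N"
          by (cases "s \<in> B") (auto dest: sets.sets_Collect_neg)
      qed
      finally show ?thesis .
    qed
    then show "(\<lambda>\<omega>. {s \<in> D'. \<forall>r\<in>D'. m \<omega> s \<le> m \<omega> r}) \<in> space N \<rightarrow> Pow D' \<and>
        (\<forall>a\<in>Pow D'. (\<lambda>\<omega>. {s \<in> D'. \<forall>r\<in>D'. m \<omega> s \<le> m \<omega> r}) -` {a} \<inter> space N \<in> sets N)"
      by auto
  qed (use fin in simp)
  then show "(\<lambda>\<omega>. pick (m \<omega>) D' p') \<in> N \<rightarrow>\<^sub>M count_space UNIV"
    unfolding pick_def by (rule measurable_compose) simp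
qed

definition measurable_inputs :: "'w measure \<Rightarrow> 'w jsq_input \<Rightarrow> nat \<Rightarrow> nat \<Rightarrow> (nat \<Rightarrow> nat) \<Rightarrow> nat \<Rightarrow> bool" where
  "measurable_inputs N S n d q k \<longleftrightarrow>
     (\<forall>i<k. arr_gap S i \<in> borel_measurable N \<and> work S i \<in> borel_measurable N \<and>
        sampled S i \<in> N \<rightarrow>\<^sub>M count_space (samples n d) \<and> tie_rank S i \<in> N \<rightarrow>\<^sub>M count_space (rankings n)) \<and>
     (\<forall>s<n. \<forall>m<q s. init_work S s m \<in> borel_measurable N)"

lemma measurable_inputs_mono: "measurable_inputs N S n d q k \<Longrightarrow> i \<le> k \<Longrightarrow> measurable_inputs N S n d q i"
  by (auto simp: measurable_inputs_def)

lemma measurable_arrival_time: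
  "measurable_inputs N S n d q k \<Longrightarrow> i < k \<Longrightarrow> arrival_time S i \<in> borel_measurable N"
  unfolding arrival_time_def[abs_def] measurable_inputs_def by (intro borel_measurable_sum) auto

text \<open>Job lists get no sigma-algebra of their own; only the three functionals read off them
  matter. Joint measurability in outcome and time is required because they are evaluated at random
  arrival times.\<close>

definition measurable_job_list :: "'w measure \<Rightarrow> ('w \<Rightarrow> job list) \<Rightarrow> bool" where
  "measurable_job_list N f \<longleftrightarrow>
     (\<forall>s. (\<lambda>(\<omega>, t). jobs_present (f \<omega>) s t) \<in> N \<Otimes>\<^sub>M borel \<rightarrow>\<^sub>M count_space UNIV \<and>
        (\<lambda>(\<omega>, t). last_departure (f \<omega>) s t) \<in> borel_measurable (N \<Otimes>\<^sub>M borel)) \<and>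
     (\<lambda>(\<omega>, t). num_departed t (f \<omega>)) \<in> N \<Otimes>\<^sub>M borel \<rightarrow>\<^sub>M count_space UNIV"

lemma measurable_job_listD:
  assumes f: "measurable_job_list N f" and g: "g \<in> N' \<rightarrow>\<^sub>M N" and t: "t \<in> borel_measurable N'"
  shows "(\<lambda>\<omega>. jobs_present (f (g \<omega>)) s (t \<omega>)) \<in> N' \<rightarrow>\<^sub>M count_space UNIV"
    "(\<lambda>\<omega>. last_departure (f (g \<omega>)) s (t \<omega>)) \<in> borel_measurable N'"
    "(\<lambda>\<omega>. num_departed (t \<omega>) (f (g \<omega>))) \<in> N' \<rightarrow>\<^sub>M count_space UNIV"
proof -
  note gt = measurable_Pair[OF g t]
  show "(\<lambda>\<omega>. jobs_present (f (g \<omega>)) s (t \<omega>)) \<in> N' \<rightarrow>\<^sub>M count_space UNIV"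
    using measurable_compose[OF gt, of "\<lambda>(\<omega>, t). jobs_present (f \<omega>) s t"] f
    by (simp add: measurable_job_list_def)
  show "(\<lambda>\<omega>. last_departure (f (g \<omega>)) s (t \<omega>)) \<in> borel_measurable N'"
    using measurable_compose[OF gt, of "\<lambda>(\<omega>, t). last_departure (f \<omega>) s t"] f
    by (simp add: measurable_job_list_def)
  show "(\<lambda>\<omega>. num_departed (t \<omega>) (f (g \<omega>))) \<in> N' \<rightarrow>\<^sub>M count_space UNIV"
    using measurable_compose[OF gt, of "\<lambda>(\<omega>, t). num_departed t (f \<omega>)"] f
    by (simp add: measurable_job_list_def)
qed

lemma measurable_job_list_snoc:
  assumes f: "measurable_job_list N f" and s: "s \<in> N \<rightarrow>\<^sub>M count_space UNIV"
    and a: "a \<in> borel_measurable N" and v: "v \<in> borel_measurable N"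
  shows "measurable_job_list N (\<lambda>\<omega>. f \<omega> @ [(s \<omega>, a \<omega>, v \<omega> + last_departure (f \<omega>) (s \<omega>) (a \<omega>))])"
proof -
  let ?N = "N \<Otimes>\<^sub>M (borel :: real measure)"
  define e where "e \<omega> = v \<omega> + last_departure (f \<omega>) (s \<omega>) (a \<omega>)" for \<omega>
  have e: "e \<in> borel_measurable N"
    unfolding e_def[abs_def]
    by (intro borel_measurable_add v measurable_compose_countable[OF measurable_job_listD(2)[OF f measurable_ident_sets[OF refl] a] s])
  note [measurable] = e a v s
  note jp = measurable_job_listD[OF f measurable_fst measurable_snd]
  have "(\<lambda>p. k + (if s (fst p) = s' \<and> a (fst p) \<le> snd p \<and> snd p < e (fst p) then 1 else 0 :: nat)) \<in> ?N \<rightarrow>\<^sub>M count_space UNIV" for k s'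
    by measurable
  then have "(\<lambda>p. jobs_present (f (fst p)) s' (snd p) + (if s (fst p) = s' \<and> a (fst p) \<le> snd p \<and> snd p < e (fst p) then 1 else 0 :: nat)) \<in> ?N \<rightarrow>\<^sub>M count_space UNIV" for s'
    by (rule measurable_compose_countable) (rule jp)
  moreover have "(\<lambda>p. k + (if e (fst p) \<le> snd p then 1 else 0 :: nat)) \<in> ?N \<rightarrow>\<^sub>M count_space UNIV" for k
    by measurable
  then have "(\<lambda>p. num_departed (snd p) (f (fst p)) + (if e (fst p) \<le> snd p then 1 else 0 :: nat)) \<in> ?N \<rightarrow>\<^sub>M count_space UNIV"
    by (rule measurable_compose_countable) (rule jp)
  moreover have "(\<lambda>p. if s (fst p) = s' then max (e (fst p)) (last_departure (f (fst p)) s' (snd p)) else last_departure (f (fst p)) s' (snd p)) \<in> borel_measurable ?N" for s'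
  proof -
    note [measurable] = jp(2)[of s']
    show ?thesis by measurable
  qed
  ultimately show ?thesis
    unfolding measurable_job_list_def jobs_present_snoc last_departure_snoc num_departed_snoc e_def[symmetric] split_beta'
    by blast
qed

lemma jobs_0_eq:
  "jobs S n q \<omega> 0 = fold (\<lambda>(s, m) js. js @ [(s, 0, init_work S s m \<omega> + last_departure js s 0)])
     [(s, m). s \<leftarrow> [0..<n], m \<leftarrow> [0..<q s]] []"
  by (simp add: enqueue_eq[abs_def] split_beta')

lemma measurable_jobs:
  assumes "measurable_inputs N S n d q k"
  shows "measurable_job_list N (\<lambda>\<omega>. jobs S n q \<omega> k)"
  using assms
proof (induction k)
  case 0
  let ?step = "\<lambda>\<omega> (s, m) js. js @ [(s, 0::real, init_work S s m \<omega> + last_departure js s 0)]"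
  have "measurable_job_list N (\<lambda>\<omega>. fold (?step \<omega>) L [])" if "\<forall>(s, m)\<in>set L. s < n \<and> m < q s" for L
    using that
  proof (induction L rule: rev_induct)
    case Nil
    have "(\<lambda>(\<omega>, t). t) \<in> borel_measurable (N \<Otimes>\<^sub>M (borel :: real measure))"
      by measurable
    then show ?case by (simp add: measurable_job_list_def)
  next
    case (snoc x L)
    obtain s m where x: "x = (s, m)" by force
    have "init_work S s m \<in> borel_measurable N"
      using snoc.prems 0 by (auto simp: measurable_inputs_def x)
    with snoc show ?case
      by (auto simp: x intro!: measurable_job_list_snoc)
  qed
  then show ?case unfolding jobs_0_eq by auto
next
  case (Suc k)
  have IH: "measurable_job_list N (\<lambda>\<omega>. jobs S n q \<omega> k)"
    using Suc.IH Suc.prems measurable_inputs_mono[of N S n d q "Suc k" k] by auto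
  have a: "arrival_time S k \<in> borel_measurable N"
    using Suc.prems by (rule measurable_arrival_time) simp
  have "work S k \<in> borel_measurable N" "sampled S k \<in> N \<rightarrow>\<^sub>M count_space (samples n d)"
    "tie_rank S k \<in> N \<rightarrow>\<^sub>M count_space (rankings n)"
    using Suc.prems by (auto simp: measurable_inputs_def)
  moreover have "(\<lambda>\<omega> s. jobs_present (jobs S n q \<omega> k) s (arrival_time S k \<omega>)) \<in> N \<rightarrow>\<^sub>M len_space"
    using measurable_job_listD(1)[OF IH measurable_ident_sets[OF refl] a] by (auto simp: measurable_len_space_iff)
  ultimately show ?case
    unfolding jobs_Suc_eq Let_def using IH a by (intro measurable_job_list_snoc measurable_pick) auto
qed

subsection \<open>The events\<close>

text \<open>For positive \<open>i\<close> the condition is a strict bound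
  \<open>i - 1 < Sup\<close>, which a single term must witness; this covers an infinite supremum as
  well.\<close>

lemma enat_le_queue_length:
  "enat i \<le> queue_length S n q s t \<omega> \<longleftrightarrow> i = 0 \<or> (\<exists>k. i \<le> jobs_present (jobs S n q \<omega> k) s t)"
proof (cases i)
  case (Suc i')
  have "enat i \<le> queue_length S n q s t \<omega> \<longleftrightarrow> enat i' < queue_length S n q s t \<omega>"
    using Suc by (simp add: Suc_ile_eq)
  also have "\<dots> \<longleftrightarrow> (\<exists>k. i \<le> jobs_present (jobs S n q \<omega> k) s t)"
    unfolding queue_length_def less_SUP_iff using Suc by (simp add: less_eq_Suc_le)
  finally show ?thesis using Suc by simp
qed (simp add: zero_enat_def[symmetric])

lemma occupancy_pos_iff:
  assumes "n \<ge> 1" "i \<ge> 1"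
  shows "occupancy S n q i t \<omega> > 0 \<longleftrightarrow> (\<exists>k. \<exists>s<n. i \<le> jobs_present (jobs S n q \<omega> k) s t)"
  using assms unfolding occupancy_def
  by (auto simp: card_gt_0_iff enat_le_queue_length zero_less_divide_iff)

lemma occupancy_eq_1_iff:
  assumes "n \<ge> 1" "i \<ge> 1"
  shows "occupancy S n q i t \<omega> = 1 \<longleftrightarrow> (\<exists>k. \<forall>s<n. i \<le> jobs_present (jobs S n q \<omega> k) s t)"
proof -
  let ?A = "{s. s < n \<and> enat i \<le> queue_length S n q s t \<omega>}"
  have "occupancy S n q i t \<omega> = 1 \<longleftrightarrow> card ?A = n"
    using assms by (auto simp: occupancy_def field_simps)
  also have "\<dots> \<longleftrightarrow> ?A = {..<n}"
  proof
    assume c: "card ?A = n"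
    show "?A = {..<n}" by (rule card_subset_eq) (auto simp: c)
  next
    assume "?A = {..<n}"
    then show "card ?A = n" by (simp only: card_lessThan)
  qed
  also have "\<dots> \<longleftrightarrow> (\<forall>s<n. \<exists>k. i \<le> jobs_present (jobs S n q \<omega> k) s t)"
    using assms unfolding enat_le_queue_length set_eq_iff mem_Collect_eq lessThan_iff by auto
  \<comment> \<open>Lengths increase with \<open>k\<close>, so the largest of the finitely many
    witnesses serves all servers.\<close>
  also have "\<dots> \<longleftrightarrow> (\<exists>k. \<forall>s<n. i \<le> jobs_present (jobs S n q \<omega> k) s t)"
  proof safe
    assume "\<forall>s<n. \<exists>k. i \<le> jobs_present (jobs S n q \<omega> k) s t"
    then obtain K where K: "s < n \<Longrightarrow> i \<le> jobs_present (jobs S n q \<omega> (K s)) s t" for s by metis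
    have "i \<le> jobs_present (jobs S n q \<omega> (Max (K ` {..<n}))) s t" if "s < n" for s
      using K[OF that] jobs_present_jobs_mono[of "K s" "Max (K ` {..<n})" S n q \<omega> s t] that
      by (auto intro: le_trans)
    then show "\<exists>k. \<forall>s<n. i \<le> jobs_present (jobs S n q \<omega> k) s t" by blast
  qed auto
  finally show ?thesis .
qed

text \<open>Shifted by one against \<open>arrival_time\<close>: epoch 0 is time 0, and epoch
  \<open>k\<close> is the moment at which the job list of index \<open>k\<close> comes into
  force.\<close>

definition epoch :: "'w jsq_input \<Rightarrow> nat \<Rightarrow> 'w \<Rightarrow> real" where
  "epoch S k \<omega> = (\<Sum>i<k. arr_gap S i \<omega>)"

lemma epoch_0 [simp]: "epoch S 0 \<omega> = 0"
  by (simp add: epoch_def)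

lemma epoch_Suc: "epoch S (Suc k) \<omega> = epoch S k \<omega> + arr_gap S k \<omega>"
  by (simp add: epoch_def)

lemma arrival_time_epoch: "arrival_time S k \<omega> = epoch S (Suc k) \<omega>"
  by (simp add: arrival_time_def epoch_def lessThan_Suc_atMost)

lemma arrivals_at_epochs: "(s, a, e) \<in> set (jobs S n q \<omega> k) \<Longrightarrow> \<exists>i\<le>k. a = epoch S i \<omega>"
proof (induction k)
  case 0
  let ?step = "\<lambda>(s, m) js. js @ [(s, 0::real, init_work S s m \<omega> + last_departure js s 0)]"
  have "a = 0" if "(s, a, e) \<in> set (fold ?step L [])" for L
    using that by (induction L rule: rev_induct) (auto split: prod.splits)
  with 0 show ?case unfolding jobs_0_eq by auto
next
  case (Suc k)
  then show ?case
    unfolding jobs_Suc_eq Let_def by (auto simp: arrival_time_epoch intro: le_SucI)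
qed

text \<open>Queue lengths only increase at arrivals.\<close>

lemma jobs_present_at_epoch:
  assumes "0 \<le> t"
  obtains i where "i \<le> k" "0 \<le> epoch S i \<omega>" "epoch S i \<omega> \<le> t"
    "\<And>s. jobs_present (jobs S n q \<omega> k) s t \<le> jobs_present (jobs S n q \<omega> k) s (epoch S i \<omega>)"
proof -
  \<comment> \<open>The latest epoch up to \<open>t\<close>, chosen by value and not by index since
    gaps are not assumed positive here: the conclusion is wanted on the whole space, not merely
    almost surely.\<close>
  let ?E = "{epoch S i \<omega> |i. i \<le> k \<and> epoch S i \<omega> \<le> t}"
  have fin: "finite ?E" by simp
  have 0: "0 \<in> ?E" using assms by (auto intro!: exI[of _ 0])
  then have "Max ?E \<in> ?E" using fin by (intro Max_in) auto
  then obtain i where i: "i \<le> k" "epoch S i \<omega> \<le> t" "Max ?E = epoch S i \<omega>" by auto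
  have "jobs_present (jobs S n q \<omega> k) s t \<le> jobs_present (jobs S n q \<omega> k) s (epoch S i \<omega>)" for s
    unfolding jobs_present_def length_filter_conv_card
  proof (rule card_mono, simp, clarsimp)
    fix l a e
    assume l: "l < length (jobs S n q \<omega> k)" "jobs S n q \<omega> k ! l = (s, a, e)" "a \<le> t" "t < e"
    then have "(s, a, e) \<in> set (jobs S n q \<omega> k)" by (metis nth_mem)
    then have "a \<in> ?E" using arrivals_at_epochs \<open>a \<le> t\<close> by fastforce
    then show "a \<le> epoch S i \<omega> \<and> epoch S i \<omega> < e"
      using i l fin by (metis (no_types, lifting) Max_ge order_le_less_trans)
  qed
  moreover have "0 \<le> epoch S i \<omega>" using Max_ge[OF fin 0] i by simp
  ultimately show ?thesis using that i by blast
qed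

text \<open>Restricting to epochs turns the uncountable union over times into a countable one, from
  which measurability follows.\<close>

lemma event_U_eq:
  assumes "n \<ge> 1" "j \<ge> 1"
  shows "event_U M S n q j T = {\<omega> \<in> space M. \<exists>k. \<exists>i\<le>k. 0 \<le> epoch S i \<omega> \<and> epoch S i \<omega> \<le> T \<and>
    (\<exists>s<n. j \<le> jobs_present (jobs S n q \<omega> k) s (epoch S i \<omega>))}" (is "?L = ?R")
proof safe
  fix \<omega> assume "\<omega> \<in> ?L"
  then obtain t k s where *: "\<omega> \<in> space M" "0 \<le> t" "t \<le> T" "s < n" "j \<le> jobs_present (jobs S n q \<omega> k) s t"
    unfolding event_U_def occupancy_pos_iff[OF assms] by auto
  from jobs_present_at_epoch[OF \<open>0 \<le> t\<close>, of k S \<omega> n q]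
  obtain i where "i \<le> k" "0 \<le> epoch S i \<omega>" "epoch S i \<omega> \<le> t"
    "jobs_present (jobs S n q \<omega> k) s t \<le> jobs_present (jobs S n q \<omega> k) s (epoch S i \<omega>)" by metis
  then show "\<exists>k. \<exists>i\<le>k. 0 \<le> epoch S i \<omega> \<and> epoch S i \<omega> \<le> T \<and> (\<exists>s<n. j \<le> jobs_present (jobs S n q \<omega> k) s (epoch S i \<omega>))"
    using * by (intro exI[of _ k] exI[of _ i] exI[of _ s] conjI) auto
next
  fix \<omega> k i s assume "\<omega> \<in> space M" "i \<le> k" "0 \<le> epoch S i \<omega>" "epoch S i \<omega> \<le> T" "s < n"
    "j \<le> jobs_present (jobs S n q \<omega> k) s (epoch S i \<omega>)"
  then show "\<omega> \<in> ?L"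
    using occupancy_pos_iff[OF assms, of S q "epoch S i \<omega>" \<omega>]
    unfolding event_U_def by (auto intro!: bexI[of _ "epoch S i \<omega>"])
qed (auto simp: event_U_def)

lemma event_V_eq:
  assumes "n \<ge> 1" "j \<ge> 2"
  shows "event_V M S n q j T = {\<omega> \<in> space M. \<exists>k. \<exists>i\<le>k. 0 \<le> epoch S i \<omega> \<and> epoch S i \<omega> \<le> T \<and>
    (\<forall>s<n. j - 1 \<le> jobs_present (jobs S n q \<omega> k) s (epoch S i \<omega>))}" (is "?L = ?R")
proof safe
  have j: "j - 1 \<ge> 1" using assms by simp
  fix \<omega> assume "\<omega> \<in> ?L"
  then obtain t k where *: "\<omega> \<in> space M" "0 \<le> t" "t \<le> T" "\<forall>s<n. j - 1 \<le> jobs_present (jobs S n q \<omega> k) s t"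
    unfolding event_V_def occupancy_eq_1_iff[OF assms(1) j] by auto
  from jobs_present_at_epoch[OF \<open>0 \<le> t\<close>, of k S \<omega> n q]
  obtain i where "i \<le> k" "0 \<le> epoch S i \<omega>" "epoch S i \<omega> \<le> t"
    "\<And>s. jobs_present (jobs S n q \<omega> k) s t \<le> jobs_present (jobs S n q \<omega> k) s (epoch S i \<omega>)" by metis
  then show "\<exists>k. \<exists>i\<le>k. 0 \<le> epoch S i \<omega> \<and> epoch S i \<omega> \<le> T \<and> (\<forall>s<n. j - 1 \<le> jobs_present (jobs S n q \<omega> k) s (epoch S i \<omega>))"
    using * by (intro exI[of _ k] exI[of _ i] conjI) (auto intro: le_trans)
next
  fix \<omega> k i assume "\<omega> \<in> space M" "i \<le> k" "0 \<le> epoch S i \<omega>" "epoch S i \<omega> \<le> T"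
    "\<forall>s<n. j - 1 \<le> jobs_present (jobs S n q \<omega> k) s (epoch S i \<omega>)"
  then show "\<omega> \<in> ?L"
    using assms occupancy_eq_1_iff[of n "j - 1" S q "epoch S i \<omega>" \<omega>]
    unfolding event_V_def by (auto intro!: bexI[of _ "epoch S i \<omega>"] exI[of _ k])
qed (auto simp: event_V_def)

lemma sets_events:
  assumes inp: "\<And>k. measurable_inputs M S n d q k" and n: "n \<ge> 1" and j: "j \<ge> 2"
  shows "event_U M S n q j T \<in> sets M" "event_V M S n q j T \<in> sets M"
proof -
  have ep [measurable]: "epoch S i \<in> borel_measurable M" for i
    unfolding epoch_def[abs_def] using inp[of i] by (intro borel_measurable_sum) (auto simp: measurable_inputs_def)
  have [measurable]: "(\<lambda>\<omega>. jobs_present (jobs S n q \<omega> k) s (epoch S i \<omega>)) \<in> M \<rightarrow>\<^sub>M count_space UNIV" for k s i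
    by (rule measurable_job_listD(1)[OF measurable_jobs[OF inp[of k]] measurable_ident_sets[OF refl] ep[of i]])
  have j1: "j \<ge> 1" using j by simp
  show "event_U M S n q j T \<in> sets M" unfolding event_U_eq[OF n j1] by measurable
  show "event_V M S n q j T \<in> sets M" unfolding event_V_eq[OF n j] by measurable
qed

subsection \<open>Paths of the system\<close>

definition good_path :: "'w jsq_input \<Rightarrow> nat \<Rightarrow> nat \<Rightarrow> (nat \<Rightarrow> nat) \<Rightarrow> 'w \<Rightarrow> bool" where
  "good_path S n d q \<omega> \<longleftrightarrow>
     (\<forall>k. 0 < arr_gap S k \<omega> \<and> 0 < work S k \<omega> \<and> sampled S k \<omega> \<in> samples n d) \<and>
     (\<forall>s<n. \<forall>m<q s. 0 < init_work S s m \<omega>)"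

lemma epoch_mono: "good_path S n d q \<omega> \<Longrightarrow> i \<le> k \<Longrightarrow> epoch S i \<omega> \<le> epoch S k \<omega>"
  unfolding good_path_def epoch_def by (intro sum_mono2) (auto intro: less_imp_le)

lemma epoch_strict_mono: "good_path S n d q \<omega> \<Longrightarrow> i < k \<Longrightarrow> epoch S i \<omega> < epoch S k \<omega>"
  using epoch_mono[of S n d q \<omega> "Suc i" k] by (auto simp: good_path_def epoch_Suc Suc_le_eq intro: less_le_trans[rotated])

lemma epoch_nonneg: "good_path S n d q \<omega> \<Longrightarrow> 0 \<le> epoch S k \<omega>"
  using epoch_mono[of S n d q \<omega> 0 k] by simp

lemma arrivals_le_epoch:
  "good_path S n d q \<omega> \<Longrightarrow> (s, a, e) \<in> set (jobs S n q' \<omega> k) \<Longrightarrow> a \<le> epoch S k \<omega>"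
  using arrivals_at_epochs epoch_mono by metis

lemma jobs_present_before:
  assumes "good_path S n d q \<omega>" "i \<le> k" "t < epoch S (Suc i) \<omega>"
  shows "jobs_present (jobs S n q' \<omega> k) s t = jobs_present (jobs S n q' \<omega> i) s t"
  using assms(2)
proof (induction k rule: dec_induct)
  case (step k)
  have "t < arrival_time S k \<omega>"
    using assms(3) epoch_mono[OF assms(1), of "Suc i" "Suc k"] step.hyps by (simp add: arrival_time_epoch)
  then show ?case using step.IH by (simp add: jobs_Suc_eq Let_def jobs_present_snoc)
qed simp

lemma jobs_present_antimono:
  assumes "\<And>s a e. (s, a, e) \<in> set js \<Longrightarrow> a \<le> t" "t \<le> t'"
  shows "jobs_present js s t' \<le> jobs_present js s t"
  using assms by (induction js) (fastforce simp: jobs_present_def)+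

lemma pick_less:
  assumes "D \<in> samples n d" "d \<ge> 1"
  shows "pick m D p < n" "pick m D p \<in> D" "r \<in> D \<Longrightarrow> m (pick m D p) \<le> m r"
proof -
  have "finite D" "D \<noteq> {}" "D \<subseteq> {..<n}" using samplesD[OF assms(1)] assms(2) by auto
  with pick_in(1)[of D m p] pick_in(2)[of D r m p] show "pick m D p < n" "pick m D p \<in> D" "r \<in> D \<Longrightarrow> m (pick m D p) \<le> m r"
    by auto
qed

lemma fst_set_jobs:
  assumes "good_path S n d q \<omega>" "d \<ge> 1" "(s, a, e) \<in> set (jobs S n q' \<omega> k)"
  shows "s < n"
  using assms(3)
proof (induction k)
  case 0
  let ?step = "\<lambda>(s, m) js. js @ [(s, 0::real, init_work S s m \<omega> + last_departure js s 0)]"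
  have "s \<in> fst ` set L" if "(s, a, e) \<in> set (fold ?step L [])" for L
    using that by (induction L rule: rev_induct) (auto split: prod.splits)
  with 0 show ?case unfolding jobs_0_eq by fastforce
next
  case (Suc k)
  have "sampled S k \<omega> \<in> samples n d" using assms(1) by (simp add: good_path_def)
  with Suc pick_less(1)[OF _ assms(2)] show ?case by (auto simp: jobs_Suc_eq Let_def)
qed

lemma jobs_present_0:
  assumes good: "good_path S n d q \<omega>" and s: "s < n"
  shows "jobs_present (jobs S n q \<omega> k) s 0 = q s"
proof -
  let ?step = "\<lambda>(s, m) js. js @ [(s, 0::real, init_work S s m \<omega> + last_departure js s 0)]"
  have "jobs_present (fold ?step L []) s 0 = length (filter (\<lambda>x. fst x = s) L)"
    if "\<forall>(s, m)\<in>set L. 0 < init_work S s m \<omega>" for L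
    using that
  proof (induction L rule: rev_induct)
    case (snoc x L)
    obtain s' m where x: "x = (s', m)" by force
    have "0 < init_work S s' m \<omega> + last_departure (fold ?step L []) s' 0"
      using snoc.prems last_departure_ge[of 0 "fold ?step L []" s'] by (auto simp: x)
    with snoc show ?case by (auto simp: x jobs_present_snoc)
  qed simp
  moreover have "\<forall>(s, m)\<in>set [(s, m). s \<leftarrow> [0..<n], m \<leftarrow> [0..<q s]]. 0 < init_work S s m \<omega>"
    using good by (auto simp: good_path_def)
  moreover have "length (filter (\<lambda>x. fst x = s) [(s, m). s \<leftarrow> [0..<n], m \<leftarrow> [0..<q s]]) = (if s < n then q s else 0)" for n
  proof (induction n)
    case (Suc n)
    then show ?case by (auto simp: less_Suc_eq filter_map o_def)
  qed simp
  ultimately have "jobs_present (jobs S n q \<omega> 0) s 0 = q s"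
    using s unfolding jobs_0_eq by simp
  moreover have "0 < epoch S (Suc 0) \<omega>" using good by (simp add: good_path_def epoch_Suc)
  ultimately show ?thesis using jobs_present_before[OF good, of 0 k 0 q s] by simp
qed

text \<open>On a good path no job arrives or leaves at time 0, so the queue lengths there are
  exactly \<open>q\<close>; proportion 1 at level 1 and 0 at level 2 pin them down.\<close>

lemma one_job_per_server:
  assumes good: "good_path S n d q \<omega>" and n: "n \<ge> 1"
    and occ: "\<forall>i\<ge>1. occupancy S n q i 0 \<omega> = (if i = 1 then 1 else 0)"
  shows "\<forall>s<n. q s = 1"
proof -
  have "occupancy S n q 1 0 \<omega> = 1" using occ by simp
  then have 1: "\<forall>s<n. 1 \<le> q s"
    using occupancy_eq_1_iff[OF n, of 1 S q 0 \<omega>] jobs_present_0[OF good] by auto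
  have "occupancy S n q 2 0 \<omega> = 0" using occ by simp
  then have "\<forall>s<n. \<not> 2 \<le> q s"
    using occupancy_pos_iff[OF n, of 2 S q 0 \<omega>] jobs_present_0[OF good] by auto
  with 1 show ?thesis by (metis One_nat_def Suc_1 le_antisym not_less_eq_eq)
qed

lemma last_departure_fresh: "(\<And>a e. (s, a, e) \<notin> set js) \<Longrightarrow> last_departure js s t = t"
  by (simp add: last_departure_def)

lemma jobs_0_one:
  assumes "\<forall>s<n. q s = 1"
  shows "jobs S n q \<omega> 0 = map (\<lambda>s. (s, 0, init_work S s 0 \<omega>)) [0..<n]"
proof -
  let ?step = "\<lambda>(s, m) js. js @ [(s, 0::real, init_work S s m \<omega> + last_departure js s 0)]"
  have "[(s, m). s \<leftarrow> [0..<n], m \<leftarrow> [0..<q s]] = map (\<lambda>s. (s, 0)) [0..<n]"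
    using assms by (induction n) auto
  moreover have "fold ?step (map (\<lambda>s. (s, 0)) [0..<n]) [] = map (\<lambda>s. (s, 0, init_work S s 0 \<omega>)) [0..<n]"
  proof (induction n)
    case (Suc n)
    have "last_departure (map (\<lambda>s. (s, 0, init_work S s 0 \<omega>)) [0..<n]) n 0 = 0"
      by (rule last_departure_fresh) auto
    with Suc show ?case by simp
  qed simp
  ultimately show ?thesis unfolding jobs_0_eq by simp
qed

lemma event_U_imp_event_V:
  assumes good: "good_path S n n q \<omega>" and n: "n \<ge> 1" and j: "j \<ge> 2" and q: "\<forall>s<n. q s = 1"
    and U: "\<omega> \<in> event_U M S n q j T"
  shows "\<omega> \<in> event_V M S n q j T"
proof -
  let ?J = "jobs S n q \<omega>"
  define P where "P i \<longleftrightarrow> epoch S i \<omega> \<le> T \<and> (\<exists>s<n. j \<le> jobs_present (?J i) s (epoch S i \<omega>))" for i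
  have j1: "j \<ge> 1" using j by simp
  from U obtain k i s where i: "\<omega> \<in> space M" "i \<le> k" "0 \<le> epoch S i \<omega>" "epoch S i \<omega> \<le> T" "s < n"
    "j \<le> jobs_present (?J k) s (epoch S i \<omega>)"
    unfolding event_U_eq[OF n j1] by auto
  have "P i" unfolding P_def
    using i jobs_present_before[OF good \<open>i \<le> k\<close>, of "epoch S i \<omega>" q s] epoch_strict_mono[OF good, of i "Suc i"] by auto
  \<comment> \<open>At the first epoch with a queue of length \<open>j\<close>, the arriving job
    itself raised that queue from \<open>j - 1\<close>. It joined a shortest queue among all
    \<open>n\<close>.\<close>
  define l where "l = (LEAST i. P i)"
  have "P l" and least: "\<And>i. i < l \<Longrightarrow> \<not> P i"
    unfolding l_def using \<open>P i\<close> by (auto intro: LeastI dest: not_less_Least)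
  have "\<not> P 0" using jobs_present_0[OF good, of _ 0] q j by (auto simp: P_def)
  then obtain l' where l: "l = Suc l'" using \<open>P l\<close> by (cases l) auto
  from \<open>P l\<close> obtain s where s: "epoch S l \<omega> \<le> T" "s < n" "j \<le> jobs_present (?J l) s (epoch S l \<omega>)"
    by (auto simp: P_def)
  define a where "a = arrival_time S l' \<omega>"
  have a: "a = epoch S l \<omega>" by (simp add: a_def l arrival_time_epoch)
  define s0 where "s0 = pick (\<lambda>s. jobs_present (?J l') s a) (sampled S l' \<omega>) (tie_rank S l' \<omega>)"
  obtain e where J: "?J l = ?J l' @ [(s0, a, e)]"
    unfolding l jobs_Suc_eq Let_def s0_def a_def by blast
  have "epoch S l' \<omega> \<le> a" unfolding a by (rule epoch_mono[OF good]) (simp add: l)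
  then have "jobs_present (?J l') s a \<le> jobs_present (?J l') s (epoch S l' \<omega>)"
    using arrivals_le_epoch[OF good] by (intro jobs_present_antimono) blast+
  moreover have "\<not> P l'" using least l by simp
  ultimately have "\<not> j \<le> jobs_present (?J l') s a"
    using \<open>epoch S l' \<omega> \<le> a\<close> s unfolding P_def a by (meson order_trans)
  then have "s0 = s" and js: "j - 1 \<le> jobs_present (?J l') s a"
    using s(3) unfolding J a[symmetric] jobs_present_snoc by (auto split: if_splits)
  have samp: "sampled S l' \<omega> \<in> samples n n" using good by (simp add: good_path_def)
  then have "sampled S l' \<omega> = {..<n}"
    by (auto simp: samples_def card_subset_eq)
  then have "j - 1 \<le> jobs_present (?J l') r a" if "r < n" for r
    using pick_less(3)[OF samp n, of r "\<lambda>s. jobs_present (?J l') s a" "tie_rank S l' \<omega>"] js that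
    unfolding s0_def[symmetric] \<open>s0 = s\<close> by auto
  then have "\<forall>r<n. j - 1 \<le> jobs_present (?J l) r (epoch S l \<omega>)"
    using jobs_present_jobs_mono[of l' l S n q \<omega> _ a] unfolding a l by (meson le_SucI le_refl le_trans)
  then show ?thesis
    unfolding event_V_eq[OF n j] using i(1) s(1) epoch_nonneg[OF good, of l] by blast
qed

text \<open>Each of the first \<open>n + K\<close> jobs has either left by \<open>T\<close> or is
  present at \<open>T\<close>. Further arrivals are ignored, since they can only lengthen
  queues.\<close>

lemma event_U_pigeonhole:
  assumes good: "good_path S n d q \<omega>" and n: "n \<ge> 1" and d: "d \<ge> 1" and j: "j \<ge> 1" and q: "\<forall>s<n. q s = 1"
    and T: "epoch S K \<omega> \<le> T" "\<omega> \<in> space M"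
    and D: "num_departed T (jobs S n q \<omega> K) + (j - 1) * n < n + K"
  shows "\<omega> \<in> event_U M S n q j T"
proof -
  let ?J = "jobs S n q \<omega> K"
  have "length ?J = n + K"
    by (induction K) (simp_all add: jobs_0_one[OF q] jobs_Suc_eq Let_def del: jobs.simps)
  moreover have "length (filter (\<lambda>(s, a, e). e \<le> T) js) + (\<Sum>s<n. jobs_present js s T) = length js"
    if "\<And>s a e. (s, a, e) \<in> set js \<Longrightarrow> s < n \<and> a \<le> T" for js
    using that
  proof (induction js)
    case (Cons x js)
    obtain s a e where x: "x = (s, a, e)" by (cases x)
    have "(\<Sum>r<n. jobs_present (x # js) r T) = (\<Sum>r<n. (if r = s then (if T < e then 1 else 0) else 0) + jobs_present js r T)"
      using Cons.prems[of s a e] x by (intro sum.cong) (auto simp: jobs_present_def)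
    also have "\<dots> = (if T < e then 1 else 0) + (\<Sum>r<n. jobs_present js r T)"
      using Cons.prems[of s a e] x by (simp add: sum.distrib)
    finally show ?case using Cons x by auto
  qed simp
  moreover have "s < n \<and> a \<le> T" if "(s, a, e) \<in> set ?J" for s a e
    using fst_set_jobs[OF good d that] arrivals_le_epoch[OF good that] T by simp
  ultimately have "length (filter (\<lambda>(s, a, e). e \<le> T) ?J) + (\<Sum>s<n. jobs_present ?J s T) = n + K"
    by metis
  then have sum: "(j - 1) * n < (\<Sum>s<n. jobs_present ?J s T)"
    using D unfolding num_departed_def by linarith
  have "\<exists>s<n. j \<le> jobs_present ?J s T"
  proof (rule ccontr)
    assume "\<not> ?thesis"
    then have "(\<Sum>s<n. jobs_present ?J s T) \<le> (\<Sum>s<n. j - 1)" using j by (intro sum_mono) auto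
    with sum show False by (simp add: mult.commute)
  qed
  then have "occupancy S n q j T \<omega> > 0"
    unfolding occupancy_pos_iff[OF n j] by (rule exI[of _ K])
  moreover have "0 \<le> T" using T epoch_nonneg[OF good, of K] by simp
  ultimately show ?thesis using T by (auto simp: event_U_def)
qed

subsection \<open>Queue lengths and residual service times\<close>

text \<open>The new requirement overwrites the first filler of the chosen row, at index
  \<open>m s\<close>. Gap, sample, ranking and requirement are separate arguments so that each can
  be frozen or integrated independently.\<close>

definition sys_step :: "nat \<Rightarrow> real \<Rightarrow> nat set \<Rightarrow> (nat \<Rightarrow> nat) \<Rightarrow> real \<Rightarrow>
    (nat \<Rightarrow> nat) \<times> (nat \<Rightarrow> nat \<Rightarrow> real) \<Rightarrow> (nat \<Rightarrow> nat) \<times> (nat \<Rightarrow> nat \<Rightarrow> real)" where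
  "sys_step n g D p w x = (let m = adv_len n g (fst x) (snd x); r = adv_res n g (fst x) (snd x); s = pick m D p
     in (m(s := Suc (m s)), r(s := (r s)(m s := w))))"

text \<open>
  The state just after the \<open>k\<close>-th arrival: queue lengths, and for each server the residual service
  times of its jobs in FIFO order. Entries beyond the queue length are fillers taken from \<open>f\<close>.
\<close>

primrec sys_state :: "'w jsq_input \<Rightarrow> nat \<Rightarrow> (nat \<Rightarrow> nat \<Rightarrow> real) \<Rightarrow> 'w \<Rightarrow> nat \<Rightarrow>
    (nat \<Rightarrow> nat) \<times> (nat \<Rightarrow> nat \<Rightarrow> real)" where
  "sys_state S n f \<omega> 0 = (\<lambda>s. if s < n then 1 else 0, \<lambda>s. if s < n then (f s)(0 := init_work S s 0 \<omega>) else f s)"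
| "sys_state S n f \<omega> (Suc k) =
     sys_step n (arr_gap S k \<omega>) (sampled S k \<omega>) (tie_rank S k \<omega>) (work S k \<omega>) (sys_state S n f \<omega> k)"

definition departures :: "job list \<Rightarrow> nat \<Rightarrow> real list" where
  "departures js s = map (snd \<circ> snd) (filter (\<lambda>x. fst x = s) js)"

lemma departures_snoc: "departures (js @ [(s', a, e)]) s = departures js s @ (if s' = s then [e] else [])"
  by (simp add: departures_def)

lemma jobs_present_departures:
  "(\<And>s a e. (s, a, e) \<in> set js \<Longrightarrow> a \<le> t) \<Longrightarrow> jobs_present js s t = length (filter ((<) t) (departures js s))"
  by (induction js) (force simp: jobs_present_def departures_def)+

lemma last_departure_departures: "last_departure js s t = Max (insert t (set (departures js s)))"
proof -
  have "{e. \<exists>a. (s, a, e) \<in> set js} = set (departures js s)"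
    by (force simp: departures_def)
  then show ?thesis by (simp add: last_departure_def)
qed

text \<open>Under FIFO the pending departure times are \<open>t\<close> plus the partial sums of the
  residual times. This links job lists, which record absolute times, with the memoryless
  description.\<close>

definition represents :: "nat \<Rightarrow> job list \<Rightarrow> real \<Rightarrow> (nat \<Rightarrow> nat) \<times> (nat \<Rightarrow> nat \<Rightarrow> real) \<Rightarrow> bool" where
  "represents n js t x \<longleftrightarrow> (\<forall>s<n.
     filter ((<) t) (departures js s) = map (\<lambda>i. t + (\<Sum>l\<le>i. snd x s l)) [0..<fst x s] \<and>
     (\<forall>i<fst x s. 0 < snd x s i))"

text \<open>A completed head moves the origin to \<open>t + x 0\<close> and leaves the time
  \<open>g - x 0\<close> for the others, hence both vary in the induction.\<close>

lemma filter_advance: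
  assumes "\<And>i. i < m \<Longrightarrow> 0 < x i" "0 \<le> g"
  shows "filter ((<) (t + g)) (map (\<lambda>i. t + (\<Sum>l\<le>i. x l)) [0..<m]) =
      map (\<lambda>i. t + g + (\<Sum>l\<le>i. snd (advance m g x) l)) [0..<fst (advance m g x)] \<and>
    (\<forall>i<fst (advance m g x). 0 < snd (advance m g x) i)"
  using assms
proof (induction m arbitrary: x g t)
  case (Suc m)
  have upt: "[0..<Suc m] = 0 # map Suc [0..<m]"
    by (metis map_Suc_upt upt_conv_Cons zero_less_Suc)
  have sum_Suc: "(\<Sum>l\<le>Suc i. x l) = x 0 + (\<Sum>l\<le>i. x (Suc l))" for i
    by (rule sum.atMost_Suc_shift)
  show ?case
  proof (cases "g < x 0")
    case True
    have "x 0 \<le> (\<Sum>l\<le>i. x l)" if "i < Suc m" for i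
      using Suc.prems(1) that by (intro member_le_sum) (auto intro: less_imp_le)
    then have "filter ((<) (t + g)) (map (\<lambda>i. t + (\<Sum>l\<le>i. x l)) [0..<Suc m]) = map (\<lambda>i. t + (\<Sum>l\<le>i. x l)) [0..<Suc m]"
      using True by (intro filter_True) (force simp del: upt_Suc)
    also have "\<dots> = map (\<lambda>i. t + g + (\<Sum>l\<le>i. (x(0 := x 0 - g)) l)) [0..<Suc m]"
    proof (intro map_cong refl)
      fix i show "t + (\<Sum>l\<le>i. x l) = t + g + (\<Sum>l\<le>i. (x(0 := x 0 - g)) l)"
        by (induction i) auto
    qed
    finally show ?thesis using True Suc.prems by auto
  next
    case False
    have "filter ((<) (t + g)) (map (\<lambda>i. t + (\<Sum>l\<le>i. x l)) [0..<Suc m]) =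
        filter ((<) ((t + x 0) + (g - x 0))) (map (\<lambda>i. (t + x 0) + (\<Sum>l\<le>i. x (Suc l))) [0..<m])"
      using False unfolding upt by (simp add: sum_Suc o_def add.assoc del: sum.atMost_Suc)
    then show ?thesis
      using Suc.IH[of "\<lambda>i. x (Suc i)" "g - x 0" "t + x 0"] Suc.prems False by simp
  qed
qed simp

lemma represents_advance:
  assumes "represents n js t x" "0 \<le> g"
  shows "represents n js (t + g) (adv_len n g (fst x) (snd x), adv_res n g (fst x) (snd x))"
  unfolding represents_def
proof (intro allI impI)
  fix s assume s: "s < n"
  have "filter ((<) (t + g)) (departures js s) = filter ((<) (t + g)) (filter ((<) t) (departures js s))"
    unfolding filter_filter using assms(2) by (intro filter_cong) auto
  also have "filter ((<) t) (departures js s) = map (\<lambda>i. t + (\<Sum>l\<le>i. snd x s l)) [0..<fst x s]"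
    using assms s by (simp add: represents_def)
  finally show "filter ((<) (t + g)) (departures js s) =
      map (\<lambda>i. t + g + (\<Sum>l\<le>i. snd (adv_len n g (fst x) (snd x), adv_res n g (fst x) (snd x)) s l))
        [0..<fst (adv_len n g (fst x) (snd x), adv_res n g (fst x) (snd x)) s] \<and>
    (\<forall>i<fst (adv_len n g (fst x) (snd x), adv_res n g (fst x) (snd x)) s.
        0 < snd (adv_len n g (fst x) (snd x), adv_res n g (fst x) (snd x)) s i)"
    using filter_advance[of "fst x s" "snd x s" g t] assms s
    by (simp add: represents_def adv_len_def adv_res_def)
qed

lemma represents_arrival:
  assumes rep: "represents n js t (m, r)" and s: "s < n" and w: "0 < w"
  shows "represents n (js @ [(s, t, w + last_departure js s t)]) t (m(s := Suc (m s)), r(s := (r s)(m s := w)))"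
proof -
  \<comment> \<open>The new job starts when the whole backlog of its server is cleared.\<close>
  have ld: "last_departure js s t = t + (\<Sum>l<m s. r s l)"
    unfolding last_departure_departures
  proof (rule Max_eqI)
    have rep_s: "filter ((<) t) (departures js s) = map (\<lambda>i. t + (\<Sum>l\<le>i. r s l)) [0..<m s]"
      and pos: "\<And>i. i < m s \<Longrightarrow> 0 < r s i"
      using rep s by (auto simp: represents_def)
    fix y assume y: "y \<in> insert t (set (departures js s))"
    show "y \<le> t + (\<Sum>l<m s. r s l)"
    proof (cases "t < y")
      case True
      then have "y \<in> set (filter ((<) t) (departures js s))" using y by auto
      then obtain i where i: "i < m s" "y = t + (\<Sum>l\<le>i. r s l)" unfolding rep_s by auto
      then have "(\<Sum>l\<le>i. r s l) \<le> (\<Sum>l<m s. r s l)"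
        using pos by (intro sum_mono2) (auto intro: less_imp_le)
      then show ?thesis using i by simp
    next
      case False
      have "0 \<le> (\<Sum>l<m s. r s l)" using pos by (intro sum_nonneg) (auto intro: less_imp_le)
      with False show ?thesis by simp
    qed
  next
    have rep_s: "filter ((<) t) (departures js s) = map (\<lambda>i. t + (\<Sum>l\<le>i. r s l)) [0..<m s]"
      using rep s by (auto simp: represents_def)
    show "t + (\<Sum>l<m s. r s l) \<in> insert t (set (departures js s))"
    proof (cases "m s")
      case (Suc k)
      then have "t + (\<Sum>l<m s. r s l) \<in> set (filter ((<) t) (departures js s))"
        unfolding rep_s by (auto simp: lessThan_Suc_atMost)
      then show ?thesis by auto
    qed simp
  qed simp
  have pos: "0 \<le> (\<Sum>l<m s. r s l)"
    using rep s by (intro sum_nonneg) (auto simp: represents_def intro: less_imp_le)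
  have "(\<Sum>l\<le>m s. ((r s)(m s := w)) l) = (\<Sum>l<m s. r s l) + w"
    by (simp add: lessThan_Suc_atMost[symmetric])
  moreover have "(\<Sum>l\<le>i. ((r s)(m s := w)) l) = (\<Sum>l\<le>i. r s l)" if "i < m s" for i
    using that by (intro sum.cong) auto
  ultimately show ?thesis
    using rep w pos unfolding represents_def departures_snoc
    by (auto simp: ld less_Suc_eq)
qed

lemma represents_sys_state:
  assumes good: "good_path S n d q \<omega>" and d: "d \<ge> 1" and q: "\<forall>s<n. q s = 1"
  shows "represents n (jobs S n q \<omega> k) (epoch S k \<omega>) (sys_state S n f \<omega> k)"
proof (induction k)
  case 0
  have "filter (\<lambda>x. fst x = s) (map (\<lambda>s. (s, 0::real, init_work S s 0 \<omega>)) [0..<n]) = [(s, 0, init_work S s 0 \<omega>)]" if "s < n" for s n :: nat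
    using that
  proof (induction n)
    case (Suc n)
    show ?case
    proof (cases "s = n")
      case True
      then have "filter (\<lambda>x. fst x = s) (map (\<lambda>s. (s, 0::real, init_work S s 0 \<omega>)) [0..<n]) = []" by (auto simp: filter_empty_conv)
      with True show ?thesis by simp
    qed (use Suc in auto)
  qed simp
  then have "departures (jobs S n q \<omega> 0) s = [init_work S s 0 \<omega>]" if "s < n" for s
    using that unfolding departures_def jobs_0_one[OF q] by simp
  then show ?case
    using good q unfolding represents_def by (simp add: good_path_def del: jobs.simps)
next
  case (Suc k)
  define g where "g = arr_gap S k \<omega>"
  have g: "0 \<le> g" using good by (simp add: g_def good_path_def less_imp_le)
  define m where "m = adv_len n g (fst (sys_state S n f \<omega> k)) (snd (sys_state S n f \<omega> k))"
  define r where "r = adv_res n g (fst (sys_state S n f \<omega> k)) (snd (sys_state S n f \<omega> k))"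
  define t where "t = arrival_time S k \<omega>"
  have t: "t = epoch S k \<omega> + g" by (simp add: t_def g_def arrival_time_epoch epoch_Suc)
  have rep: "represents n (jobs S n q \<omega> k) t (m, r)"
    unfolding t m_def r_def by (rule represents_advance[OF Suc g])
  have arr: "a \<le> t" if "(s, a, e) \<in> set (jobs S n q \<omega> k)" for s a e
    using arrivals_le_epoch[OF good that] t g by simp
  have samp: "sampled S k \<omega> \<in> samples n d" using good by (simp add: good_path_def)
  have "jobs_present (jobs S n q \<omega> k) s t = m s" if "s < n" for s
    using rep that jobs_present_departures[of "jobs S n q \<omega> k" t s, OF arr] by (simp add: represents_def)
  then have pick: "pick (\<lambda>s. jobs_present (jobs S n q \<omega> k) s t) (sampled S k \<omega>) (tie_rank S k \<omega>) = pick m (sampled S k \<omega>) (tie_rank S k \<omega>)"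
    using samplesD[OF samp] by (intro pick_cong) auto
  have "0 < work S k \<omega>" using good by (simp add: good_path_def)
  from represents_arrival[OF rep pick_less(1)[OF samp d] this]
  show ?case
    unfolding jobs_Suc_eq Let_def sys_state.simps sys_step_def
    by (simp add: pick g_def[symmetric] m_def[symmetric] r_def[symmetric] t_def[symmetric] arrival_time_epoch[symmetric])
qed

text \<open>Since \<open>f\<close> is arbitrary, the fillers do not influence the lengths, and
  averaging over them later leaves statements on lengths intact.\<close>

lemma sys_state_len:
  assumes good: "good_path S n d q \<omega>" and d: "d \<ge> 1" and q: "\<forall>s<n. q s = 1" and s: "s < n"
  shows "jobs_present (jobs S n q \<omega> k) s (epoch S k \<omega>) = fst (sys_state S n f \<omega> k) s"
  using represents_sys_state[OF good d q, of k f] s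
    jobs_present_departures[of "jobs S n q \<omega> k" "epoch S k \<omega>" s, OF arrivals_le_epoch[OF good]]
  by (simp add: represents_def)

text \<open>Index 0 is excluded because all queues start with one job while \<open>j - 1\<close> is
  at least 2.\<close>

lemma event_V_imp:
  assumes good: "good_path S n d q \<omega>" and n: "n \<ge> 1" and d: "d \<ge> 1" and j: "j \<ge> 3" and q: "\<forall>s<n. q s = 1"
    and V: "\<omega> \<in> event_V M S n q j T"
  shows "\<exists>k. epoch S (Suc k) \<omega> \<le> T \<and> (\<forall>s<n. j - 1 \<le> fst (sys_state S n f \<omega> (Suc k)) s)"
proof -
  have j2: "j \<ge> 2" using j by simp
  from V obtain k i where i: "i \<le> k" "epoch S i \<omega> \<le> T"
    "\<forall>s<n. j - 1 \<le> jobs_present (jobs S n q \<omega> k) s (epoch S i \<omega>)"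
    unfolding event_V_eq[OF n j2] by auto
  have *: "\<forall>s<n. j - 1 \<le> fst (sys_state S n f \<omega> i) s"
    using i jobs_present_before[OF good i(1), of "epoch S i \<omega>" q] epoch_strict_mono[OF good, of i "Suc i"]
      sys_state_len[OF good d q, of _ i f] by simp
  moreover have "i \<noteq> 0" using *[rule_format, of 0] n j by (cases i) auto
  ultimately show ?thesis using i(2) by (cases i) auto
qed

subsection \<open>The inputs of a system\<close>

lemma sets_vimage_algebra_subset: "sets (vimage_algebra X f N) \<subseteq> Pow X"
  using sets.space_closed[of "vimage_algebra X f N"] by simp

context jsq_system
begin

definition src_algebra :: "source set \<Rightarrow> 'w measure" where
  "src_algebra J = sigma (space M) (\<Union>i\<in>J. source_events M S n d i)"

lemma source_events_space: "source_events M S n d i \<subseteq> Pow (space M)"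
  by (cases i) (simp_all add: source_events_def sets_vimage_algebra_subset)

lemma space_src_algebra [simp]: "space (src_algebra J) = space M"
  unfolding src_algebra_def using source_events_space by (intro space_measure_of) blast

lemma sets_src_algebra: "sets (src_algebra J) = sigma_sets (space M) (\<Union>i\<in>J. source_events M S n d i)"
  unfolding src_algebra_def using source_events_space by (intro sets_measure_of) blast

lemma source_events_src_algebra: "i \<in> J \<Longrightarrow> source_events M S n d i \<subseteq> sets (src_algebra J)"
  unfolding sets_src_algebra by auto

lemma measurable_src_vimage:
  assumes "i \<in> J" "source_events M S n d i = sets (vimage_algebra (space M) f N)" "f \<in> space M \<rightarrow> space N"
  shows "f \<in> src_algebra J \<rightarrow>\<^sub>M N"
proof (rule measurableI)
  fix A assume "A \<in> sets N"
  then have "f -` A \<inter> space M \<in> sets (vimage_algebra (space M) f N)" by (rule in_vimage_algebra)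
  then show "f -` A \<inter> space (src_algebra J) \<in> sets (src_algebra J)"
    using source_events_src_algebra[OF assms(1)] assms(2) by auto
qed (use assms(3) in auto)

lemma measurable_src:
  "Gap k \<in> J \<Longrightarrow> arr_gap S k \<in> borel_measurable (src_algebra J)"
  "Work k \<in> J \<Longrightarrow> work S k \<in> borel_measurable (src_algebra J)"
  "Init s m \<in> J \<Longrightarrow> init_work S s m \<in> borel_measurable (src_algebra J)"
  "Sample k \<in> J \<Longrightarrow> sampled S k \<in> src_algebra J \<rightarrow>\<^sub>M count_space (samples n d)"
  "Tie k \<in> J \<Longrightarrow> tie_rank S k \<in> src_algebra J \<rightarrow>\<^sub>M count_space (rankings n)"
  using measurable_space[OF sampled_measurable[of k]] measurable_space[OF tie_rank_measurable[of k]]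
  by (auto intro!: measurable_src_vimage simp: source_events_def)

lemma nn_integral_src_decouple:
  assumes "A \<union> B \<subseteq> sources n q" "A \<inter> B = {}"
    and "(\<lambda>(x, y). h x y) \<in> borel_measurable (src_algebra A \<Otimes>\<^sub>M src_algebra B)"
  shows "(\<integral>\<^sup>+x. h x x \<partial>M) = (\<integral>\<^sup>+x. \<integral>\<^sup>+y. h x y \<partial>M \<partial>M)"
proof (rule nn_integral_decouple)
  show "indep_sets (source_events M S n d) (A \<union> B)"
    by (rule indep_sets_mono_index[OF assms(1) indep])
  show "Int_stable (source_events M S n d i)" for i
    unfolding Int_stable_def source_events_def by (auto split: source.split)
qed (use assms in \<open>auto simp: src_algebra_def\<close>)

lemma sets_src_subset: "J \<subseteq> sources n q \<Longrightarrow> sets (src_algebra J) \<subseteq> events"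
  using indep unfolding sets_src_algebra indep_sets_def by (intro sets.sigma_sets_subset) auto

lemma measurable_from_src: "J \<subseteq> sources n q \<Longrightarrow> f \<in> src_algebra J \<rightarrow>\<^sub>M N \<Longrightarrow> f \<in> M \<rightarrow>\<^sub>M N"
  using sets_src_subset[of J] unfolding measurable_def by auto

lemma nn_integral_work:
  assumes "f \<in> borel_measurable borel"
  shows "(\<integral>\<^sup>+\<omega>. f (work S k \<omega>) \<partial>M) = (\<integral>\<^sup>+w. f w \<partial>expo)"
  using distributed_nn_integral[OF work, of f] assms
  unfolding expo_def by (subst nn_integral_density) (auto simp: exponential_density_def)

lemma nn_integral_init:
  assumes "f \<in> borel_measurable borel" "s < n" "m < q s"
  shows "(\<integral>\<^sup>+\<omega>. f (init_work S s m \<omega>) \<partial>M) = (\<integral>\<^sup>+w. f w \<partial>expo)"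
  using distributed_nn_integral[OF init_work[OF assms(2,3)], of f] assms
  unfolding expo_def by (subst nn_integral_density) (auto simp: exponential_density_def)

lemma AE_exponential_pos:
  assumes "distributed M lborel X (exponential_density c)" "0 < c"
  shows "AE \<omega> in M. 0 < X \<omega>"
proof -
  have "prob {\<omega> \<in> space M. 0 < X \<omega>} = 1"
    using exponential_distributedD_gt[OF assms(1), of 0] assms(2) by simp
  moreover have "{\<omega> \<in> space M. 0 < X \<omega>} \<in> events"
    using distributed_measurable[OF assms(1)] by simp
  ultimately show ?thesis by (simp add: prob_Collect_eq_1)
qed

lemma AE_good_path:
  assumes "n \<ge> 1" "l > 0"
  shows "AE \<omega> in M. good_path S n d q \<omega>"
proof -
  have "AE \<omega> in M. \<forall>k. 0 < arr_gap S k \<omega>" "AE \<omega> in M. \<forall>k. 0 < work S k \<omega>"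
    using assms by (auto simp: AE_all_countable intro!: AE_exponential_pos[OF arr_gap] AE_exponential_pos[OF work])
  moreover have "AE \<omega> in M. \<forall>s m. s < n \<longrightarrow> m < q s \<longrightarrow> 0 < init_work S s m \<omega>"
    unfolding AE_all_countable
  proof (intro allI)
    fix s m show "AE \<omega> in M. s < n \<longrightarrow> m < q s \<longrightarrow> 0 < init_work S s m \<omega>"
      using AE_exponential_pos[OF init_work, of s m] by (cases "s < n \<and> m < q s") auto
  qed
  moreover have "AE \<omega> in M. \<forall>k. sampled S k \<omega> \<in> samples n d"
    using measurable_space[OF sampled_measurable] by (intro AE_I2) auto
  ultimately show ?thesis
    by eventually_elim (auto simp: good_path_def)
qed

lemma measurable_inputs_src:
  assumes "\<And>i. i < k \<Longrightarrow> {Gap i, Work i, Sample i, Tie i} \<subseteq> J" "{Init s m |s m. s < n \<and> m < q s} \<subseteq> J"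
  shows "measurable_inputs (src_algebra J) S n d q k"
  unfolding measurable_inputs_def using assms by (auto intro!: measurable_src)

lemma measurable_inputs_M: "measurable_inputs M S n d q k"
  using distributed_measurable[OF arr_gap] distributed_measurable[OF work] distributed_measurable[OF init_work]
    sampled_measurable tie_rank_measurable
  by (auto simp: measurable_inputs_def)

end

subsection \<open>Few departures\<close>

text \<open>The probability that a Poisson variable with mean \<open>y\<close> is less than
  \<open>m\<close>.\<close>

definition poisson_less :: "nat \<Rightarrow> real \<Rightarrow> real" where
  "poisson_less m y = (\<Sum>i<m. exp (- y) * y ^ i / fact i)"

lemma poisson_less_0 [simp]: "poisson_less 0 y = 0"
  by (simp add: poisson_less_def)

lemma poisson_less_nonneg: "0 \<le> y \<Longrightarrow> 0 \<le> poisson_less m y"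
  unfolding poisson_less_def by (intro sum_nonneg) auto

lemma poisson_less_le_1: "0 \<le> y \<Longrightarrow> poisson_less m y \<le> 1"
proof -
  assume y: "0 \<le> y"
  have "(\<Sum>i<m. y ^ i / fact i) \<le> exp y"
  proof -
    have "(\<Sum>i<m. y ^ i /\<^sub>R fact i) \<le> (\<Sum>i. y ^ i /\<^sub>R fact i)"
      using y by (intro sum_le_suminf sums_summable[OF exp_converges]) auto
    then show ?thesis
      using sums_unique[OF exp_converges[of y]] by (simp add: divide_inverse mult.commute)
  qed
  then have "exp (- y) * (\<Sum>i<m. y ^ i / fact i) \<le> exp (- y) * exp y" by (intro mult_left_mono) auto
  then show ?thesis by (simp add: poisson_less_def sum_distrib_left exp_minus)
qed

lemma poisson_less_ge: "0 \<le> y \<Longrightarrow> k < m \<Longrightarrow> exp (- y) * y ^ k / fact k \<le> poisson_less m y"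
  unfolding poisson_less_def by (rule member_le_sum) auto

text \<open>The forward equation of the Poisson process; the derivatives of the single terms
  telescope.\<close>

lemma poisson_less_deriv:
  "((\<lambda>y. poisson_less (Suc m) y) has_real_derivative poisson_less m y - poisson_less (Suc m) y) (at y)"
proof -
  have "((\<lambda>y. exp (- y) * y ^ Suc i / fact (Suc i)) has_real_derivative
      exp (- y) * y ^ i / fact i - exp (- y) * y ^ Suc i / fact (Suc i)) (at y)" for i
  proof -
    have "((\<lambda>y. y ^ Suc i / fact (Suc i)) has_real_derivative real (Suc i) * y ^ i / fact (Suc i)) (at y)"
      using DERIV_cdivide[OF DERIV_pow[of "Suc i" y UNIV], of "fact (Suc i)"]
      by (simp del: fact_Suc power_Suc of_nat_Suc)
    also have "real (Suc i) * y ^ i / fact (Suc i) = y ^ i / fact i"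
      by (simp add: fact_Suc del: of_nat_Suc)
    finally have "((\<lambda>y. exp (- y) * (y ^ Suc i / fact (Suc i))) has_real_derivative
        exp (- y) * (y ^ i / fact i) + exp (- y) * (- 1) * (y ^ Suc i / fact (Suc i))) (at y)"
      by (intro DERIV_mult' DERIV_chain2[OF DERIV_exp]) (auto intro!: derivative_eq_intros)
    then show ?thesis by simp
  qed
  then have "((\<lambda>y. exp (- y) + (\<Sum>i<m. exp (- y) * y ^ Suc i / fact (Suc i))) has_real_derivative
      - exp (- y) + (\<Sum>i<m. exp (- y) * y ^ i / fact i - exp (- y) * y ^ Suc i / fact (Suc i))) (at y)"
    by (intro DERIV_add DERIV_sum) (auto intro!: derivative_eq_intros simp del: fact_Suc power_Suc)
  then show ?thesis
    unfolding poisson_less_def sum.lessThan_Suc_shift[where n=m] by (simp add: sum_subtractf algebra_simps)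
qed

lemma poisson_less_antimono:
  assumes "0 \<le> y" "y \<le> z" shows "poisson_less m z \<le> poisson_less m y"
proof (cases m)
  case (Suc k)
  have "poisson_less (Suc k) z \<le> poisson_less (Suc k) y"
  proof (rule DERIV_nonpos_imp_nonincreasing[OF assms(2)])
    fix x assume "y \<le> x" "x \<le> z"
    then have "poisson_less k x \<le> poisson_less (Suc k) x" using assms by (simp add: poisson_less_def)
    then show "\<exists>D. ((\<lambda>y. poisson_less (Suc k) y) has_real_derivative D) (at x) \<and> D \<le> 0"
      using poisson_less_deriv by fastforce
  qed
  with Suc show ?thesis by simp
qed simp

lemma measurable_poisson_less [measurable]: "poisson_less m \<in> borel_measurable borel"
  unfolding poisson_less_def[abs_def] by measurable

text \<open>Reveal a Poisson process on an interval of length \<open>x + y\<close> up to its first point or time \<open>x\<close>.\<close>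

lemma poisson_less_first_point:
  assumes x: "0 \<le> x" and y: "0 \<le> y"
  shows "ennreal (poisson_less m (y + x)) =
    (\<integral>\<^sup>+w. ennreal (poisson_less (m - (if w \<le> x then 1 else 0)) (y + max 0 (x - w))) \<partial>expo)"
proof (cases m)
  case 0
  then show ?thesis by simp
next
  case (Suc k)
  \<comment> \<open>Antiderivative of the density of the first point at \<open>w\<close> times the
    chance of few points afterwards.\<close>
  define G where "G w = - exp (- w) * poisson_less (Suc k) (y + x - w)" for w
  have G: "(G has_real_derivative exp (- w) * poisson_less k (y + x - w)) (at w)" for w
    unfolding G_def by (auto intro!: derivative_eq_intros DERIV_chain2[OF poisson_less_deriv] simp: algebra_simps)
  have FTC: "(\<integral>\<^sup>+w. ennreal (exp (- w) * poisson_less k (y + x - w)) * indicator {0..x} w \<partial>lborel) = ennreal (G x - G 0)"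
    using x y by (intro nn_integral_FTC_Icc) (auto intro!: G has_field_derivative_at_within mult_nonneg_nonneg poisson_less_nonneg)
  have "(\<integral>\<^sup>+w. ennreal (poisson_less (m - (if w \<le> x then 1 else 0)) (y + max 0 (x - w))) \<partial>expo) =
      (\<integral>\<^sup>+w. (if w \<le> x then ennreal (poisson_less k (y + x - w)) else 0) + (if x < w then ennreal (poisson_less m y) else 0) \<partial>expo)"
    by (intro nn_integral_cong) (auto simp: Suc max_def algebra_simps)
  also have "\<dots> = (\<integral>\<^sup>+w. (if w \<le> x then ennreal (poisson_less k (y + x - w)) else 0) \<partial>expo) + (\<integral>\<^sup>+w. (if x < w then ennreal (poisson_less m y) else 0) \<partial>expo)"
    by (rule nn_integral_add) auto
  also have "(\<integral>\<^sup>+w. (if x < w then ennreal (poisson_less m y) else 0) \<partial>expo) = ennreal (exp (- x)) * ennreal (poisson_less m y)"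
    using nn_integral_expo_shift[OF x, of "\<lambda>_. ennreal (poisson_less m y)"] prob_space.emeasure_space_1[OF prob_space_expo] by simp
  also have "(\<integral>\<^sup>+w. (if w \<le> x then ennreal (poisson_less k (y + x - w)) else 0) \<partial>expo) =
      (\<integral>\<^sup>+w. ennreal (exponential_density 1 w) * (if w \<le> x then ennreal (poisson_less k (y + x - w)) else 0) \<partial>lborel)"
    unfolding expo_def by (rule nn_integral_density) (auto simp: exponential_density_def)
  also have "\<dots> = (\<integral>\<^sup>+w. ennreal (exp (- w) * poisson_less k (y + x - w)) * indicator {0..x} w \<partial>lborel)"
    using y by (intro nn_integral_cong) (auto simp: exponential_density_def indicator_def ennreal_mult poisson_less_nonneg)
  also have "\<dots> = ennreal (G x - G 0)" by (rule FTC)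
  also have "G x - G 0 = poisson_less m (y + x) - exp (- x) * poisson_less m y"
    by (simp add: G_def Suc)
  also have "ennreal \<dots> + ennreal (exp (- x)) * ennreal (poisson_less m y) = ennreal (poisson_less m (y + x))"
  proof -
    have "0 \<le> G x - G 0"
    proof -
      have "G 0 \<le> G x" using x y
        by (intro DERIV_nonneg_imp_nondecreasing[of 0 x G]) (auto intro!: exI G mult_nonneg_nonneg poisson_less_nonneg)
      then show ?thesis by simp
    qed
    then have "0 \<le> poisson_less m (y + x) - exp (- x) * poisson_less m y" by (simp add: G_def Suc)
    then show ?thesis
      using y by (simp add: ennreal_mult[symmetric] ennreal_plus[symmetric] poisson_less_nonneg del: ennreal_plus)
  qed
  finally show ?thesis ..
qed

text \<open>A bound for the time that the servers can still be busy up to time \<open>T\<close> with further jobs.\<close>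

definition capacity :: "nat \<Rightarrow> real \<Rightarrow> job list \<Rightarrow> real" where
  "capacity n T js = (\<Sum>s<n. max 0 (T - last_departure js s 0))"

text \<open>The chance of fewer than \<open>m\<close> departures in total if the time still
  available to the servers carried a rate 1 Poisson process of departures. Truncated subtraction
  gives 0 once \<open>m\<close> jobs have departed.\<close>

definition few_departures :: "nat \<Rightarrow> nat \<Rightarrow> real \<Rightarrow> job list \<Rightarrow> real" where
  "few_departures m n T js = poisson_less (m - num_departed T js) (capacity n T js)"

lemma capacity_nonneg: "0 \<le> capacity n T js"
  by (simp add: capacity_def sum_nonneg)

lemma few_departures_le: "few_departures m n T js \<le> (if num_departed T js < m then 1 else 0)"
  using poisson_less_le_1[OF capacity_nonneg] by (auto simp: few_departures_def)

text \<open>The new job starts at \<sigma>. Time that its server idles before \<sigma> is lost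
  capacity, which only raises the chance of few departures; this is the sole inequality. Its service
  time then plays the first point of the Poisson process on the server's remaining interval, so
  averaging over it changes nothing.\<close>

lemma few_departures_step:
  assumes s: "s < n" and a: "0 \<le> a"
  shows "ennreal (few_departures m n T js) \<le>
    (\<integral>\<^sup>+w. ennreal (few_departures m n T (js @ [(s, a, w + last_departure js s a)])) \<partial>expo)"
proof -
  define \<sigma> where "\<sigma> = last_departure js s a"
  define x where "x = max 0 (T - \<sigma>)"
  define y where "y = (\<Sum>s'\<in>{..<n} - {s}. max 0 (T - last_departure js s' 0))"
  have \<sigma>: "last_departure js s 0 \<le> \<sigma>"
    using last_departure_max[OF a, of js s] by (simp add: \<sigma>_def)
  have y: "0 \<le> y" unfolding y_def by (intro sum_nonneg) simp
  have cap: "capacity n T js = y + max 0 (T - last_departure js s 0)"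
    unfolding capacity_def y_def using s by (subst sum.remove[of _ s]) auto
  have cap': "capacity n T (js @ [(s, a, w + \<sigma>)]) = y + max 0 (x - w)" if "0 < w" for w
  proof -
    have "capacity n T (js @ [(s, a, w + \<sigma>)]) = max 0 (T - (w + \<sigma>)) +
        (\<Sum>s'\<in>{..<n} - {s}. max 0 (T - last_departure (js @ [(s, a, w + \<sigma>)]) s' 0))"
      unfolding capacity_def using s \<sigma> that by (subst sum.remove[of _ s]) (auto simp: last_departure_snoc max_def)
    also have "(\<Sum>s'\<in>{..<n} - {s}. max 0 (T - last_departure (js @ [(s, a, w + \<sigma>)]) s' 0)) = y"
      unfolding y_def by (intro sum.cong) (auto simp: last_departure_snoc)
    finally show ?thesis using that by (auto simp: x_def max_def)
  qed
  have num': "num_departed T (js @ [(s, a, w + \<sigma>)]) = num_departed T js + (if w \<le> x then 1 else 0)" if "0 < w" for w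
    using that by (auto simp: num_departed_def x_def max_def)
  have "few_departures m n T js \<le> poisson_less (m - num_departed T js) (y + x)"
    unfolding few_departures_def cap using \<sigma> y
    by (intro poisson_less_antimono) (auto simp: x_def)
  then have "ennreal (few_departures m n T js) \<le> ennreal (poisson_less (m - num_departed T js) (y + x))"
    by (rule ennreal_leI)
  also have "\<dots> = (\<integral>\<^sup>+w. ennreal (poisson_less (m - num_departed T js - (if w \<le> x then 1 else 0)) (y + max 0 (x - w))) \<partial>expo)"
    by (rule poisson_less_first_point) (auto simp: x_def y)
  also have "\<dots> = (\<integral>\<^sup>+w. ennreal (few_departures m n T (js @ [(s, a, w + \<sigma>)])) \<partial>expo)"
  proof (rule nn_integral_cong_AE)
    have "AE w in expo. 0 < w"
      unfolding expo_def using AE_lborel_singleton[of "0::real"]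
      by (subst AE_density) (auto simp: exponential_density_def elim!: eventually_mono)
    then show "AE w in expo. ennreal (poisson_less (m - num_departed T js - (if w \<le> x then 1 else 0)) (y + max 0 (x - w))) =
      ennreal (few_departures m n T (js @ [(s, a, w + \<sigma>)]))"
      by eventually_elim (simp add: few_departures_def cap' num')
  qed
  finally show ?thesis by (simp add: \<sigma>_def)
qed

lemma measurable_job_list_compose:
  assumes f: "measurable_job_list N f" and g: "g \<in> N' \<rightarrow>\<^sub>M N"
  shows "measurable_job_list N' (\<lambda>\<omega>. f (g \<omega>))"
  unfolding measurable_job_list_def split_beta'
  using measurable_job_listD[OF f measurable_compose[OF measurable_fst g] measurable_snd] by blast

lemma measurable_few_departures:
  assumes f: "measurable_job_list N f"
  shows "(\<lambda>\<omega>. few_departures m n T (f \<omega>)) \<in> borel_measurable N"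
proof -
  note D = measurable_job_listD[OF f measurable_ident_sets[OF refl]]
  note [measurable] = D(2)[of "\<lambda>_. 0"]
  have "(\<lambda>\<omega>. capacity n T (f \<omega>)) \<in> borel_measurable N"
    unfolding capacity_def by measurable
  then have "(\<lambda>\<omega>. poisson_less (m - k) (capacity n T (f \<omega>))) \<in> borel_measurable N" for k
    by measurable
  then show ?thesis
    unfolding few_departures_def
    by (rule measurable_compose_countable) (rule D(3)[of "\<lambda>_. T"], simp)
qed

section \<open>Poisson domination of the departures\<close>

context jsq_system
begin

text \<open>Server and arrival time may depend in any way on the sources \<open>J\<close>, but not
  on the service time that is being revealed; freezing \<open>J\<close> reduces the claim to
  \<open>few_departures_step\<close>. The weight \<open>c\<close> carries the arrival event
  along.\<close>

lemma few_departures_mono_job: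
  assumes J: "J \<subseteq> sources n q" "i \<in> sources n q" "i \<notin> J"
    and v: "v \<in> borel_measurable (src_algebra {i})"
    and law: "\<And>f. f \<in> borel_measurable borel \<Longrightarrow> (\<integral>\<^sup>+\<omega>. f (v \<omega>) \<partial>M) = (\<integral>\<^sup>+w. f w \<partial>expo)"
    and f: "measurable_job_list (src_algebra J) f" and s: "s \<in> src_algebra J \<rightarrow>\<^sub>M count_space UNIV"
    and a: "a \<in> borel_measurable (src_algebra J)" and c: "c \<in> borel_measurable (src_algebra J)"
    and AE: "AE \<omega> in M. s \<omega> < n \<and> 0 \<le> a \<omega>"
  shows "(\<integral>\<^sup>+\<omega>. c \<omega> * ennreal (few_departures m n T (f \<omega>)) \<partial>M) \<le>
    (\<integral>\<^sup>+\<omega>. c \<omega> * ennreal (few_departures m n T (f \<omega> @ [(s \<omega>, a \<omega>, v \<omega> + last_departure (f \<omega>) (s \<omega>) (a \<omega>))])) \<partial>M)"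
proof -
  define ext where "ext x w = f x @ [(s x, a x, w + last_departure (f x) (s x) (a x))]" for x w
  have inner: "(\<lambda>w. ennreal (few_departures m n T (ext x w))) \<in> borel_measurable borel" if x: "x \<in> space M" for x
  proof -
    have const: "(\<lambda>_. x) \<in> (borel :: real measure) \<rightarrow>\<^sub>M src_algebra J" using x by simp
    have "measurable_job_list (borel :: real measure) (\<lambda>w. ext x w)"
      unfolding ext_def
      by (rule measurable_job_list_snoc[OF measurable_job_list_compose[OF f const]]) simp_all
    then show ?thesis by (intro measurable_compose[OF measurable_few_departures measurable_ennreal])
  qed
  have "measurable_job_list (src_algebra J \<Otimes>\<^sub>M src_algebra {i}) (\<lambda>p. ext (fst p) (v (snd p)))"
    unfolding ext_def
    by (intro measurable_job_list_snoc measurable_job_list_compose[OF f measurable_fst]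
        measurable_compose[OF measurable_fst s] measurable_compose[OF measurable_fst a]
        measurable_compose[OF measurable_snd v])
  from measurable_few_departures[OF this]
  have "(\<lambda>(x, y). c x * ennreal (few_departures m n T (ext x (v y)))) \<in> borel_measurable (src_algebra J \<Otimes>\<^sub>M src_algebra {i})"
    unfolding split_beta'
    by (intro borel_measurable_times_ennreal measurable_compose[OF measurable_fst c] measurable_compose[OF _ measurable_ennreal])
  then have "(\<integral>\<^sup>+x. c x * ennreal (few_departures m n T (ext x (v x))) \<partial>M) =
      (\<integral>\<^sup>+x. \<integral>\<^sup>+y. c x * ennreal (few_departures m n T (ext x (v y))) \<partial>M \<partial>M)"
    using J by (intro nn_integral_src_decouple) auto
  also have "\<dots> = (\<integral>\<^sup>+x. c x * (\<integral>\<^sup>+w. ennreal (few_departures m n T (ext x w)) \<partial>expo) \<partial>M)"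
  proof (rule nn_integral_cong)
    fix x assume x: "x \<in> space M"
    have "v \<in> borel_measurable M" using v J by (intro measurable_from_src[of "{i}"]) auto
    then show "(\<integral>\<^sup>+y. c x * ennreal (few_departures m n T (ext x (v y))) \<partial>M) =
        c x * (\<integral>\<^sup>+w. ennreal (few_departures m n T (ext x w)) \<partial>expo)"
      using law[OF inner[OF x]] measurable_compose[OF _ inner[OF x], of v M]
      by (subst nn_integral_cmult) auto
  qed
  also have "\<dots> \<ge> (\<integral>\<^sup>+x. c x * ennreal (few_departures m n T (f x)) \<partial>M)"
    using AE by (intro nn_integral_mono_AE, eventually_elim)
      (auto simp: ext_def intro!: mult_left_mono few_departures_step)
  finally show ?thesis by (simp add: ext_def)
qed

text \<open>The arrival event \<open>G\<close> depends on the gaps alone and stays as a weight while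
  service times are revealed one by one. The weighted mean of \<open>few_departures\<close> grows
  from its value for the empty list to a quantity bounded by the probability of
  \<open>event_U\<close>.\<close>

lemma prob_event_U_ge_poisson_less:
  assumes n: "n \<ge> 1" and d: "d \<ge> 1" and l: "l > 0" and q: "\<forall>s<n. q s = 1" and j: "j \<ge> 2" and T: "T \<ge> 0"
    and K: "m + (j - 1) * n \<le> n + K"
  shows "prob {\<omega> \<in> space M. epoch S K \<omega> \<le> T} * poisson_less m (real n * T) \<le> prob (event_U M S n q j T)"
proof -
  define G where "G = {\<omega> \<in> space M. epoch S K \<omega> \<le> T}"
  have epm: "epoch S k \<in> borel_measurable (src_algebra J)" if "range Gap \<subseteq> J" for J k
    unfolding epoch_def[abs_def] using that by (intro borel_measurable_sum measurable_src(1)) auto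
  have Gs: "G \<in> sets (src_algebra J)" if "range Gap \<subseteq> J" for J
    using epm[OF that, of K] unfolding G_def by (auto simp: borel_measurable_iff_le)
  have Gm: "(indicator G :: _ \<Rightarrow> ennreal) \<in> borel_measurable (src_algebra J)" if "range Gap \<subseteq> J" for J
    using Gs[OF that] by simp
  have gap_sub: "range Gap \<subseteq> sources n q" by (auto simp: sources_def)
  have GM: "G \<in> events" using Gs[OF gap_sub] sets_src_subset[OF order_refl] by auto
  \<comment> \<open>The value for the empty list, whose capacity is \<open>n * T\<close>.\<close>
  define P where "P = ennreal (prob G * poisson_less m (real n * T))"
  define L where "L s \<omega> = map (\<lambda>i. (i, 0::real, init_work S i 0 \<omega>)) [0..<s]" for s \<omega>
  define J where "J s = range Gap \<union> {Init i 0 |i. i < s}" for s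
  \<comment> \<open>The initial jobs are revealed like arrivals at time 0, one server after the
    other.\<close>
  have init: "s \<le> n \<Longrightarrow> measurable_job_list (src_algebra (J s)) (L s) \<and>
      P \<le> (\<integral>\<^sup>+\<omega>. indicator G \<omega> * ennreal (few_departures m n T (L s \<omega>)) \<partial>M)" for s
  proof (induction s)
    case 0
    have "(\<lambda>(\<omega>, t). t) \<in> borel_measurable (src_algebra (J 0) \<Otimes>\<^sub>M (borel :: real measure))"
      by measurable
    then have "measurable_job_list (src_algebra (J 0)) (L 0)"
      by (simp add: measurable_job_list_def L_def)
    moreover have "P = (\<integral>\<^sup>+\<omega>. indicator G \<omega> * ennreal (poisson_less m (real n * T)) \<partial>M)"
      using GM T by (simp add: P_def ennreal_mult poisson_less_nonneg emeasure_eq_measure nn_integral_multc)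
    ultimately show ?case
      using T by (simp add: few_departures_def capacity_def L_def[abs_def])
  next
    case (Suc s)
    then have s: "s < n" and IH: "measurable_job_list (src_algebra (J s)) (L s)"
      "P \<le> (\<integral>\<^sup>+\<omega>. indicator G \<omega> * ennreal (few_departures m n T (L s \<omega>)) \<partial>M)" by auto
    have "last_departure (L s \<omega>) s 0 = 0" for \<omega>
      by (rule last_departure_fresh) (auto simp: L_def)
    then have L: "L (Suc s) \<omega> = L s \<omega> @ [(s, 0, init_work S s 0 \<omega> + last_departure (L s \<omega>) s 0)]" for \<omega>
      by (simp add: L_def)
    have sub: "J s \<subseteq> J (Suc s)" by (auto simp: J_def)
    have idJ: "(\<lambda>x. x) \<in> src_algebra (J (Suc s)) \<rightarrow>\<^sub>M src_algebra (J s)"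
    proof (rule measurableI)
      fix A assume A: "A \<in> sets (src_algebra (J s))"
      have "(\<Union>i\<in>J s. source_events M S n d i) \<subseteq> (\<Union>i\<in>J (Suc s). source_events M S n d i)" using sub by auto
      then have "sets (src_algebra (J s)) \<subseteq> sets (src_algebra (J (Suc s)))"
        unfolding sets_src_algebra by (rule sigma_sets_subseteq)
      then show "(\<lambda>x. x) -` A \<inter> space (src_algebra (J (Suc s))) \<in> sets (src_algebra (J (Suc s)))"
        using A sets.sets_into_space[OF A] by (auto simp: Int_absorb2)
    qed simp
    have "measurable_job_list (src_algebra (J (Suc s))) (L (Suc s))"
      unfolding L[abs_def]
      by (intro measurable_job_list_snoc measurable_job_list_compose[OF IH(1) idJ])
         (auto intro!: measurable_src simp: J_def)
    moreover have "(\<integral>\<^sup>+\<omega>. indicator G \<omega> * ennreal (few_departures m n T (L s \<omega>)) \<partial>M) \<le>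
        (\<integral>\<^sup>+\<omega>. indicator G \<omega> * ennreal (few_departures m n T (L (Suc s) \<omega>)) \<partial>M)"
      unfolding L
      by (rule few_departures_mono_job[where J="J s" and i="Init s 0" and s="\<lambda>_. s" and a="\<lambda>_. 0"])
         (use s q IH(1) Gm in \<open>auto simp: J_def sources_def intro!: measurable_src nn_integral_init\<close>)
    ultimately show ?case using IH(2) by (auto intro: order_trans)
  qed
  \<comment> \<open>Everything except the service times still hidden. All gaps are included, also
    those of later jobs, because \<open>G\<close> looks at \<open>K\<close> of them.\<close>
  define J' where "J' k = sources n q - {Work i |i. k \<le> i}" for k
  have jobs: "P \<le> (\<integral>\<^sup>+\<omega>. indicator G \<omega> * ennreal (few_departures m n T (jobs S n q \<omega> k)) \<partial>M)" for k
  proof (induction k)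
    case 0
    have "jobs S n q \<omega> 0 = L n \<omega>" for \<omega> unfolding jobs_0_one[OF q] L_def ..
    then show ?case using init[of n] by simp
  next
    case (Suc k)
    have inp: "measurable_inputs (src_algebra (J' k)) S n d q k"
      by (rule measurable_inputs_src) (auto simp: J'_def sources_def)
    have a: "arrival_time S k \<in> borel_measurable (src_algebra (J' k))"
      unfolding arrival_time_epoch[abs_def] by (rule epm) (auto simp: J'_def sources_def)
    define s where "s \<omega> = pick (\<lambda>s. jobs_present (jobs S n q \<omega> k) s (arrival_time S k \<omega>)) (sampled S k \<omega>) (tie_rank S k \<omega>)" for \<omega>
    have sm: "s \<in> src_algebra (J' k) \<rightarrow>\<^sub>M count_space UNIV"
      unfolding s_def[abs_def]
    proof (rule measurable_pick)
      show "(\<lambda>\<omega> s. jobs_present (jobs S n q \<omega> k) s (arrival_time S k \<omega>)) \<in> src_algebra (J' k) \<rightarrow>\<^sub>M len_space"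
        unfolding measurable_len_space_iff
        using measurable_job_listD(1)[OF measurable_jobs[OF inp] measurable_ident_sets[OF refl] a] by auto
    qed (auto intro!: measurable_src simp: J'_def sources_def)
    have AE: "AE \<omega> in M. s \<omega> < n \<and> 0 \<le> arrival_time S k \<omega>"
      using AE_good_path[OF n l]
    proof eventually_elim
      case (elim \<omega>)
      then have "sampled S k \<omega> \<in> samples n d" by (simp add: good_path_def)
      from pick_less(1)[OF this d] epoch_nonneg[OF elim] show ?case
        unfolding s_def arrival_time_epoch by simp
    qed
    have "(\<integral>\<^sup>+\<omega>. indicator G \<omega> * ennreal (few_departures m n T (jobs S n q \<omega> k)) \<partial>M) \<le>
        (\<integral>\<^sup>+\<omega>. indicator G \<omega> * ennreal (few_departures m n T (jobs S n q \<omega> (Suc k))) \<partial>M)"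
      unfolding jobs_Suc_eq Let_def s_def[symmetric]
    proof (rule few_departures_mono_job[where J="J' k" and i="Work k" and s=s and a="arrival_time S k"])
      show "(indicator G :: _ \<Rightarrow> ennreal) \<in> borel_measurable (src_algebra (J' k))"
        by (rule Gm) (auto simp: J'_def sources_def)
      show "J' k \<subseteq> sources n q" "Work k \<in> sources n q" "Work k \<notin> J' k"
        by (auto simp: J'_def sources_def)
    qed (rule measurable_jobs[OF inp] a sm AE measurable_src(2) nn_integral_work singletonI | assumption)+
    with Suc show ?case by (rule order_trans)
  qed
  have U: "event_U M S n q j T \<in> events"
    by (rule sets_events(1)[OF measurable_inputs_M n j])
  have "P \<le> (\<integral>\<^sup>+\<omega>. indicator (event_U M S n q j T) \<omega> \<partial>M)"
  proof (rule order_trans[OF jobs[of K]], rule nn_integral_mono_AE)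
    show "AE \<omega> in M. indicator G \<omega> * ennreal (few_departures m n T (jobs S n q \<omega> K)) \<le> indicator (event_U M S n q j T) \<omega>"
      using AE_good_path[OF n l]
    proof eventually_elim
      case (elim \<omega>)
      show ?case
      \<comment> \<open>\<open>few_departures\<close> is at most 1 and vanishes unless fewer than
        \<open>m\<close> jobs have left.\<close>
      proof (cases "\<omega> \<in> G \<and> num_departed T (jobs S n q \<omega> K) < m")
        case True
        then have "num_departed T (jobs S n q \<omega> K) + (j - 1) * n < n + K" using K by linarith
        then have "\<omega> \<in> event_U M S n q j T"
          using event_U_pigeonhole[OF elim n d _ q, of j K T M] True j by (auto simp: G_def)
        then show ?thesis
          using few_departures_le[of m n T "jobs S n q \<omega> K"] True by (simp add: ennreal_le_1)
      next
        case False
        then have "indicator G \<omega> * ennreal (few_departures m n T (jobs S n q \<omega> K)) = 0"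
          using few_departures_le[of m n T "jobs S n q \<omega> K"] by (auto simp: indicator_def ennreal_neg)
        then show ?thesis by (simp only: zero_le)
      qed
    qed
  qed
  also have "\<dots> = ennreal (prob (event_U M S n q j T))"
    using U by (simp add: emeasure_eq_measure)
  finally show ?thesis by (simp add: P_def G_def)
qed

text \<open>The sum of the gaps is Erlang distributed, so the event has the probability of at least
  \<open>K\<close> Poisson points. A single atom of this tail suffices on the exponential
  scale.\<close>

lemma prob_epoch_le_ge:
  assumes n: "n \<ge> 1" and l: "l > 0" and T: "T \<ge> 0" and K: "K \<ge> 1"
  shows "exp (- (real n * l * T)) * (real n * l * T) ^ K / fact K \<le> prob {\<omega> \<in> space M. epoch S K \<omega> \<le> T}"
proof -
  have "indep_vars (\<lambda>_. borel) (arr_gap S) {..<K}"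
    unfolding indep_vars_def2
  proof (intro conjI ballI)
    show "arr_gap S i \<in> borel_measurable M" for i
      using distributed_measurable[OF arr_gap] by simp
    have E: "{arr_gap S k -` A \<inter> space M |A. A \<in> sets borel} = source_events M S n d (Gap k)" for k
      by (simp add: source_events_def sets_vimage_algebra2)
    show "indep_sets (\<lambda>i. {arr_gap S i -` A \<inter> space M |A. A \<in> sets borel}) {..<K}"
      unfolding E
    proof (rule indep_setsI)
      fix i show "source_events M S n d (Gap i) \<subseteq> events"
        using indep by (auto simp: indep_sets_def sources_def)
    next
      fix A J assume J: "J \<noteq> {}" "J \<subseteq> {..<K}" "finite J" "\<forall>j\<in>J. A j \<in> source_events M S n d (Gap j)"
      define B where "B x = A (case x of Gap k \<Rightarrow> k | _ \<Rightarrow> 0)" for x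
      have "prob (\<Inter>x\<in>Gap ` J. B x) = (\<Prod>x\<in>Gap ` J. prob (B x))"
        using J by (intro indep_setsD[OF indep]) (auto simp: B_def sources_def)
      also have "\<dots> = (\<Prod>k\<in>J. prob (A k))"
        by (subst prod.reindex) (auto simp: B_def inj_on_def)
      also have "(\<Inter>x\<in>Gap ` J. B x) = (\<Inter>k\<in>J. A k)"
        by (simp add: B_def)
      finally show "prob (\<Inter>j\<in>J. A j) = (\<Prod>j\<in>J. prob (A j))" .
    qed
  qed
  then have "distributed M lborel (\<lambda>\<omega>. \<Sum>i\<in>{..<K}. arr_gap S i \<omega>) (erlang_density (card {..<K} - 1) (real n * l))"
    using n l K by (intro exponential_distributed_sum arr_gap) (auto simp: lessThan_empty_iff)
  then have "distributed M lborel (epoch S K) (erlang_density (K - 1) (real n * l))"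
    by (simp add: epoch_def[abs_def])
  then have "prob {\<omega> \<in> space M. epoch S K \<omega> \<le> T} = erlang_CDF (K - 1) (real n * l) T"
    using n l T by (intro erlang_distributed_le) auto
  also have "\<dots> = 1 - poisson_less K (real n * l * T)"
  proof -
    have "{..K - 1} = {..<K}" using K by auto
    then show ?thesis using T by (simp add: erlang_CDF_def poisson_less_def mult.commute mult.assoc)
  qed
  \<comment> \<open>A tail is at least its first atom, because \<open>poisson_less (Suc K)\<close>
    is at most 1.\<close>
  finally show ?thesis
    using poisson_less_le_1[of "real n * l * T" "Suc K"] n l T by (simp add: poisson_less_def)
qed

text \<open>With \<open>K\<close> arrivals and at most \<open>m\<close> departures there remain
  \<open>n + K - m = (j - 1) * n + 1\<close> jobs, just one more than queues of length
  \<open>j - 1\<close> can hold.\<close>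

lemma prob_event_U_ge:
  assumes n: "n \<ge> 1" and d: "d \<ge> 1" and l: "l > 0" and q: "\<forall>s<n. q s = 1" and j: "j \<ge> 2" and T: "T \<ge> 0"
    and K: "K = m + (j - 2) * n + 1"
  shows "(exp (- (real n * l * T)) * (real n * l * T) ^ K / fact K) *
      (exp (- (real n * T)) * (real n * T) ^ m / fact m) \<le> prob (event_U M S n q j T)"
proof -
  have "(j - 1) * n = (j - 2) * n + n"
  proof -
    have "j - 1 = Suc (j - 2)" using j by simp
    then show ?thesis by simp
  qed
  then have "Suc m + (j - 1) * n \<le> n + K" using K by linarith
  then have main: "prob {\<omega> \<in> space M. epoch S K \<omega> \<le> T} * poisson_less (Suc m) (real n * T) \<le> prob (event_U M S n q j T)"
    by (rule prob_event_U_ge_poisson_less[OF n d l q j T])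
  have "exp (- (real n * l * T)) * (real n * l * T) ^ K / fact K \<le> prob {\<omega> \<in> space M. epoch S K \<omega> \<le> T}"
    by (rule prob_epoch_le_ge[OF n l T]) (simp add: K)
  moreover have "exp (- (real n * T)) * (real n * T) ^ m / fact m \<le> poisson_less (Suc m) (real n * T)"
    using T by (intro poisson_less_ge) auto
  moreover have "0 \<le> exp (- (real n * T)) * (real n * T) ^ m / fact m"
    using T by simp
  ultimately have "(exp (- (real n * l * T)) * (real n * l * T) ^ K / fact K) *
      (exp (- (real n * T)) * (real n * T) ^ m / fact m) \<le>
      prob {\<omega> \<in> space M. epoch S K \<omega> \<le> T} * poisson_less (Suc m) (real n * T)"
    by (intro mult_mono) simp_all
  with main show ?thesis by linarith
qed

end

subsection \<open>Integrating out the residual service times\<close>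

lemma measurable_random_index:
  assumes m: "m \<in> N \<rightarrow>\<^sub>M len_space" and s: "s \<in> N \<rightarrow>\<^sub>M count_space UNIV"
  shows "(\<lambda>x. m x (s x)) \<in> N \<rightarrow>\<^sub>M count_space UNIV"
proof (rule measurable_compose_countable[OF _ s])
  show "(\<lambda>x. m x i) \<in> N \<rightarrow>\<^sub>M count_space UNIV" for i
    using m unfolding measurable_len_space_iff by blast
qed

lemma measurable_inc:
  assumes m: "m \<in> N \<rightarrow>\<^sub>M len_space" and s: "s \<in> N \<rightarrow>\<^sub>M count_space UNIV"
  shows "(\<lambda>x. (m x)(s x := Suc (m x (s x)))) \<in> N \<rightarrow>\<^sub>M len_space"
proof (rule measurable_compose_countable[OF _ s])
  fix i
  have "(\<lambda>x. m x i) \<in> N \<rightarrow>\<^sub>M count_space UNIV" using m unfolding measurable_len_space_iff by blast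
  then show "(\<lambda>x. (m x)(i := Suc (m x i))) \<in> N \<rightarrow>\<^sub>M len_space"
    by (intro measurable_len_upd[OF m]) measurable
qed

lemma measurable_entry_upd:
  assumes r: "r \<in> N \<rightarrow>\<^sub>M res_space" and s: "s \<in> N \<rightarrow>\<^sub>M count_space UNIV"
    and i: "i \<in> N \<rightarrow>\<^sub>M count_space UNIV" and w: "w \<in> borel_measurable N"
  shows "(\<lambda>x. (r x)(s x := (r x (s x))(i x := w x))) \<in> N \<rightarrow>\<^sub>M res_space"
proof (rule measurable_compose_countable[OF _ s], rule measurable_compose_countable[OF _ i])
  fix s' i'
  have "(\<lambda>x. r x s') \<in> N \<rightarrow>\<^sub>M PiM UNIV (\<lambda>_. borel)" using r by (auto simp: measurable_res_space_iff)
  then show "(\<lambda>x. (r x)(s' := (r x s')(i' := w x))) \<in> N \<rightarrow>\<^sub>M res_space"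
    by (intro measurable_res_upd[OF r] measurable_upd_nat w)
qed

lemma measurable_sys_step:
  assumes g: "g \<in> borel_measurable N" and D: "D \<in> N \<rightarrow>\<^sub>M count_space (samples n d)"
    and p: "p \<in> N \<rightarrow>\<^sub>M count_space (rankings n)" and w: "w \<in> borel_measurable N"
    and x: "x \<in> N \<rightarrow>\<^sub>M len_space \<Otimes>\<^sub>M res_space"
  shows "(\<lambda>\<omega>. sys_step n (g \<omega>) (D \<omega>) (p \<omega>) (w \<omega>) (x \<omega>)) \<in> N \<rightarrow>\<^sub>M len_space \<Otimes>\<^sub>M res_space"
proof -
  note x' = measurable_compose[OF x measurable_fst] measurable_compose[OF x measurable_snd]
  note a = measurable_adv_len[OF g x'] measurable_adv_res[OF g x']
  note s = measurable_pick[OF a(1) D p]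
  show ?thesis
    unfolding sys_step_def Let_def
    by (intro measurable_Pair measurable_inc[OF a(1) s] measurable_entry_upd[OF a(2) s _ w] measurable_random_index[OF a(1) s])
qed

lemma measurable_sys_state:
  assumes inp: "measurable_inputs N' S n d q k" and q: "\<forall>s<n. q s = 1"
    and f: "f \<in> N \<rightarrow>\<^sub>M res_space" and g: "g \<in> N \<rightarrow>\<^sub>M N'"
  shows "(\<lambda>x. sys_state S n (f x) (g x) k) \<in> N \<rightarrow>\<^sub>M len_space \<Otimes>\<^sub>M res_space"
  using inp
proof (induction k)
  case 0
  have "(\<lambda>x s. if s < n then (f x s)(0 := init_work S s 0 (g x)) else f x s) \<in> N \<rightarrow>\<^sub>M res_space"
    unfolding measurable_res_space_iff
  proof
    fix s
    have fs: "(\<lambda>x. f x s) \<in> N \<rightarrow>\<^sub>M PiM UNIV (\<lambda>_. borel)" using f by (auto simp: measurable_res_space_iff)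
    show "(\<lambda>x. if s < n then (f x s)(0 := init_work S s 0 (g x)) else f x s) \<in> N \<rightarrow>\<^sub>M PiM UNIV (\<lambda>_. borel)"
    proof (cases "s < n")
      case True
      then have "init_work S s 0 \<in> borel_measurable N'" using 0 q by (auto simp: measurable_inputs_def)
      with True show ?thesis by (auto intro!: measurable_upd_nat fs measurable_compose[OF g])
    qed (use fs in simp)
  qed
  then show ?case by (auto intro!: measurable_Pair)
next
  case (Suc k)
  then have "(\<lambda>x. sys_state S n (f x) (g x) k) \<in> N \<rightarrow>\<^sub>M len_space \<Otimes>\<^sub>M res_space"
    using measurable_inputs_mono[of N' S n d q "Suc k" k] by simp
  moreover have "arr_gap S k \<in> borel_measurable N'" "work S k \<in> borel_measurable N'"
     "sampled S k \<in> N' \<rightarrow>\<^sub>M count_space (samples n d)" "tie_rank S k \<in> N' \<rightarrow>\<^sub>M count_space (rankings n)"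
    using Suc.prems by (auto simp: measurable_inputs_def)
  ultimately show ?case
    unfolding sys_state.simps by (intro measurable_sys_step measurable_compose[OF g])
qed

text \<open>Writing a fresh exponential requirement over any entry preserves the law of the
  array.\<close>

lemma nn_integral_famexp_entry:
  assumes f: "f \<in> borel_measurable res_space"
  shows "(\<integral>\<^sup>+r. f r \<partial>famexp) = (\<integral>\<^sup>+r. \<integral>\<^sup>+w. f (r(s := (r s)(i := w))) \<partial>expo \<partial>famexp)"
proof -
  interpret expo: prob_space expo by (rule prob_space_expo)
  have upd: "(\<integral>\<^sup>+r. h r \<partial>famexp) = (\<integral>\<^sup>+r. \<integral>\<^sup>+x. h (r(s := x)) \<partial>seqexp \<partial>famexp)"
    if "h \<in> borel_measurable res_space" for h :: "_ \<Rightarrow> ennreal"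
    using that by (intro nn_integral_famexp_upd)
      (simp add: res_space_def seqexp_def famexp_def sets_famexp_res cong: measurable_cong_sets)
  have "(\<lambda>(r, w). f (r(s := (r s)(i := w)))) \<in> borel_measurable (res_space \<Otimes>\<^sub>M expo)"
    unfolding split_beta'
    by (intro measurable_compose[OF _ f] measurable_entry_upd) auto
  then have m: "(\<lambda>r. \<integral>\<^sup>+w. f (r(s := (r s)(i := w))) \<partial>expo) \<in> borel_measurable res_space"
    by (rule expo.borel_measurable_nn_integral)
  have fs: "(\<lambda>x. f (r(s := x))) \<in> borel_measurable (PiM UNIV (\<lambda>_. borel))" for r
    by (intro measurable_compose[OF _ f] measurable_res_upd) auto
  have "(\<integral>\<^sup>+r. \<integral>\<^sup>+w. f (r(s := (r s)(i := w))) \<partial>expo \<partial>famexp) =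
      (\<integral>\<^sup>+r. \<integral>\<^sup>+x. \<integral>\<^sup>+w. f (r(s := x(i := w))) \<partial>expo \<partial>seqexp \<partial>famexp)"
    by (subst upd[OF m]) simp
  also have "\<dots> = (\<integral>\<^sup>+r. \<integral>\<^sup>+x. f (r(s := x)) \<partial>seqexp \<partial>famexp)"
  proof (rule nn_integral_cong)
    fix r
    have "(\<lambda>x. f (r(s := x))) \<in> borel_measurable seqexp"
      using fs[of r] by (simp add: sets_seqexp cong: measurable_cong_sets)
    from nn_integral_seqexp_upd[OF this, of i]
    show "(\<integral>\<^sup>+x. \<integral>\<^sup>+w. f (r(s := x(i := w))) \<partial>expo \<partial>seqexp) = (\<integral>\<^sup>+x. f (r(s := x)) \<partial>seqexp)"
      by simp
  qed
  also have "\<dots> = (\<integral>\<^sup>+r. f r \<partial>famexp)" by (rule upd[OF f, symmetric])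
  finally show ?thesis ..
qed

definition arrive_len :: "nat set \<Rightarrow> (nat \<Rightarrow> nat) \<Rightarrow> (nat \<Rightarrow> nat) \<Rightarrow> nat \<Rightarrow> nat" where
  "arrive_len D p m = m(pick m D p := Suc (m (pick m D p)))"

definition arrive :: "nat set \<Rightarrow> (nat \<Rightarrow> nat) \<Rightarrow> real \<Rightarrow> (nat \<Rightarrow> nat) \<times> (nat \<Rightarrow> nat \<Rightarrow> real) \<Rightarrow>
    (nat \<Rightarrow> nat) \<times> (nat \<Rightarrow> nat \<Rightarrow> real)" where
  "arrive D p w x = (let s = pick (fst x) D p in (arrive_len D p (fst x), (snd x)(s := (snd x s)(fst x s := w))))"

lemma sys_step_eq: "sys_step n g D p w (m, r) = arrive D p w (adv_len n g m r, adv_res n g m r)"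
  by (simp add: sys_step_def arrive_def arrive_len_def Let_def)

lemma measurable_arrive_len:
  assumes "D \<in> samples n d" "p \<in> rankings n" and m: "m \<in> N \<rightarrow>\<^sub>M len_space"
  shows "(\<lambda>x. arrive_len D p (m x)) \<in> N \<rightarrow>\<^sub>M len_space"
  unfolding arrive_len_def
  by (intro measurable_inc[OF m] measurable_pick[OF m, where n=n and d=d]) (use assms in auto)

lemma measurable_arrive:
  assumes D: "D \<in> samples n d" and p: "p \<in> rankings n"
    and w: "w \<in> borel_measurable N" and x: "x \<in> N \<rightarrow>\<^sub>M len_space \<Otimes>\<^sub>M res_space"
  shows "(\<lambda>y. arrive D p (w y) (x y)) \<in> N \<rightarrow>\<^sub>M len_space \<Otimes>\<^sub>M res_space"
proof -
  note x' = measurable_compose[OF x measurable_fst] measurable_compose[OF x measurable_snd]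
  have s: "(\<lambda>y. pick (fst (x y)) D p) \<in> N \<rightarrow>\<^sub>M count_space UNIV"
    by (rule measurable_pick[OF x'(1), where n=n and d=d]) (use D p in auto)
  show ?thesis unfolding arrive_def Let_def
    by (intro measurable_Pair measurable_arrive_len[OF D p x'(1)]
      measurable_entry_upd[OF x'(2) s _ w] measurable_random_index[OF x'(1) s])
qed

lemma measurable_ident_famexp: "(\<lambda>x. x) \<in> famexp \<rightarrow>\<^sub>M res_space"
  by (rule measurable_ident_sets) (rule sets_famexp_res)

text \<open>During the gap the residuals are renewed given the lengths, and the new job replaces one
  entry by another exponential variable. The old residuals \<open>r\<close> thus affect only the new
  lengths, and \<open>r'\<close> is fresh.\<close>

lemma nn_integral_sys_step:
  assumes H: "H \<in> borel_measurable (len_space \<Otimes>\<^sub>M res_space)" and g: "0 \<le> g"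
    and D: "D \<in> samples n d" and p: "p \<in> rankings n"
  shows "(\<integral>\<^sup>+w. \<integral>\<^sup>+r. H (sys_step n g D p w (m, r)) \<partial>famexp \<partial>expo) =
    (\<integral>\<^sup>+r. \<integral>\<^sup>+r'. H (arrive_len D p (adv_len n g m r), r') \<partial>famexp \<partial>famexp)"
proof -
  interpret expo: prob_space expo by (rule prob_space_expo)
  interpret fam: prob_space famexp by (rule prob_space_famexp)
  interpret ef: pair_sigma_finite expo famexp ..
  note idf = measurable_ident_famexp
  have HA: "(\<lambda>y. H (arrive D p (w y) (l y, r y))) \<in> borel_measurable N"
    if "w \<in> borel_measurable N" "l \<in> N \<rightarrow>\<^sub>M len_space" "r \<in> N \<rightarrow>\<^sub>M res_space"
    for w l r and N :: "((real \<times> (nat \<Rightarrow> nat \<Rightarrow> real)) \<times> (nat \<Rightarrow> nat \<Rightarrow> real)) measure"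
    by (rule measurable_compose[OF measurable_arrive[OF D p] H], rule that(1), rule measurable_Pair[OF that(2,3)])
  have "(\<integral>\<^sup>+w. \<integral>\<^sup>+r. H (sys_step n g D p w (m, r)) \<partial>famexp \<partial>expo) =
      (\<integral>\<^sup>+w. \<integral>\<^sup>+r. \<integral>\<^sup>+r'. H (arrive D p w (adv_len n g m r, r')) \<partial>famexp \<partial>famexp \<partial>expo)"
    unfolding sys_step_eq
    by (intro nn_integral_cong nn_integral_adv_all[OF _ g] measurable_compose[OF measurable_arrive[OF D p] H]) auto
  also have "\<dots> = (\<integral>\<^sup>+r. \<integral>\<^sup>+w. \<integral>\<^sup>+r'. H (arrive D p w (adv_len n g m r, r')) \<partial>famexp \<partial>expo \<partial>famexp)"
  proof (rule ef.Fubini'[symmetric])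
    show "(\<lambda>(w, r). \<integral>\<^sup>+r'. H (arrive D p w (adv_len n g m r, r')) \<partial>famexp) \<in> borel_measurable (expo \<Otimes>\<^sub>M famexp)"
      unfolding split_beta'
    proof (rule fam.borel_measurable_nn_integral, unfold split_beta', rule HA)
      note r = measurable_compose[OF measurable_compose[OF measurable_fst measurable_snd] idf]
      show "(\<lambda>x. adv_len n g m (snd (fst x))) \<in> (expo \<Otimes>\<^sub>M famexp) \<Otimes>\<^sub>M famexp \<rightarrow>\<^sub>M len_space"
        by (rule measurable_adv_len[OF measurable_const measurable_const r]) simp_all
      show "(\<lambda>x. snd x) \<in> (expo \<Otimes>\<^sub>M famexp) \<Otimes>\<^sub>M famexp \<rightarrow>\<^sub>M res_space"
        by (rule measurable_compose[OF measurable_snd idf])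
    qed simp
  qed
  also have "\<dots> = (\<integral>\<^sup>+r. \<integral>\<^sup>+r'. \<integral>\<^sup>+w. H (arrive D p w (adv_len n g m r, r')) \<partial>expo \<partial>famexp \<partial>famexp)"
  proof (rule nn_integral_cong, rule ef.Fubini'[symmetric])
    fix r
    show "(\<lambda>(w, r'). H (arrive D p w (adv_len n g m r, r'))) \<in> borel_measurable (expo \<Otimes>\<^sub>M famexp)"
      unfolding split_beta'
      by (rule measurable_compose[OF measurable_arrive[OF D p _ measurable_Pair[OF measurable_const measurable_compose[OF measurable_snd idf]]] H])
         simp_all
  qed
  also have "\<dots> = (\<integral>\<^sup>+r. \<integral>\<^sup>+r'. H (arrive_len D p (adv_len n g m r), r') \<partial>famexp \<partial>famexp)"
  proof (rule nn_integral_cong)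
    fix r
    have "(\<lambda>r'. H (arrive_len D p (adv_len n g m r), r')) \<in> borel_measurable res_space"
      by (intro measurable_compose[OF _ H]) simp
    from nn_integral_famexp_entry[OF this, symmetric]
    show "(\<integral>\<^sup>+r'. \<integral>\<^sup>+w. H (arrive D p w (adv_len n g m r, r')) \<partial>expo \<partial>famexp) =
        (\<integral>\<^sup>+r'. H (arrive_len D p (adv_len n g m r), r') \<partial>famexp)"
      by (simp add: arrive_def Let_def)
  qed
  finally show ?thesis .
qed

section \<open>Discounted averages over outcomes and fillers\<close>

context jsq_system
begin

definition step_weight :: "real \<Rightarrow> nat \<Rightarrow> 'w \<Rightarrow> ennreal" where
  "step_weight c k \<omega> = ennreal (exp (- (c * arr_gap S k \<omega>)))"

text \<open>Discounting in time: the restriction to epochs before \<open>T\<close> later costs only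
  a factor \<open>exp (c * T)\<close>.\<close>

definition weight :: "real \<Rightarrow> nat \<Rightarrow> 'w \<Rightarrow> ennreal" where
  "weight c k \<omega> = ennreal (exp (- (c * epoch S k \<omega>)))"

text \<open>The fillers are not random elements of \<open>M\<close>, so they are integrated
  separately against \<open>famexp\<close>.\<close>

definition avg :: "real \<Rightarrow> nat \<Rightarrow> ((nat \<Rightarrow> nat) \<times> (nat \<Rightarrow> nat \<Rightarrow> real) \<Rightarrow> ennreal) \<Rightarrow> ennreal" where
  "avg c k H = (\<integral>\<^sup>+f. \<integral>\<^sup>+\<omega>. weight c k \<omega> * H (sys_state S n f \<omega> k) \<partial>M \<partial>famexp)"

definition next_state :: "nat \<Rightarrow> 'w \<Rightarrow> real \<Rightarrow> (nat \<Rightarrow> nat) \<times> (nat \<Rightarrow> nat \<Rightarrow> real) \<Rightarrow>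
    (nat \<Rightarrow> nat) \<times> (nat \<Rightarrow> nat \<Rightarrow> real)" where
  "next_state k \<omega> w x = sys_step n (arr_gap S k \<omega>) (sampled S k \<omega>) (tie_rank S k \<omega>) w x"

definition next_len :: "nat \<Rightarrow> 'w \<Rightarrow> (nat \<Rightarrow> nat) \<Rightarrow> (nat \<Rightarrow> nat \<Rightarrow> real) \<Rightarrow> nat \<Rightarrow> nat" where
  "next_len k \<omega> m r = arrive_len (sampled S k \<omega>) (tie_rank S k \<omega>) (adv_len n (arr_gap S k \<omega>) m r)"

lemma weight_Suc: "weight c (Suc k) \<omega> = weight c k \<omega> * step_weight c k \<omega>"
  by (simp add: weight_def step_weight_def epoch_Suc ennreal_mult[symmetric] exp_add[symmetric] algebra_simps)

lemma measurable_weight: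
  assumes "measurable_inputs N' S n d q k" "y \<in> N \<rightarrow>\<^sub>M N'"
  shows "(\<lambda>z. weight c k (y z)) \<in> borel_measurable N"
proof -
  have [measurable]: "epoch S k \<in> borel_measurable N'"
    using assms(1) unfolding epoch_def[abs_def] measurable_inputs_def by (intro borel_measurable_sum) auto
  have "weight c k \<in> borel_measurable N'"
    unfolding weight_def[abs_def] by measurable
  then show ?thesis by (rule measurable_compose[OF assms(2)])
qed

definition stage_inputs :: "'w measure \<Rightarrow> nat \<Rightarrow> bool" where
  "stage_inputs N k \<longleftrightarrow> arr_gap S k \<in> borel_measurable N \<and>
     sampled S k \<in> N \<rightarrow>\<^sub>M count_space (samples n d) \<and> tie_rank S k \<in> N \<rightarrow>\<^sub>M count_space (rankings n)"

lemma measurable_step_weight: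
  assumes "stage_inputs N' k" "x \<in> N \<rightarrow>\<^sub>M N'"
  shows "(\<lambda>z. step_weight c k (x z)) \<in> borel_measurable N"
proof -
  have [measurable]: "arr_gap S k \<in> borel_measurable N'" using assms(1) by (simp add: stage_inputs_def)
  have "step_weight c k \<in> borel_measurable N'"
    unfolding step_weight_def[abs_def] by measurable
  then show ?thesis by (rule measurable_compose[OF assms(2)])
qed

lemma measurable_next_state:
  assumes st: "stage_inputs N' k" and x: "x \<in> N \<rightarrow>\<^sub>M N'" and w: "w \<in> borel_measurable N"
    and y: "y \<in> N \<rightarrow>\<^sub>M len_space \<Otimes>\<^sub>M res_space"
  shows "(\<lambda>z. next_state k (x z) (w z) (y z)) \<in> N \<rightarrow>\<^sub>M len_space \<Otimes>\<^sub>M res_space"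
proof -
  have "arr_gap S k \<in> borel_measurable N'" "sampled S k \<in> N' \<rightarrow>\<^sub>M count_space (samples n d)"
    "tie_rank S k \<in> N' \<rightarrow>\<^sub>M count_space (rankings n)"
    using st by (auto simp: stage_inputs_def)
  from this[THEN measurable_compose[OF x]] show ?thesis
    unfolding next_state_def by (rule measurable_sys_step) (rule w y)+
qed

lemma measurable_next_len:
  assumes st: "stage_inputs N' k" and x: "x \<in> N \<rightarrow>\<^sub>M N'" and m: "m \<in> N \<rightarrow>\<^sub>M len_space" and r: "r \<in> N \<rightarrow>\<^sub>M res_space"
  shows "(\<lambda>z. next_len k (x z) (m z) (r z)) \<in> N \<rightarrow>\<^sub>M len_space"
proof -
  have "arr_gap S k \<in> borel_measurable N'" and D: "sampled S k \<in> N' \<rightarrow>\<^sub>M count_space (samples n d)"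
    and p: "tie_rank S k \<in> N' \<rightarrow>\<^sub>M count_space (rankings n)"
    using st by (auto simp: stage_inputs_def)
  from measurable_adv_len[OF measurable_compose[OF x this(1)] m r]
  have a: "(\<lambda>z. adv_len n (arr_gap S k (x z)) (m z) (r z)) \<in> N \<rightarrow>\<^sub>M len_space" .
  show ?thesis
    unfolding next_len_def arrive_len_def
    by (intro measurable_inc[OF a] measurable_pick[OF a measurable_compose[OF x D] measurable_compose[OF x p]])
qed

lemma stage_inputs_M: "stage_inputs M k"
  using measurable_inputs_M[of "Suc k"] by (auto simp: stage_inputs_def measurable_inputs_def)

lemma sys_state_Suc: "sys_state S n f \<omega> (Suc k) = next_state k \<omega> (work S k \<omega>) (sys_state S n f \<omega> k)"
  by (simp add: next_state_def)

text \<open>The integrand of \<open>avg c (Suc k) H\<close> with the roles of the outcome separated: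
  \<open>x\<close> supplies gap, sample and ranking of the current arrival, \<open>w\<close> its
  service time, and \<open>y\<close> the past.\<close>

definition step_fun where
  "step_fun c k H f x w y =
     step_weight c k x * (weight c k y * H (next_state k x w (sys_state S n f y k)))"

lemma measurable_step_fun:
  assumes q: "\<forall>s<n. q s = 1" and H: "H \<in> borel_measurable (len_space \<Otimes>\<^sub>M res_space)"
    and f: "f \<in> N \<rightarrow>\<^sub>M res_space" and x: "stage_inputs N1 k" "x \<in> N \<rightarrow>\<^sub>M N1" and w: "w \<in> borel_measurable N"
    and y: "measurable_inputs N2 S n d q k" "y \<in> N \<rightarrow>\<^sub>M N2"
  shows "(\<lambda>z. step_fun c k H (f z) (x z) (w z) (y z)) \<in> borel_measurable N"
  unfolding step_fun_def
  by (intro borel_measurable_times_ennreal measurable_step_weight[OF x] measurable_weight[OF y]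
      measurable_compose[OF _ H] measurable_next_state[OF x w] measurable_sys_state[OF y(1) q f y(2)])

text \<open>Past, current arrival and current service time use disjoint groups of sources. Two
  decouplings give them separate integration variables, and Fubini brings the average over the past
  inside.\<close>

lemma avg_Suc:
  assumes q: "\<forall>s<n. q s = 1" and H: "H \<in> borel_measurable (len_space \<Otimes>\<^sub>M res_space)"
  shows "avg c (Suc k) H = (\<integral>\<^sup>+x. step_weight c k x * (\<integral>\<^sup>+w. avg c k (\<lambda>z. H (next_state k x w z)) \<partial>expo) \<partial>M)"
proof -
  interpret expo: prob_space expo by (rule prob_space_expo)
  interpret fam: prob_space famexp by (rule prob_space_famexp)
  interpret eM: pair_sigma_finite expo M ..
  interpret Mf: pair_sigma_finite M famexp ..
  interpret ef: pair_sigma_finite expo famexp ..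
  note idf = measurable_ident_famexp
  define P where "P = {Gap i |i. i < k} \<union> {Sample i |i. i < k} \<union> {Tie i |i. i < k} \<union> {Work i |i. i < k} \<union> {Init s m |s m. s < n \<and> m < q s}"
  define G where "G = {Gap k, Sample k, Tie k}"
  have sub: "P \<union> G \<union> {Work k} \<subseteq> sources n q" "(P \<union> G) \<inter> {Work k} = {}" "G \<union> P \<subseteq> sources n q" "G \<inter> P = {}"
    by (auto simp: P_def G_def sources_def)
  have inpP: "measurable_inputs (src_algebra P) S n d q k" "measurable_inputs (src_algebra (P \<union> G)) S n d q k"
    by (rule measurable_inputs_src; auto simp: P_def)+
  have stG: "stage_inputs (src_algebra G) k" "stage_inputs (src_algebra (P \<union> G)) k"
    by (auto simp: stage_inputs_def G_def intro!: measurable_src)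
  note hm = measurable_step_fun[OF q H, where c=c and k=k]
  note inpM = measurable_inputs_M[of k] and stM = stage_inputs_M[of k]
  let ?h = "step_fun c k H"
  have wk: "work S k \<in> borel_measurable (src_algebra {Work k})" by (rule measurable_src) simp
  have "avg c (Suc k) H = (\<integral>\<^sup>+f. \<integral>\<^sup>+y. ?h f y (work S k y) y \<partial>M \<partial>famexp)"
    unfolding avg_def sys_state_Suc weight_Suc step_fun_def by (simp add: ac_simps)
  also have "\<dots> = (\<integral>\<^sup>+f. \<integral>\<^sup>+x. \<integral>\<^sup>+y. \<integral>\<^sup>+w. ?h f x w y \<partial>expo \<partial>M \<partial>M \<partial>famexp)"
  proof (rule nn_integral_cong)
    fix f
    have cf: "(\<lambda>_. f) \<in> N \<rightarrow>\<^sub>M res_space" for N :: "('w \<times> 'w) measure" by simp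
    have cf1: "(\<lambda>_. f) \<in> (borel :: real measure) \<rightarrow>\<^sub>M res_space" by simp
    have cf2: "(\<lambda>_. f) \<in> N \<rightarrow>\<^sub>M res_space" for N :: "(('w \<times> 'w) \<times> real) measure" by simp
    have "(\<integral>\<^sup>+y. ?h f y (work S k y) y \<partial>M) = (\<integral>\<^sup>+y. \<integral>\<^sup>+z. ?h f y (work S k z) y \<partial>M \<partial>M)"
      by (rule nn_integral_src_decouple[OF sub(1,2)], unfold split_beta',
          rule hm[OF cf stG(2) measurable_fst measurable_compose[OF measurable_snd wk] inpP(2) measurable_fst])
    also have "\<dots> = (\<integral>\<^sup>+y. \<integral>\<^sup>+w. ?h f y w y \<partial>expo \<partial>M)"
    proof (rule nn_integral_cong)
      fix y assume y: "y \<in> space M"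
      have c: "(\<lambda>_. y) \<in> (borel :: real measure) \<rightarrow>\<^sub>M M" using y by simp
      show "(\<integral>\<^sup>+z. ?h f y (work S k z) y \<partial>M) = (\<integral>\<^sup>+w. ?h f y w y \<partial>expo)"
        by (rule nn_integral_work, rule hm[OF cf1 stM c _ inpM c]) simp
    qed
    also have "\<dots> = (\<integral>\<^sup>+x. \<integral>\<^sup>+y. \<integral>\<^sup>+w. ?h f x w y \<partial>expo \<partial>M \<partial>M)"
    proof (rule nn_integral_src_decouple[OF sub(3,4)])
      have "(\<lambda>p. \<integral>\<^sup>+w. ?h f (fst p) w (snd p) \<partial>expo) \<in> borel_measurable (src_algebra G \<Otimes>\<^sub>M src_algebra P)"
        by (rule expo.borel_measurable_nn_integral, unfold split_beta', rule hm[OF cf2 stG(1) _ _ inpP(1)])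
          (simp_all add: measurable_compose[OF measurable_fst])
      then show "(\<lambda>(x, y). \<integral>\<^sup>+w. ?h f x w y \<partial>expo) \<in> borel_measurable (src_algebra G \<Otimes>\<^sub>M src_algebra P)"
        by (simp add: split_beta')
    qed
    finally show "(\<integral>\<^sup>+y. ?h f y (work S k y) y \<partial>M) = (\<integral>\<^sup>+x. \<integral>\<^sup>+y. \<integral>\<^sup>+w. ?h f x w y \<partial>expo \<partial>M \<partial>M)" .
  qed
  also have "\<dots> = (\<integral>\<^sup>+x. \<integral>\<^sup>+f. \<integral>\<^sup>+y. \<integral>\<^sup>+w. ?h f x w y \<partial>expo \<partial>M \<partial>famexp \<partial>M)"
  proof (rule Mf.Fubini')
    show "(\<lambda>(x, f). \<integral>\<^sup>+y. \<integral>\<^sup>+w. ?h f x w y \<partial>expo \<partial>M) \<in> borel_measurable (M \<Otimes>\<^sub>M famexp)"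
      unfolding split_beta'
      by (rule borel_measurable_nn_integral, unfold split_beta', rule expo.borel_measurable_nn_integral, unfold split_beta',
          rule hm[OF _ stM _ _ inpM])
         (simp_all add: measurable_compose[OF measurable_fst] measurable_compose[OF _ idf])
  qed
  also have "\<dots> = (\<integral>\<^sup>+x. \<integral>\<^sup>+w. \<integral>\<^sup>+f. \<integral>\<^sup>+y. ?h f x w y \<partial>M \<partial>famexp \<partial>expo \<partial>M)"
  proof (rule nn_integral_cong)
    fix x assume x: "x \<in> space M"
    have "(\<integral>\<^sup>+f. \<integral>\<^sup>+y. \<integral>\<^sup>+w. ?h f x w y \<partial>expo \<partial>M \<partial>famexp) = (\<integral>\<^sup>+f. \<integral>\<^sup>+w. \<integral>\<^sup>+y. ?h f x w y \<partial>M \<partial>expo \<partial>famexp)"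
    proof (rule nn_integral_cong, rule eM.Fubini')
      fix f
      show "(\<lambda>(w, y). ?h f x w y) \<in> borel_measurable (expo \<Otimes>\<^sub>M M)"
        unfolding split_beta' by (rule hm[OF _ stM _ _ inpM]) (use x in simp_all)
    qed
    also have "\<dots> = (\<integral>\<^sup>+w. \<integral>\<^sup>+f. \<integral>\<^sup>+y. ?h f x w y \<partial>M \<partial>famexp \<partial>expo)"
    proof (rule ef.Fubini')
      show "(\<lambda>(w, f). \<integral>\<^sup>+y. ?h f x w y \<partial>M) \<in> borel_measurable (expo \<Otimes>\<^sub>M famexp)"
        unfolding split_beta'
        by (rule borel_measurable_nn_integral, unfold split_beta', rule hm[OF _ stM _ _ inpM])
           (use x in \<open>simp_all add: measurable_compose[OF measurable_fst] measurable_compose[OF _ idf]\<close>)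
    qed
    finally show "(\<integral>\<^sup>+f. \<integral>\<^sup>+y. \<integral>\<^sup>+w. ?h f x w y \<partial>expo \<partial>M \<partial>famexp) = (\<integral>\<^sup>+w. \<integral>\<^sup>+f. \<integral>\<^sup>+y. ?h f x w y \<partial>M \<partial>famexp \<partial>expo)" .
  qed
  also have "\<dots> = (\<integral>\<^sup>+x. step_weight c k x * (\<integral>\<^sup>+w. avg c k (\<lambda>z. H (next_state k x w z)) \<partial>expo) \<partial>M)"
  proof (rule nn_integral_cong)
    fix x assume x: "x \<in> space M"
    define a where "a f w y = weight c k y * H (next_state k x w (sys_state S n f y k))" for f w y
    have am: "(\<lambda>z. a (f z) (w z) (y z)) \<in> borel_measurable N"
      if "f \<in> N \<rightarrow>\<^sub>M res_space" "w \<in> borel_measurable N" "y \<in> N \<rightarrow>\<^sub>M M" for f w y and N :: "((real \<times> (nat \<Rightarrow> nat \<Rightarrow> real)) \<times> 'w) measure"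
      unfolding a_def
      by (intro borel_measurable_times_ennreal measurable_weight[OF inpM that(3)] measurable_compose[OF _ H]
        measurable_next_state[OF stM _ that(2)] measurable_sys_state[OF inpM q that(1,3)]) (use x in simp)
    have a3: "(\<lambda>p. \<integral>\<^sup>+y. a (snd p) (fst p) y \<partial>M) \<in> borel_measurable (expo \<Otimes>\<^sub>M famexp)"
      by (rule borel_measurable_nn_integral, unfold split_beta', rule am)
        (simp_all add: measurable_compose[OF measurable_fst] measurable_compose[OF _ idf])
    have a2: "(\<lambda>f. \<integral>\<^sup>+y. a f w y \<partial>M) \<in> borel_measurable famexp" for w
      using measurable_compose[OF measurable_Pair1' a3, of w] by simp
    have a1: "(\<lambda>y. a f w y) \<in> borel_measurable M" for f w
      unfolding a_def
      by (intro borel_measurable_times_ennreal measurable_weight[OF inpM] measurable_compose[OF _ H]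
        measurable_next_state[OF stM] measurable_sys_state[OF inpM q]) (use x in simp_all)
    have a4: "(\<lambda>w. \<integral>\<^sup>+f. \<integral>\<^sup>+y. a f w y \<partial>M \<partial>famexp) \<in> borel_measurable expo"
      using a3 by (intro fam.borel_measurable_nn_integral) (simp add: split_beta')
    show "(\<integral>\<^sup>+w. \<integral>\<^sup>+f. \<integral>\<^sup>+y. ?h f x w y \<partial>M \<partial>famexp \<partial>expo) =
        step_weight c k x * (\<integral>\<^sup>+w. avg c k (\<lambda>z. H (next_state k x w z)) \<partial>expo)"
      using nn_integral_cmult[OF a1] nn_integral_cmult[OF a2] nn_integral_cmult[OF a4]
      unfolding step_fun_def avg_def a_def[symmetric] by simp
  qed
  finally show ?thesis .
qed

lemma avg_swap:
  fixes N :: "'z measure"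
  assumes N: "sigma_finite_measure N" and q: "\<forall>s<n. q s = 1"
    and H: "(\<lambda>(w, z). H w z) \<in> borel_measurable (N \<Otimes>\<^sub>M (len_space \<Otimes>\<^sub>M res_space))"
  shows "(\<integral>\<^sup>+w. avg c k (H w) \<partial>N) = avg c k (\<lambda>z. \<integral>\<^sup>+w. H w z \<partial>N)"
proof -
  interpret N: sigma_finite_measure N by fact
  interpret fam: prob_space famexp by (rule prob_space_famexp)
  interpret Nf: pair_sigma_finite N famexp ..
  interpret NM: pair_sigma_finite N M ..
  note idf = measurable_ident_famexp
  note inpM = measurable_inputs_M[of k]
  have am: "(\<lambda>p. weight c k (snd p) * H (fst (fst p)) (sys_state S n (snd (fst p)) (snd p) k)) \<in> borel_measurable ((N \<Otimes>\<^sub>M famexp) \<Otimes>\<^sub>M M)"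
  proof -
    have "(\<lambda>p. (fst (fst p), sys_state S n (snd (fst p)) (snd p) k)) \<in> (N \<Otimes>\<^sub>M famexp) \<Otimes>\<^sub>M M \<rightarrow>\<^sub>M N \<Otimes>\<^sub>M (len_space \<Otimes>\<^sub>M res_space)"
      by (intro measurable_Pair measurable_sys_state[OF inpM q]) (simp_all add: measurable_compose[OF measurable_fst] measurable_compose[OF _ idf])
    from measurable_compose[OF this H] show ?thesis
      by (intro borel_measurable_times_ennreal measurable_weight[OF inpM measurable_snd]) simp
  qed
  have "(\<integral>\<^sup>+w. avg c k (H w) \<partial>N) = (\<integral>\<^sup>+f. \<integral>\<^sup>+w. \<integral>\<^sup>+y. weight c k y * H w (sys_state S n f y k) \<partial>M \<partial>N \<partial>famexp)"
    unfolding avg_def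
  proof (rule Nf.Fubini'[symmetric])
    show "(\<lambda>(w, f). \<integral>\<^sup>+y. weight c k y * H w (sys_state S n f y k) \<partial>M) \<in> borel_measurable (N \<Otimes>\<^sub>M famexp)"
      unfolding split_beta' by (rule borel_measurable_nn_integral) (use am in \<open>simp add: split_beta'\<close>)
  qed
  also have "\<dots> = (\<integral>\<^sup>+f. \<integral>\<^sup>+y. \<integral>\<^sup>+w. weight c k y * H w (sys_state S n f y k) \<partial>N \<partial>M \<partial>famexp)"
  proof (rule nn_integral_cong, rule NM.Fubini'[symmetric])
    fix f
    have "(\<lambda>p. (fst p, sys_state S n f (snd p) k)) \<in> N \<Otimes>\<^sub>M M \<rightarrow>\<^sub>M N \<Otimes>\<^sub>M (len_space \<Otimes>\<^sub>M res_space)"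
      by (intro measurable_Pair measurable_sys_state[OF inpM q]) simp_all
    from measurable_compose[OF this H]
    have "(\<lambda>p. weight c k (snd p) * H (fst p) (sys_state S n f (snd p) k)) \<in> borel_measurable (N \<Otimes>\<^sub>M M)"
      by (intro borel_measurable_times_ennreal measurable_weight[OF inpM measurable_snd]) simp
    then show "(\<lambda>(w, y). weight c k y * H w (sys_state S n f y k)) \<in> borel_measurable (N \<Otimes>\<^sub>M M)"
      by (simp add: split_beta')
  qed
  also have "\<dots> = avg c k (\<lambda>z. \<integral>\<^sup>+w. H w z \<partial>N)"
    unfolding avg_def
  proof (intro nn_integral_cong)
    fix f y
    have "(\<lambda>w. H w z) \<in> borel_measurable N" for z
      using measurable_compose[OF measurable_Pair2' H, of z] by (simp add: space_pair_measure)
    then show "(\<integral>\<^sup>+w. weight c k y * H w (sys_state S n f y k) \<partial>N) = weight c k y * (\<integral>\<^sup>+w. H w (sys_state S n f y k) \<partial>N)"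
      by (rule nn_integral_cmult)
  qed
  finally show ?thesis .
qed

lemma avg_mono: "(\<And>z. H z \<le> H' z) \<Longrightarrow> avg c k H \<le> avg c k H'"
  unfolding avg_def by (intro nn_integral_mono mult_left_mono) auto

lemma avg_cmult:
  assumes q: "\<forall>s<n. q s = 1" and H: "H \<in> borel_measurable (len_space \<Otimes>\<^sub>M res_space)"
  shows "avg c k (\<lambda>z. a * H z) = a * avg c k H"
proof -
  have "(\<lambda>p. weight c k (snd p) * H (sys_state S n (fst p) (snd p) k)) \<in> borel_measurable (famexp \<Otimes>\<^sub>M M)"
    by (intro borel_measurable_times_ennreal measurable_weight[OF measurable_inputs_M measurable_snd]
        measurable_compose[OF _ H] measurable_sys_state[OF measurable_inputs_M q _ measurable_snd]
        measurable_compose[OF measurable_fst measurable_ident_famexp])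
  then have m: "(\<lambda>(f, y). weight c k y * H (sys_state S n f y k)) \<in> borel_measurable (famexp \<Otimes>\<^sub>M M)"
    by (simp add: split_beta')
  have m1: "(\<lambda>y. weight c k y * H (sys_state S n f y k)) \<in> borel_measurable M" for f
    using measurable_compose[OF measurable_Pair1' m, of f] by simp
  have m2: "(\<lambda>f. \<integral>\<^sup>+y. weight c k y * H (sys_state S n f y k) \<partial>M) \<in> borel_measurable famexp"
    by (rule borel_measurable_nn_integral[OF m])
  have "avg c k (\<lambda>z. a * H z) = (\<integral>\<^sup>+f. \<integral>\<^sup>+y. a * (weight c k y * H (sys_state S n f y k)) \<partial>M \<partial>famexp)"
    unfolding avg_def by (simp add: ac_simps)
  then show ?thesis
    unfolding avg_def by (simp add: nn_integral_cmult[OF m1] nn_integral_cmult[OF m2])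
qed

text \<open>Given the queue lengths, the residual service times are independent and exponential.\<close>

definition residual_free :: "real \<Rightarrow> nat \<Rightarrow> bool" where
  "residual_free c k \<longleftrightarrow> (\<forall>H\<in>borel_measurable (len_space \<Otimes>\<^sub>M res_space).
     avg c k H = avg c k (\<lambda>z. \<integral>\<^sup>+r. H (fst z, r) \<partial>famexp))"

text \<open>The hypothesis replaces the residuals before the gap by fresh ones, and
  \<open>nn_integral_sys_step\<close> then carries out the step. Only lengths survive from the
  state.\<close>

lemma avg_Suc_residual_free:
  assumes q: "\<forall>s<n. q s = 1" and nl: "n \<ge> 1" "l > 0"
    and H: "H \<in> borel_measurable (len_space \<Otimes>\<^sub>M res_space)" and free: "residual_free c k"
  shows "avg c (Suc k) H = (\<integral>\<^sup>+x. step_weight c k x *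
      avg c k (\<lambda>z. \<integral>\<^sup>+r. \<integral>\<^sup>+r'. H (next_len k x (fst z) r, r') \<partial>famexp \<partial>famexp) \<partial>M)"
  unfolding avg_Suc[OF q H]
proof (rule nn_integral_cong_AE)
  have gap: "AE x in M. 0 < arr_gap S k x"
    using AE_good_path[OF nl] by eventually_elim (simp add: good_path_def)
  show "AE x in M. step_weight c k x * (\<integral>\<^sup>+w. avg c k (\<lambda>z. H (next_state k x w z)) \<partial>expo) =
     step_weight c k x * avg c k (\<lambda>z. \<integral>\<^sup>+r. \<integral>\<^sup>+r'. H (next_len k x (fst z) r, r') \<partial>famexp \<partial>famexp)"
    using gap AE_space
  proof eventually_elim
    case (elim x)
    interpret expo: prob_space expo by (rule prob_space_expo)
    interpret fam: prob_space famexp by (rule prob_space_famexp)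
    note idf = measurable_ident_famexp
    have D: "sampled S k x \<in> samples n d" and p: "tie_rank S k x \<in> rankings n"
      using measurable_space[OF sampled_measurable elim(2)] measurable_space[OF tie_rank_measurable elim(2)] by auto
    have Hn: "(\<lambda>z. H (next_state k x w z)) \<in> borel_measurable (len_space \<Otimes>\<^sub>M res_space)" for w
      by (intro measurable_compose[OF _ H] measurable_next_state[OF stage_inputs_M]) (use elim in simp_all)
    have "(\<integral>\<^sup>+w. avg c k (\<lambda>z. H (next_state k x w z)) \<partial>expo) =
        (\<integral>\<^sup>+w. avg c k (\<lambda>z. \<integral>\<^sup>+r. H (next_state k x w (fst z, r)) \<partial>famexp) \<partial>expo)"
      by (intro nn_integral_cong free[unfolded residual_free_def, rule_format] Hn)
    also have "\<dots> = avg c k (\<lambda>z. \<integral>\<^sup>+w. \<integral>\<^sup>+r. H (next_state k x w (fst z, r)) \<partial>famexp \<partial>expo)"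
    proof (rule avg_swap[OF _ q])
      have "(\<lambda>p. H (next_state k x (fst (fst p)) (fst (snd (fst p)), snd p))) \<in> borel_measurable ((expo \<Otimes>\<^sub>M (len_space \<Otimes>\<^sub>M res_space)) \<Otimes>\<^sub>M famexp)"
      proof (intro measurable_compose[OF _ H] measurable_next_state[OF stage_inputs_M] measurable_Pair)
        show "(\<lambda>p. snd p) \<in> (expo \<Otimes>\<^sub>M (len_space \<Otimes>\<^sub>M res_space)) \<Otimes>\<^sub>M famexp \<rightarrow>\<^sub>M res_space"
          by (rule measurable_compose[OF measurable_snd idf])
      qed (use elim in \<open>simp_all add: measurable_compose[OF measurable_fst]\<close>)
      then show "(\<lambda>(w, z). \<integral>\<^sup>+r. H (next_state k x w (fst z, r)) \<partial>famexp) \<in> borel_measurable (expo \<Otimes>\<^sub>M (len_space \<Otimes>\<^sub>M res_space))"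
        unfolding split_beta' by (intro fam.borel_measurable_nn_integral) (simp add: split_beta')
    qed unfold_locales
    also have "\<dots> = avg c k (\<lambda>z. \<integral>\<^sup>+r. \<integral>\<^sup>+r'. H (next_len k x (fst z) r, r') \<partial>famexp \<partial>famexp)"
      unfolding next_state_def next_len_def
      using elim by (subst nn_integral_sys_step[OF H _ D p]) auto
    finally show ?case by simp
  qed
qed

text \<open>The one-step formula involves \<open>H\<close> only through its integral over
  \<open>r'\<close>, and integrating out the residuals once more does not change that.\<close>

lemma residual_free_Suc:
  assumes q: "\<forall>s<n. q s = 1" and nl: "n \<ge> 1" "l > 0" and free: "residual_free c k"
  shows "residual_free c (Suc k)"
  unfolding residual_free_def
proof
  interpret fam: prob_space famexp by (rule prob_space_famexp)
  fix H :: "(nat \<Rightarrow> nat) \<times> (nat \<Rightarrow> nat \<Rightarrow> real) \<Rightarrow> ennreal"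
  assume H: "H \<in> borel_measurable (len_space \<Otimes>\<^sub>M res_space)"
  have "(\<lambda>p. H (fst (fst p), snd p)) \<in> borel_measurable ((len_space \<Otimes>\<^sub>M res_space) \<Otimes>\<^sub>M famexp)"
    by (intro measurable_compose[OF _ H] measurable_Pair measurable_compose[OF measurable_snd measurable_ident_famexp])
       (simp add: measurable_compose[OF measurable_fst])
  then have H': "(\<lambda>z. \<integral>\<^sup>+r. H (fst z, r) \<partial>famexp) \<in> borel_measurable (len_space \<Otimes>\<^sub>M res_space)"
    by (intro fam.borel_measurable_nn_integral) (simp add: split_beta')
  show "avg c (Suc k) H = avg c (Suc k) (\<lambda>z. \<integral>\<^sup>+r. H (fst z, r) \<partial>famexp)"
    unfolding avg_Suc_residual_free[OF q nl H free] avg_Suc_residual_free[OF q nl H' free]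
    using fam.emeasure_space_1 by simp
qed

definition set_init :: "nat \<Rightarrow> (nat \<Rightarrow> nat \<Rightarrow> real) \<Rightarrow> 'w \<Rightarrow> nat \<Rightarrow> nat \<Rightarrow> real" where
  "set_init j f \<omega> = (\<lambda>s. if s < j then (f s)(0 := init_work S s 0 \<omega>) else f s)"

lemma measurable_set_init:
  assumes f: "f \<in> N \<rightarrow>\<^sub>M res_space" and y: "y \<in> N \<rightarrow>\<^sub>M N'"
    and i: "\<And>s. s < j \<Longrightarrow> init_work S s 0 \<in> borel_measurable N'"
  shows "(\<lambda>z. set_init j (f z) (y z)) \<in> N \<rightarrow>\<^sub>M res_space"
  unfolding measurable_res_space_iff
proof
  fix s
  have fs: "(\<lambda>x. f x s) \<in> N \<rightarrow>\<^sub>M PiM UNIV (\<lambda>_. borel)" using f unfolding measurable_res_space_iff by blast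
  show "(\<lambda>z. set_init j (f z) (y z) s) \<in> N \<rightarrow>\<^sub>M PiM UNIV (\<lambda>_. borel)"
  proof (cases "s < j")
    case True
    then show ?thesis
      unfolding set_init_def by (simp add: measurable_upd_nat[OF fs] measurable_compose[OF y i])
  qed (use fs in \<open>simp add: set_init_def\<close>)
qed

text \<open>The first entries come from \<open>init_work\<close>, the others from the fillers. The
  two kinds have the same law and are exchanged server by server.\<close>

lemma residual_free_0:
  assumes q: "\<forall>s<n. q s = 1"
  shows "residual_free c 0"
  unfolding residual_free_def
proof
  fix H :: "(nat \<Rightarrow> nat) \<times> (nat \<Rightarrow> nat \<Rightarrow> real) \<Rightarrow> ennreal"
  assume H: "H \<in> borel_measurable (len_space \<Otimes>\<^sub>M res_space)"
  interpret fam: prob_space famexp by (rule prob_space_famexp)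
  define m :: "nat \<Rightarrow> nat" where "m = (\<lambda>s. if s < n then 1 else 0)"
  have Hm: "(\<lambda>r. H (m, r)) \<in> borel_measurable res_space"
    by (intro measurable_compose[OF _ H]) simp
  \<comment> \<open>The interpolation: servers below \<open>j\<close> use their initial service
    times, the others only fillers.\<close>
  define Z where "Z j f = (\<integral>\<^sup>+y. H (m, set_init j f y) \<partial>M)" for j f
  have init_M: "init_work S s 0 \<in> borel_measurable M" if "s < n" for s
    using distributed_measurable[OF init_work[OF that, of 0]] q that by simp
  have Z: "Z j \<in> borel_measurable res_space" if "j \<le> n" for j
  proof -
    have "(\<lambda>p. H (m, set_init j (fst p) (snd p))) \<in> borel_measurable (res_space \<Otimes>\<^sub>M M)"
      by (intro measurable_compose[OF _ Hm] measurable_set_init[OF measurable_fst measurable_snd] init_M) (use that in simp)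
    then show ?thesis unfolding Z_def[abs_def] by (intro borel_measurable_nn_integral) (simp add: split_beta')
  qed
  have "j \<le> n \<Longrightarrow> (\<integral>\<^sup>+f. Z j f \<partial>famexp) = (\<integral>\<^sup>+r. H (m, r) \<partial>famexp)" for j
  proof (induction j)
    case 0
    then show ?case using emeasure_space_1 by (simp add: Z_def set_init_def)
  next
    case (Suc j)
    have set: "set_init (Suc j) f y = (set_init j f y)(j := (f j)(0 := init_work S j 0 y))" for f y
      by (auto simp: set_init_def fun_eq_iff less_Suc_eq)
    have set': "(set_init j f y)(j := (f j)(0 := w)) = set_init j (f(j := (f j)(0 := w))) y" for f y w
      by (auto simp: set_init_def fun_eq_iff)
    have "Z (Suc j) f = (\<integral>\<^sup>+w. Z j (f(j := (f j)(0 := w))) \<partial>expo)" for f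
    proof -
      let ?A = "{Init j 0}" and ?B = "{Init s 0 |s. s < j}"
      have "Z (Suc j) f = (\<integral>\<^sup>+y'. \<integral>\<^sup>+y. H (m, (set_init j f y)(j := (f j)(0 := init_work S j 0 y'))) \<partial>M \<partial>M)"
        unfolding Z_def set
      proof (rule nn_integral_src_decouple)
        show "?A \<union> ?B \<subseteq> sources n q" "?A \<inter> ?B = {}" using Suc.prems q by (auto simp: sources_def)
        have "(\<lambda>p. (set_init j f (snd p))(j := (f j)(0 := init_work S j 0 (fst p)))) \<in> src_algebra ?A \<Otimes>\<^sub>M src_algebra ?B \<rightarrow>\<^sub>M res_space"
          by (intro measurable_res_upd measurable_upd_nat measurable_set_init[OF measurable_const measurable_snd]
              measurable_compose[OF measurable_fst] measurable_src) (auto simp: space_PiM)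
        from measurable_compose[OF this Hm]
        show "(\<lambda>(x, y). H (m, (set_init j f y)(j := (f j)(0 := init_work S j 0 x)))) \<in> borel_measurable (src_algebra ?A \<Otimes>\<^sub>M src_algebra ?B)"
          by (simp add: split_beta')
      qed
      also have "\<dots> = (\<integral>\<^sup>+y'. Z j (f(j := (f j)(0 := init_work S j 0 y'))) \<partial>M)"
        unfolding set' Z_def ..
      also have "\<dots> = (\<integral>\<^sup>+w. Z j (f(j := (f j)(0 := w))) \<partial>expo)"
      proof (rule nn_integral_init)
        have "(\<lambda>w. f(j := (f j)(0 := w))) \<in> (borel :: real measure) \<rightarrow>\<^sub>M res_space"
          by (intro measurable_res_upd measurable_upd_nat) (simp_all add: space_PiM)
        then show "(\<lambda>w. Z j (f(j := (f j)(0 := w)))) \<in> borel_measurable borel"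
          by (rule measurable_compose) (use Z[of j] Suc.prems in simp)
      qed (use Suc.prems q in auto)
      finally show ?thesis .
    qed
    then have "(\<integral>\<^sup>+f. Z (Suc j) f \<partial>famexp) = (\<integral>\<^sup>+f. Z j f \<partial>famexp)"
      using nn_integral_famexp_entry[OF Z[of j], of j 0] Suc.prems by simp
    then show ?case using Suc by simp
  qed
  from this[of n] show "avg c 0 H = avg c 0 (\<lambda>z. \<integral>\<^sup>+r. H (fst z, r) \<partial>famexp)"
    using emeasure_space_1 fam.emeasure_space_1
    by (simp add: avg_def weight_def Z_def set_init_def m_def)
qed

lemma residual_free:
  assumes q: "\<forall>s<n. q s = 1" and nl: "n \<ge> 1" "l > 0"
  shows "residual_free c k"
  by (induction k) (use residual_free_0[OF q] residual_free_Suc[OF q nl] in auto)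

lemma avg_len_Suc:
  assumes q: "\<forall>s<n. q s = 1" and nl: "n \<ge> 1" "l > 0" and V: "V \<in> borel_measurable len_space"
  shows "avg c (Suc k) (\<lambda>z. V (fst z)) =
     avg c k (\<lambda>z. \<integral>\<^sup>+x. step_weight c k x * (\<integral>\<^sup>+r. V (next_len k x (fst z) r) \<partial>famexp) \<partial>M)"
proof -
  interpret fam: prob_space famexp by (rule prob_space_famexp)
  note idf = measurable_ident_famexp
  have H: "(\<lambda>z. V (fst z)) \<in> borel_measurable (len_space \<Otimes>\<^sub>M res_space)"
    by (rule measurable_compose[OF measurable_fst V])
  have V1: "(\<lambda>p. V (next_len k (fst (fst p)) (snd (fst p)) (snd p))) \<in> borel_measurable ((M \<Otimes>\<^sub>M len_space) \<Otimes>\<^sub>M famexp)"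
    by (intro measurable_compose[OF _ V] measurable_next_len[OF stage_inputs_M] measurable_compose[OF measurable_snd idf])
      (simp_all add: measurable_compose[OF measurable_fst])
  then have V2: "(\<lambda>p. \<integral>\<^sup>+r. V (next_len k (fst p) (snd p) r) \<partial>famexp) \<in> borel_measurable (M \<Otimes>\<^sub>M len_space)"
    by (intro fam.borel_measurable_nn_integral) (simp add: split_beta')
  have V3: "(\<lambda>z. \<integral>\<^sup>+r. V (next_len k x (fst z) r) \<partial>famexp) \<in> borel_measurable (len_space \<Otimes>\<^sub>M res_space)" if "x \<in> space M" for x
    using measurable_compose[OF measurable_Pair1'[OF that] V2] by (intro measurable_compose[OF measurable_fst]) simp
  have "avg c (Suc k) (\<lambda>z. V (fst z)) = (\<integral>\<^sup>+x. step_weight c k x * avg c k (\<lambda>z. \<integral>\<^sup>+r. V (next_len k x (fst z) r) \<partial>famexp) \<partial>M)"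
    unfolding avg_Suc_residual_free[OF q nl H residual_free[OF q nl]] using fam.emeasure_space_1 by simp
  also have "\<dots> = (\<integral>\<^sup>+x. avg c k (\<lambda>z. step_weight c k x * (\<integral>\<^sup>+r. V (next_len k x (fst z) r) \<partial>famexp)) \<partial>M)"
    using V3 by (intro nn_integral_cong avg_cmult[OF q, symmetric])
  also have "\<dots> = avg c k (\<lambda>z. \<integral>\<^sup>+x. step_weight c k x * (\<integral>\<^sup>+r. V (next_len k x (fst z) r) \<partial>famexp) \<partial>M)"
  proof (rule avg_swap[OF _ q])
    have "(\<lambda>p. (fst p, fst (snd p))) \<in> M \<Otimes>\<^sub>M (len_space \<Otimes>\<^sub>M res_space) \<rightarrow>\<^sub>M M \<Otimes>\<^sub>M len_space"
      by (intro measurable_Pair) simp_all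
    from measurable_compose[OF this V2]
    show "(\<lambda>(x, z). step_weight c k x * (\<integral>\<^sup>+r. V (next_len k x (fst z) r) \<partial>famexp)) \<in> borel_measurable (M \<Otimes>\<^sub>M (len_space \<Otimes>\<^sub>M res_space))"
      unfolding split_beta'
      by (intro borel_measurable_times_ennreal measurable_step_weight[OF stage_inputs_M measurable_fst]) simp
  qed unfold_locales
  finally show ?thesis .
qed

text \<open>As residuals are fresh given the lengths, it suffices to contract in one step from every
  frozen length vector \<open>m\<close>.\<close>

lemma avg_len_decay:
  assumes q: "\<forall>s<n. q s = 1" and nl: "n \<ge> 1" "l > 0" and V: "V \<in> borel_measurable len_space"
    and step: "\<And>k m. (\<integral>\<^sup>+x. step_weight c k x * (\<integral>\<^sup>+r. V (next_len k x m r) \<partial>famexp) \<partial>M) \<le> \<rho> * V m"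
  shows "avg c k (\<lambda>z. V (fst z)) \<le> \<rho> ^ k * V (\<lambda>s. if s < n then 1 else 0)"
proof (induction k)
  case 0
  interpret fam: prob_space famexp by (rule prob_space_famexp)
  show ?case using fam.emeasure_space_1 emeasure_space_1 by (simp add: avg_def weight_def)
next
  case (Suc k)
  have "avg c (Suc k) (\<lambda>z. V (fst z)) \<le> avg c k (\<lambda>z. \<rho> * V (fst z))"
    unfolding avg_len_Suc[OF q nl V] by (intro avg_mono step)
  also have "\<dots> = \<rho> * avg c k (\<lambda>z. V (fst z))"
    by (intro avg_cmult[OF q] measurable_compose[OF measurable_fst V])
  also have "\<dots> \<le> \<rho> * (\<rho> ^ k * V (\<lambda>s. if s < n then 1 else 0))"
    by (intro mult_left_mono Suc) simp
  finally show ?case by (simp add: mult.assoc)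
qed

end

subsection \<open>A Lyapunov function\<close>

text \<open>The value is 1 up to \<open>e\<close> and 0 from \<open>2 * e\<close> on. The linear
  descent makes it Lipschitz with constant \<open>1 / e\<close>, which controls its change over a
  batch of departures.\<close>

definition slope :: "real \<Rightarrow> nat \<Rightarrow> real" where
  "slope e i = max 0 (min 1 (2 - real i / e))"

definition idle :: "nat \<Rightarrow> (nat \<Rightarrow> nat) \<Rightarrow> nat" where
  "idle n m = card {s. s < n \<and> m s = 0}"

definition excess :: "nat \<Rightarrow> (nat \<Rightarrow> nat) \<Rightarrow> nat" where
  "excess n m = (\<Sum>s<n. m s - 1)"

text \<open>
  Jobs in excess of one per server increase the function and idle servers decrease it, but the latter
  effect fades out when between \<open>e\<close> and \<open>2 * e\<close> servers are idle. Beyond that almost all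
  jobs join idle servers.
\<close>

definition lyap :: "nat \<Rightarrow> real \<Rightarrow> real \<Rightarrow> (nat \<Rightarrow> nat) \<Rightarrow> real" where
  "lyap n \<theta> e m = \<theta> * (real (excess n m) - (\<Sum>i=1..idle n m. slope e i))"

lemma slope_nonneg: "0 \<le> slope e i" and slope_le_1: "slope e i \<le> 1"
  by (auto simp: slope_def)

lemma slope_eq_1: "0 < e \<Longrightarrow> real i \<le> e \<Longrightarrow> slope e i = 1"
  by (auto simp: slope_def field_simps)

lemma slope_eq_0: "0 < e \<Longrightarrow> 2 * e \<le> real i \<Longrightarrow> slope e i = 0"
  by (auto simp: slope_def field_simps)

lemma slope_antimono: "0 < e \<Longrightarrow> i \<le> j \<Longrightarrow> slope e j \<le> slope e i"
  by (auto simp: slope_def field_simps max_def min_def)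

lemma slope_add: "0 < e \<Longrightarrow> slope e i - real k / e \<le> slope e (i + k)"
proof -
  define x y where "x = real i / e" and "y = real k / e"
  assume "0 < e"
  then have "0 \<le> y" by (simp add: y_def)
  then show ?thesis
    unfolding slope_def of_nat_add add_divide_distrib x_def[symmetric] y_def[symmetric] by auto
qed

lemma idle_Suc: "idle (Suc n) m = idle n m + (if m n = 0 then 1 else 0)"
proof -
  have "{s. s < Suc n \<and> m s = 0} = (if m n = 0 then insert n {s. s < n \<and> m s = 0} else {s. s < n \<and> m s = 0})"
    by (auto simp: less_Suc_eq)
  then show ?thesis by (simp add: idle_def)
qed

lemma idle_le: "idle n m \<le> n"
  by (induction n) (auto simp: idle_Suc, simp add: idle_def)

lemma card_busy: "card {s. s < n \<and> 0 < m s} = n - idle n m"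
proof -
  have "{s. s < n \<and> 0 < m s} = {..<n} - {s. s < n \<and> m s = 0}" by auto
  then show ?thesis by (simp add: idle_def card_Diff_subset subset_eq)
qed

lemma measurable_idle: "idle n \<in> len_space \<rightarrow>\<^sub>M count_space UNIV"
proof (induction n)
  case 0
  then show ?case by (simp add: idle_def[abs_def])
next
  case (Suc n)
  have [measurable]: "(\<lambda>m. m s) \<in> len_space \<rightarrow>\<^sub>M count_space UNIV" for s
    unfolding len_space_def by measurable
  have "(\<lambda>m. k + (if m n = 0 then 1 else 0 :: nat)) \<in> len_space \<rightarrow>\<^sub>M count_space UNIV" for k
    by measurable
  then show ?case unfolding idle_Suc[abs_def] by (rule measurable_compose_countable) (rule Suc)
qed

lemma measurable_lyap: "lyap n \<theta> e \<in> borel_measurable len_space"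
proof -
  have c [measurable]: "(\<lambda>m. m s) \<in> len_space \<rightarrow>\<^sub>M count_space UNIV" for s
    unfolding len_space_def by measurable
  have "(\<lambda>m. (\<Sum>i=1..idle n m. slope e i)) \<in> borel_measurable len_space"
    by (rule measurable_compose[OF measurable_idle]) simp
  moreover have "(\<lambda>m. real (excess n m)) \<in> borel_measurable len_space"
    unfolding excess_def of_nat_sum by measurable
  ultimately show ?thesis unfolding lyap_def[abs_def] by measurable
qed

lemma advance_le: "fst (advance m g x) \<le> m"
  by (induction m arbitrary: g x) (auto intro: le_SucI)

lemma advance_head: "0 < m \<Longrightarrow> x 0 \<le> g \<Longrightarrow> fst (advance m g x) \<le> m - 1"
  by (cases m) (auto intro: advance_le)

text \<open>The servers that complete their first job during the gap. Further completions at the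
  same server only decrease the Lyapunov function and may be ignored in an upper bound.\<close>

definition heads :: "nat \<Rightarrow> real \<Rightarrow> (nat \<Rightarrow> nat) \<Rightarrow> (nat \<Rightarrow> nat \<Rightarrow> real) \<Rightarrow> nat set" where
  "heads n g m r = {s. s < n \<and> 0 < m s \<and> r s 0 \<le> g}"

lemma idle_adv_len: "idle n m \<le> idle n (adv_len n g m r)"
  unfolding idle_def
proof (rule card_mono)
  show "{s. s < n \<and> m s = 0} \<subseteq> {s. s < n \<and> adv_len n g m r s = 0}"
    using advance_le[of "m s" g "r s" for s] by (auto simp: adv_len_def)
qed simp

text \<open>A completion at a queue of length 1 creates an idle server and gains one slope; at a
  longer queue it lowers the excess by 1, which is at least a slope. Slopes are collected from the
  present number of idle servers upwards.\<close>

lemma lyap_adv_len: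
  assumes e: "0 < e" and \<theta>: "0 \<le> \<theta>"
  shows "lyap n \<theta> e (adv_len n g m r) \<le> lyap n \<theta> e m - \<theta> * (\<Sum>i=1..card (heads n g m r). slope e (idle n m + i))"
proof -
  let ?m' = "adv_len n g m r"
  define D1 where "D1 = {s \<in> heads n g m r. m s = 1}"
  define D2 where "D2 = {s \<in> heads n g m r. m s \<noteq> 1}"
  have D: "heads n g m r = D1 \<union> D2" "D1 \<inter> D2 = {}" "finite D1" "finite D2" "D1 \<subseteq> {..<n}" "D2 \<subseteq> {..<n}"
    by (auto simp: D1_def D2_def heads_def)
  have card: "card (heads n g m r) = card D1 + card D2"
    using D by (simp add: card_Un_disjoint)
  have "excess n ?m' + card D2 \<le> excess n m"
  proof -
    have "card D2 = (\<Sum>s<n. if s \<in> D2 then 1 else 0)"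
      using D(6) by (simp add: sum.If_cases Int_absorb1)
    then have "excess n ?m' + card D2 = (\<Sum>s<n. (?m' s - 1) + (if s \<in> D2 then 1 else 0))"
      by (simp add: excess_def sum.distrib)
    also have "\<dots> \<le> (\<Sum>s<n. m s - 1)"
    proof (rule sum_mono)
      fix s assume "s \<in> {..<n}"
      then show "(?m' s - 1) + (if s \<in> D2 then 1 else 0) \<le> m s - 1"
        using advance_le[of "m s" g "r s"] advance_head[of "m s" "r s" g]
        by (auto simp: adv_len_def D2_def heads_def)
    qed
    finally show ?thesis by (simp add: excess_def)
  qed
  moreover have "idle n m + card D1 \<le> idle n ?m'"
  proof -
    have "idle n m + card D1 = card ({s. s < n \<and> m s = 0} \<union> D1)"
      unfolding idle_def using D by (subst card_Un_disjoint) (auto simp: D1_def)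
    also have "\<dots> \<le> idle n ?m'"
      unfolding idle_def
    proof (rule card_mono)
      show "{s. s < n \<and> m s = 0} \<union> D1 \<subseteq> {s. s < n \<and> ?m' s = 0}"
        using advance_le[of "m s" g "r s" for s] advance_head[of "m s" "r s" g for s]
        by (fastforce simp: adv_len_def D1_def heads_def)
    qed simp
    finally show ?thesis .
  qed
  then have "(\<Sum>i=1..idle n m + card D1. slope e i) \<le> (\<Sum>i=1..idle n ?m'. slope e i)"
    by (intro sum_mono2) (auto simp: slope_nonneg)
  moreover have split: "(\<Sum>i=1..a + b. f i) = (\<Sum>i=1..a. f i) + (\<Sum>i=1..b. f (a + i))" for a b :: nat and f :: "nat \<Rightarrow> real"
    by (induction b) auto
  note split[of "slope e" "idle n m" "card D1"]
  moreover have "(\<Sum>i=1..card D1 + card D2. slope e (idle n m + i)) \<le> (\<Sum>i=1..card D1. slope e (idle n m + i)) + real (card D2)"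
    unfolding split using sum_mono[of "{1..card D2}" "\<lambda>i. slope e (idle n m + (card D1 + i))" "\<lambda>_. 1"] slope_le_1 by simp
  ultimately have "real (excess n ?m') - (\<Sum>i=1..idle n ?m'. slope e i) \<le>
      (real (excess n m) - (\<Sum>i=1..idle n m. slope e i)) - (\<Sum>i=1..card (heads n g m r). slope e (idle n m + i))"
    unfolding card by linarith
  from mult_left_mono[OF this \<theta>] show ?thesis by (simp add: lyap_def algebra_simps)
qed

text \<open>With at most \<open>e\<close> idle servers the slope is 1, so joining a busy server
  raises the function as much as joining an idle one. Only beyond \<open>e\<close> is missing all
  idle servers a loss.\<close>

definition miss :: "nat \<Rightarrow> real \<Rightarrow> nat set \<Rightarrow> (nat \<Rightarrow> nat) \<Rightarrow> bool" where
  "miss n e D m \<longleftrightarrow> e < real (idle n m) \<and> (\<forall>s\<in>D. m s \<noteq> 0)"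

text \<open>Joining an idle server removes the last slope from the sum. Joining a busy one adds 1 to
  the excess and forces all sampled servers to be busy, so it is either a miss or happens where the
  slope is 1.\<close>

lemma lyap_arrive_len:
  assumes e: "0 < e" and \<theta>: "0 \<le> \<theta>" and D: "D \<in> samples n d" "d \<ge> 1"
  shows "lyap n \<theta> e (arrive_len D p m) \<le> lyap n \<theta> e m + \<theta> * (if miss n e D m then 1 else slope e (idle n m))"
proof -
  define s where "s = pick m D p"
  have s: "s < n" "s \<in> D" "\<And>r. r \<in> D \<Longrightarrow> m s \<le> m r"
    using pick_less[OF D] by (auto simp: s_def)
  have m': "arrive_len D p m = m(s := Suc (m s))" by (simp add: arrive_len_def s_def)
  have ex: "excess n (m(s := Suc (m s))) = excess n m + (if m s = 0 then 0 else 1)"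
  proof -
    have "excess n (m(s := Suc (m s))) = (\<Sum>r<n. (m r - 1) + (if r = s then (if m s = 0 then 0 else 1) else 0))"
      unfolding excess_def by (intro sum.cong) auto
    also have "\<dots> = excess n m + (if m s = 0 then 0 else 1)"
      using s(1) by (simp add: sum.distrib excess_def)
    finally show ?thesis .
  qed
  show ?thesis
  proof (cases "m s = 0")
    case True
    have "{r. r < n \<and> m r = 0} = insert s {r. r < n \<and> (m(s := Suc (m s))) r = 0}"
      using True s(1) by auto
    then have id: "idle n m = Suc (idle n (m(s := Suc (m s))))"
      by (simp add: idle_def)
    have "\<not> miss n e D m" using True s(2) by (auto simp: miss_def)
    then show ?thesis
      unfolding m' lyap_def ex id using True by (simp add: algebra_simps)
  next
    case False
    have "{r. r < n \<and> m r = 0} = {r. r < n \<and> (m(s := Suc (m s))) r = 0}"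
      using False by auto
    then have id: "idle n (m(s := Suc (m s))) = idle n m" by (simp add: idle_def)
    have "\<forall>r\<in>D. m r \<noteq> 0" using s(3) False by fastforce
    then have "(if miss n e D m then 1 else slope e (idle n m)) = 1"
      using slope_eq_1[OF e] by (auto simp: miss_def)
    then show ?thesis
      unfolding m' lyap_def ex id using False by (simp add: algebra_simps)
  qed
qed

text \<open>The ratio is the product of the quotients (b - i) / (n - i) over i < d, each at most b /
  n; the induction uses the cross-multiplied form.\<close>

lemma choose_ratio_le:
  assumes "b \<le> n" "d \<le> n" "1 \<le> n"
  shows "real (b choose d) / real (n choose d) \<le> (real b / real n) ^ d"
proof (cases "d \<le> b")
  case True
  have "real (b choose d) * real n ^ d \<le> real (n choose d) * real b ^ d"
    using \<open>d \<le> n\<close> True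
  proof (induction d)
    case (Suc d)
    have abs: "real (Suc d) * real (k choose Suc d) = (real k - real d) * real (k choose d)" if "Suc d \<le> k" for k
    proof -
      have "Suc d * (k choose Suc d) = (k - d) * (k choose d)"
        by (metis binomial_absorb_comp mult.commute binomial_absorption)
      then have "real (Suc d * (k choose Suc d)) = real ((k - d) * (k choose d))" by simp
      then show ?thesis using that by (simp add: of_nat_diff algebra_simps)
    qed
    have "real (Suc d) * (real (b choose Suc d) * real n ^ Suc d) = ((real b - real d) * real n) * (real (b choose d) * real n ^ d)"
      unfolding mult.assoc[symmetric] abs[OF Suc.prems(2)] by (simp add: ac_simps)
    also have "\<dots> \<le> ((real n - real d) * real b) * (real (n choose d) * real b ^ d)"
    proof (rule mult_mono)
      have "real d * real b \<le> real d * real n" using assms(1) by (intro mult_left_mono) auto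
      then show "(real b - real d) * real n \<le> (real n - real d) * real b" by (simp add: algebra_simps)
      show "real (b choose d) * real n ^ d \<le> real (n choose d) * real b ^ d" using Suc by simp
    qed (use Suc.prems in auto)
    also have "\<dots> = real (Suc d) * (real (n choose Suc d) * real b ^ Suc d)"
      unfolding mult.assoc[symmetric] abs[OF Suc.prems(1)] by (simp add: ac_simps)
    finally show ?case by (simp only: mult_le_cancel_left_pos of_nat_0_less_iff zero_less_Suc)
  qed simp
  moreover have "0 < real (n choose d)" using assms by (simp add: zero_less_binomial)
  ultimately show ?thesis
    using assms by (simp add: field_simps power_divide)
qed (simp add: binomial_eq_0)

context jsq_system
begin

text \<open>A miss confines the sample to the fewer than \<open>n - e\<close> busy servers. The
  bound is uniform in \<open>m\<close> and, for \<open>e\<close> proportional to \<open>n\<close>,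
  vanishes as \<open>d\<close> grows.\<close>

lemma prob_miss_le:
  assumes n: "n \<ge> 1" and d: "d \<in> {1..n}" and e: "0 \<le> e" "e \<le> real n"
  shows "(\<integral>\<^sup>+x. (if miss n e (sampled S k x) m then 1 else 0) \<partial>M) \<le> ennreal ((1 - e / real n) ^ d)"
proof (cases "e < real (idle n m)")
  case False
  then show ?thesis using e by (simp add: miss_def)
next
  case True
  define B where "B = {s. s < n \<and> 0 < m s}"
  let ?A = "{D \<in> samples n d. miss n e D m}"
  have "(\<integral>\<^sup>+x. (if miss n e (sampled S k x) m then 1 else 0) \<partial>M) =
      (\<integral>\<^sup>+D. (if miss n e D m then 1 else 0) \<partial>uniform_count_measure (samples n d))"
    unfolding sampled[of k, symmetric] by (rule nn_integral_distr[symmetric]) (use sampled_measurable in auto)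
  also have "\<dots> = emeasure (uniform_count_measure (samples n d)) ?A"
  proof -
    have "(\<integral>\<^sup>+D. (if miss n e D m then 1 else 0) \<partial>uniform_count_measure (samples n d)) =
        (\<integral>\<^sup>+D. indicator ?A D \<partial>uniform_count_measure (samples n d))"
      by (intro nn_integral_cong) (auto simp: space_uniform_count_measure)
    then show ?thesis by (simp add: sets_uniform_count_measure)
  qed
  also have "\<dots> = ennreal (real (card ?A) / real (card (samples n d)))"
    using finite_samples by (subst emeasure_uniform_count_measure) (auto simp: ennreal_of_nat_eq_real_of_nat)
  also have "?A = {D. D \<subseteq> B \<and> card D = d}"
    using True by (auto simp: miss_def samples_def B_def)
  also have "card {D. D \<subseteq> B \<and> card D = d} = (card B choose d)"
    by (rule n_subsets) (simp add: B_def)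
  also have "card B = n - idle n m" by (simp add: B_def card_busy)
  also have "card (samples n d) = (n choose d)"
    unfolding samples_def using n_subsets[of "{..<n}" d] by simp
  also have "real (n - idle n m choose d) / real (n choose d) \<le> (real (n - idle n m) / real n) ^ d"
    using d n by (intro choose_ratio_le) auto
  also have "\<dots> \<le> (1 - e / real n) ^ d"
    using True idle_le[of n m] n by (intro power_mono) (auto simp: of_nat_diff field_simps)
  finally show ?thesis by (simp add: ennreal_leI)
qed

end

subsection \<open>Departures between two arrivals\<close>

lemma measurable_res_entry: "(\<lambda>r. r s i) \<in> borel_measurable res_space"
proof -
  have "(\<lambda>r. r) \<in> res_space \<rightarrow>\<^sub>M res_space" by simp
  then have "(\<lambda>r. r s) \<in> res_space \<rightarrow>\<^sub>M PiM UNIV (\<lambda>_. borel)" unfolding measurable_res_space_iff by blast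
  then show ?thesis unfolding measurable_PiM_nat_iff by blast
qed

lemma nn_integral_famexp_head:
  assumes "\<phi> \<in> borel_measurable borel"
  shows "(\<integral>\<^sup>+r. \<phi> (r s 0) \<partial>famexp) = (\<integral>\<^sup>+w. \<phi> w \<partial>expo)"
proof -
  from nn_integral_famexp_entry[OF measurable_compose[OF measurable_res_entry assms], where s=s and i=0, of s 0]
  show ?thesis using prob_space.emeasure_space_1[OF prob_space_famexp] by simp
qed

lemma nn_integral_famexp_heads_prod:
  assumes \<phi>: "\<phi> \<in> borel_measurable borel" and B: "finite B"
  shows "(\<integral>\<^sup>+r. (\<Prod>s\<in>B. \<phi> (r s 0)) \<partial>famexp) = (\<integral>\<^sup>+w. \<phi> w \<partial>expo) ^ card B"
  using B
proof (induction B)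
  case empty
  then show ?case using prob_space.emeasure_space_1[OF prob_space_famexp] by simp
next
  case (insert s B)
  have m: "(\<lambda>r. \<Prod>s\<in>A. \<phi> (r s 0)) \<in> borel_measurable res_space" for A
    using measurable_compose[OF measurable_res_entry \<phi>] by measurable
  have "(\<integral>\<^sup>+r. (\<Prod>s\<in>insert s B. \<phi> (r s 0)) \<partial>famexp) =
      (\<integral>\<^sup>+r. \<integral>\<^sup>+w. (\<Prod>s'\<in>insert s B. \<phi> ((r(s := (r s)(0 := w))) s' 0)) \<partial>expo \<partial>famexp)"
    by (rule nn_integral_famexp_entry[OF m])
  also have "\<dots> = (\<integral>\<^sup>+r. \<integral>\<^sup>+w. \<phi> w * (\<Prod>s'\<in>B. \<phi> (r s' 0)) \<partial>expo \<partial>famexp)"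
  proof (intro nn_integral_cong)
    fix r :: "nat \<Rightarrow> nat \<Rightarrow> real" and w
    have "(\<Prod>s'\<in>B. \<phi> ((r(s := (r s)(0 := w))) s' 0)) = (\<Prod>s'\<in>B. \<phi> (r s' 0))"
      using insert.hyps by (intro prod.cong) auto
    then show "(\<Prod>s'\<in>insert s B. \<phi> ((r(s := (r s)(0 := w))) s' 0)) = \<phi> w * (\<Prod>s'\<in>B. \<phi> (r s' 0))"
      using insert.hyps by simp
  qed
  also have "\<dots> = (\<integral>\<^sup>+r. (\<integral>\<^sup>+w. \<phi> w \<partial>expo) * (\<Prod>s'\<in>B. \<phi> (r s' 0)) \<partial>famexp)"
    using \<phi> by (intro nn_integral_cong nn_integral_multc) simp
  also have "\<dots> = (\<integral>\<^sup>+w. \<phi> w \<partial>expo) * (\<integral>\<^sup>+r. (\<Prod>s'\<in>B. \<phi> (r s' 0)) \<partial>famexp)"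
    by (rule nn_integral_cmult) (use m in \<open>simp add: sets_famexp_res cong: measurable_cong_sets\<close>)
  finally show ?case using insert by simp
qed

lemma emeasure_expo_le:
  assumes "0 \<le> g"
  shows "(\<integral>\<^sup>+w. (if w \<le> g then ennreal a else ennreal b) \<partial>expo) = ennreal a * ennreal (1 - exp (- g)) + ennreal b * ennreal (exp (- g))"
proof -
  interpret prob_space expo by (rule prob_space_expo)
  have gt: "(\<integral>\<^sup>+w. (if g < w then c else 0) \<partial>expo) = c * ennreal (exp (- g))" for c :: ennreal
    using nn_integral_expo_shift[OF assms, of "\<lambda>_. c"] emeasure_space_1 by (simp add: mult.commute)
  have "(\<integral>\<^sup>+w. (if w \<le> g then 1 else 0) \<partial>expo) + (\<integral>\<^sup>+w. (if g < w then 1 else 0) \<partial>expo) = (\<integral>\<^sup>+w. (1::ennreal) \<partial>expo)"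
  proof (subst nn_integral_add[symmetric])
    show "(\<integral>\<^sup>+w. (if w \<le> g then 1 else 0) + (if g < w then 1 else 0) \<partial>expo) = (\<integral>\<^sup>+w. (1::ennreal) \<partial>expo)"
      by (rule nn_integral_cong) auto
  qed auto
  then have "(\<integral>\<^sup>+w. (if w \<le> g then 1 else 0) \<partial>expo) + ennreal (exp (- g)) = 1"
    using gt[of 1] emeasure_space_1 by simp
  then have le: "(\<integral>\<^sup>+w. (if w \<le> g then 1 else 0) \<partial>expo) = ennreal (1 - exp (- g))"
    using assms by (metis add_diff_eq_ennreal diff_add_cancel_ennreal ennreal_1 ennreal_minus exp_ge_zero ennreal_add_diff_cancel_right ennreal_less_top less_top)
  have "(\<integral>\<^sup>+w. (if w \<le> g then ennreal a else ennreal b) \<partial>expo) =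
      (\<integral>\<^sup>+w. ennreal a * (if w \<le> g then 1 else 0) + (if g < w then ennreal b else 0) \<partial>expo)"
    by (intro nn_integral_cong) auto
  also have "\<dots> = ennreal a * ennreal (1 - exp (- g)) + ennreal b * ennreal (exp (- g))"
    by (subst nn_integral_add) (auto simp: nn_integral_cmult le gt)
  finally show ?thesis .
qed

text \<open>The number of heads is binomial, with one trial per busy server and success probability
  \<open>1 - exp (- g)\<close>. Up to \<open>K\<close> heads every slope is at least
  \<open>p\<close>, and the binomial generating function gives the exponential. More than
  \<open>K\<close> heads are handled by Markov, giving the second term. At least
  \<open>n - 2 * e\<close> servers are busy unless the slope, and with it \<open>p\<close>, is
  0.\<close>

lemma nn_integral_heads_le:
  assumes e: "0 < e" and \<theta>: "0 \<le> \<theta>" and g: "0 \<le> g" and K: "0 < K" and n: "1 \<le> n"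
    and p: "p = max 0 (slope e (idle n m) - real K / e)"
  shows "(\<integral>\<^sup>+r. ennreal (exp (- (\<theta> * (\<Sum>i=1..card (heads n g m r). slope e (idle n m + i))))) \<partial>famexp) \<le>
    ennreal (exp (- ((real n - 2 * e) * (1 - exp (- (\<theta> * p))) * (1 - exp (- g)))) + real n * (1 - exp (- g)) / real K)"
proof -
  define B where "B = {s. s < n \<and> 0 < m s}"
  have B: "finite B" "card B \<le> n" "card B = n - idle n m"
    by (simp_all add: B_def card_busy)
  define u where "u = 1 - exp (- g)"
  have u: "0 \<le> u" "u \<le> 1" using g by (auto simp: u_def)
  define v where "v = 1 - exp (- (\<theta> * p))"
  have v: "0 \<le> v" "v \<le> 1" using \<theta> by (auto simp: v_def p)
  have heads: "heads n g m r = {s \<in> B. r s 0 \<le> g}" for r by (auto simp: heads_def B_def)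
  have pw: "exp (- (\<theta> * (\<Sum>i=1..D. slope e (idle n m + i)))) \<le> exp (- (\<theta> * p)) ^ D + real D / real K" for D
  proof (cases "D \<le> K")
    case True
    have "p \<le> slope e (idle n m + i)" if "i \<in> {1..D}" for i
    proof -
      have "slope e (idle n m) - real K / e \<le> slope e (idle n m) - real i / e"
        using that True e by (simp add: divide_right_mono)
      also have "\<dots> \<le> slope e (idle n m + i)" by (rule slope_add[OF e])
      finally show ?thesis using slope_nonneg[of e "idle n m + i"] by (simp add: p)
    qed
    then have "real D * p \<le> (\<Sum>i=1..D. slope e (idle n m + i))"
      using sum_mono[of "{1..D}" "\<lambda>_. p" "\<lambda>i. slope e (idle n m + i)"] by simp
    then have "real D * (\<theta> * p) \<le> \<theta> * (\<Sum>i=1..D. slope e (idle n m + i))"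
      using \<theta> mult_left_mono[of _ _ \<theta>] by (metis mult.left_commute)
    then have "exp (- (\<theta> * (\<Sum>i=1..D. slope e (idle n m + i)))) \<le> exp (- (\<theta> * p)) ^ D"
      by (simp add: exp_of_nat_mult[symmetric])
    then show ?thesis using K by (simp add: add_increasing2)
  next
    case False
    have "0 \<le> (\<Sum>i=1..D. slope e (idle n m + i))" by (intro sum_nonneg slope_nonneg)
    then have "exp (- (\<theta> * (\<Sum>i=1..D. slope e (idle n m + i)))) \<le> 1" using \<theta> by simp
    also have "1 \<le> real D / real K" using False K by simp
    finally show ?thesis by (simp add: add_increasing)
  qed
  have hs: "(\<lambda>r. r s 0) \<in> borel_measurable famexp" for s
    using measurable_res_entry[of s 0] by (simp add: sets_famexp_res cong: measurable_cong_sets)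
  note [measurable] = hs
  have ecard: "exp (- (\<theta> * p)) ^ card (heads n g m r) = (\<Prod>s\<in>B. if r s 0 \<le> g then exp (- (\<theta> * p)) else 1)" for r
    unfolding heads using B(1) by (simp add: prod.If_cases Int_def)
  have rcard: "real (card (heads n g m r)) / real K = (\<Sum>s\<in>B. if r s 0 \<le> g then 1 / real K else 0)" for r
    unfolding heads using B(1) by (simp add: sum.If_cases Int_def)
  have "(\<integral>\<^sup>+r. ennreal (exp (- (\<theta> * (\<Sum>i=1..card (heads n g m r). slope e (idle n m + i))))) \<partial>famexp) \<le>
      (\<integral>\<^sup>+r. (\<Prod>s\<in>B. (if r s 0 \<le> g then ennreal (exp (- (\<theta> * p))) else ennreal 1)) + (\<Sum>s\<in>B. (if r s 0 \<le> g then ennreal (1 / real K) else ennreal 0)) \<partial>famexp)"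
  proof (rule nn_integral_mono)
    fix r
    have "ennreal (exp (- (\<theta> * (\<Sum>i=1..card (heads n g m r). slope e (idle n m + i))))) \<le>
        ennreal (exp (- (\<theta> * p)) ^ card (heads n g m r) + real (card (heads n g m r)) / real K)"
      by (intro ennreal_leI pw)
    also have "\<dots> = ennreal (exp (- (\<theta> * p)) ^ card (heads n g m r)) + ennreal (real (card (heads n g m r)) / real K)"
      by (rule ennreal_plus) auto
    also have "\<dots> = (\<Prod>s\<in>B. ennreal (if r s 0 \<le> g then exp (- (\<theta> * p)) else 1)) + (\<Sum>s\<in>B. ennreal (if r s 0 \<le> g then 1 / real K else 0))"
      unfolding ecard rcard by (subst prod_ennreal, simp, subst sum_ennreal) auto
    also have "\<dots> = (\<Prod>s\<in>B. (if r s 0 \<le> g then ennreal (exp (- (\<theta> * p))) else ennreal 1)) + (\<Sum>s\<in>B. (if r s 0 \<le> g then ennreal (1 / real K) else ennreal 0))"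
      by (intro arg_cong2[where f="(+)"] prod.cong sum.cong) auto
    finally show "ennreal (exp (- (\<theta> * (\<Sum>i=1..card (heads n g m r). slope e (idle n m + i))))) \<le> \<dots>" .
  qed
  also have "\<dots> = (\<integral>\<^sup>+r. (\<Prod>s\<in>B. (if r s 0 \<le> g then ennreal (exp (- (\<theta> * p))) else ennreal 1)) \<partial>famexp) +
      (\<Sum>s\<in>B. (\<integral>\<^sup>+r. (if r s 0 \<le> g then ennreal (1 / real K) else ennreal 0) \<partial>famexp))"
    by (subst nn_integral_add) (measurable, simp add: nn_integral_sum)
  also have "(\<integral>\<^sup>+r. (\<Prod>s\<in>B. (if r s 0 \<le> g then ennreal (exp (- (\<theta> * p))) else ennreal 1)) \<partial>famexp) = ennreal (1 - v * u) ^ card B"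
  proof -
    have "(\<integral>\<^sup>+r. (\<Prod>s\<in>B. (if r s 0 \<le> g then ennreal (exp (- (\<theta> * p))) else ennreal 1)) \<partial>famexp) =
        (\<integral>\<^sup>+w. (if w \<le> g then ennreal (exp (- (\<theta> * p))) else ennreal 1) \<partial>expo) ^ card B"
      by (rule nn_integral_famexp_heads_prod[OF _ B(1)]) simp
    also have "(\<integral>\<^sup>+w. (if w \<le> g then ennreal (exp (- (\<theta> * p))) else ennreal 1) \<partial>expo) = ennreal (1 - v * u)"
      unfolding emeasure_expo_le[OF g] using g
      by (simp add: u_def v_def ennreal_mult[symmetric] ennreal_plus[symmetric] algebra_simps del: ennreal_plus)
    finally show ?thesis .
  qed
  also have "(\<Sum>s\<in>B. (\<integral>\<^sup>+r. (if r s 0 \<le> g then ennreal (1 / real K) else ennreal 0) \<partial>famexp)) = ennreal (real (card B) * u / real K)"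
  proof -
    have "(\<integral>\<^sup>+r. (if r s 0 \<le> g then ennreal (1 / real K) else ennreal 0) \<partial>famexp) = ennreal (u / real K)" for s
      using nn_integral_famexp_head[of "\<lambda>w. if w \<le> g then ennreal (1 / real K) else ennreal 0" s] emeasure_expo_le[OF g, of "1 / real K" 0] u
      by (simp add: u_def ennreal_mult[symmetric])
    then show ?thesis using u by (simp add: ennreal_of_nat_eq_real_of_nat ennreal_mult[symmetric])
  qed
  also have "ennreal (1 - v * u) ^ card B + ennreal (real (card B) * u / real K) \<le>
     ennreal (exp (- ((real n - 2 * e) * v * u)) + real n * u / real K)"
  proof -
    have vu: "0 \<le> 1 - v * u" using u v by (simp add: mult_le_one)
    have "(1 - v * u) ^ card B \<le> exp (- (v * u)) ^ card B"
      using vu exp_ge_add_one_self[of "- (v * u)"] by (intro power_mono) auto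
    also have "\<dots> = exp (- (real (card B) * (v * u)))" by (simp add: exp_of_nat_mult[symmetric])
    also have "\<dots> \<le> exp (- ((real n - 2 * e) * v * u))"
    proof (cases "real (idle n m) < 2 * e")
      case True
      then have "real n - 2 * e \<le> real (card B)" using B(3) idle_le[of n m] by (simp add: of_nat_diff)
      then have "(real n - 2 * e) * (v * u) \<le> real (card B) * (v * u)" using u v by (intro mult_right_mono) auto
      then show ?thesis by (simp add: mult.assoc)
    next
      case False
      then have "slope e (idle n m) = 0" using e by (intro slope_eq_0) auto
      then have "p = 0" using e by (simp add: p)
      then have "v = 0" by (simp add: v_def)
      then show ?thesis by simp
    qed
    finally have "(1 - v * u) ^ card B \<le> exp (- ((real n - 2 * e) * v * u))" .
    moreover have "real (card B) * u / real K \<le> real n * u / real K"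
      using B(2) u K by (intro divide_right_mono mult_right_mono) auto
    ultimately show ?thesis
      using vu u by (simp add: ennreal_power ennreal_plus[symmetric] ennreal_leI add_mono del: ennreal_plus)
  qed
  finally show ?thesis by (simp add: u_def v_def)
qed

subsection \<open>The decay of the Lyapunov function\<close>

lemma measurable_miss:
  assumes m: "m \<in> N \<rightarrow>\<^sub>M len_space" and D: "D \<in> N \<rightarrow>\<^sub>M count_space (samples n d)"
  shows "Measurable.pred N (\<lambda>z. miss n e (D z) (m z))"
proof (rule measurable_compose_countable'[OF _ D countable_finite[OF finite_samples]])
  fix D' assume "D' \<in> samples n d"
  then have fin: "finite D'" by (auto dest: samplesD)
  have [measurable]: "(\<lambda>z. m z s) \<in> N \<rightarrow>\<^sub>M count_space UNIV" for s
    using m unfolding measurable_len_space_iff by blast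
  have [measurable]: "(\<lambda>z. idle n (m z)) \<in> N \<rightarrow>\<^sub>M count_space UNIV"
    by (rule measurable_compose[OF m measurable_idle])
  show "Measurable.pred N (\<lambda>z. miss n e D' (m z))"
    unfolding miss_def using fin by measurable
qed

lemma heads_Suc: "heads (Suc n) g m r = (if 0 < m n \<and> r n 0 \<le> g then insert n (heads n g m r) else heads n g m r)"
  by (auto simp: heads_def less_Suc_eq)

lemma measurable_card_heads:
  assumes g: "g \<in> borel_measurable N" and r: "r \<in> N \<rightarrow>\<^sub>M res_space"
  shows "(\<lambda>z. card (heads n (g z) m (r z))) \<in> N \<rightarrow>\<^sub>M count_space UNIV"
proof (induction n)
  case 0
  then show ?case by (simp add: heads_def)
next
  case (Suc n)
  have [measurable]: "(\<lambda>z. r z n 0) \<in> borel_measurable N" by (rule measurable_compose[OF r measurable_res_entry])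
  note [measurable] = g
  have c: "card (heads (Suc n) g m r) = card (heads n g m r) + (if 0 < m n \<and> r n 0 \<le> g then 1 else 0)" for g r
    unfolding heads_Suc by (simp add: heads_def)
  have "(\<lambda>z. k + (if 0 < m n \<and> r z n 0 \<le> g z then 1 else 0 :: nat)) \<in> N \<rightarrow>\<^sub>M count_space UNIV" for k
    by measurable
  then have "(\<lambda>z. card (heads n (g z) m (r z)) + (if 0 < m n \<and> r z n 0 \<le> g z then 1 else 0 :: nat)) \<in> N \<rightarrow>\<^sub>M count_space UNIV"
    by (rule measurable_compose_countable) (rule Suc)
  then show ?case unfolding c .
qed

definition head_factor :: "nat \<Rightarrow> real \<Rightarrow> real \<Rightarrow> (nat \<Rightarrow> nat) \<Rightarrow> real \<Rightarrow> (nat \<Rightarrow> nat \<Rightarrow> real) \<Rightarrow> ennreal" where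
  "head_factor n \<theta> e m g r = ennreal (exp (- (\<theta> * (\<Sum>i=1..card (heads n g m r). slope e (idle n m + i)))))"

lemma measurable_head_factor:
  assumes "g \<in> borel_measurable N" "r \<in> N \<rightarrow>\<^sub>M res_space"
  shows "(\<lambda>z. head_factor n \<theta> e m (g z) (r z)) \<in> borel_measurable N"
  unfolding head_factor_def by (rule measurable_compose[OF measurable_card_heads[OF assms]]) simp

section \<open>Mean decay over one gap and one arrival\<close>

context jsq_system
begin

lemma nn_integral_gap_exp:
  assumes L: "n \<ge> 1" "l > 0" and a: "0 \<le> a"
  shows "(\<integral>\<^sup>+x. ennreal (exp (- (a * arr_gap S k x))) \<partial>M) = ennreal (real n * l / (real n * l + a))"
proof -
  define L where "L = real n * l"
  have "L > 0" using assms by (simp add: L_def)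
  have "(\<integral>\<^sup>+x. ennreal (exp (- (a * arr_gap S k x))) \<partial>M) =
      (\<integral>\<^sup>+g. ennreal (exponential_density L g) * ennreal (exp (- (a * g))) \<partial>lborel)"
    unfolding L_def by (rule distributed_nn_integral[OF arr_gap, symmetric]) simp
  also have "\<dots> = (\<integral>\<^sup>+g. ennreal (L / (L + a)) * ennreal (exponential_density (L + a) g) \<partial>lborel)"
  proof (rule nn_integral_cong)
    fix g
    have "L * exp (- g * L) * exp (- (a * g)) = L / (L + a) * ((L + a) * exp (- g * (L + a)))"
    proof -
      have "exp (- g * (L + a)) = exp (- g * L) * exp (- (a * g))"
        by (simp add: exp_add[symmetric] algebra_simps)
      then show ?thesis using \<open>L > 0\<close> a by simp
    qed
    then show "ennreal (exponential_density L g) * ennreal (exp (- (a * g))) = ennreal (L / (L + a)) * ennreal (exponential_density (L + a) g)"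
      using \<open>L > 0\<close> a by (simp add: exponential_density_def ennreal_mult[symmetric])
  qed
  also have "\<dots> = ennreal (L / (L + a)) * (\<integral>\<^sup>+g. ennreal (exponential_density (L + a) g) \<partial>lborel)"
    by (rule nn_integral_cmult) (auto simp: exponential_density_def)
  also have "(\<integral>\<^sup>+g. ennreal (exponential_density (L + a) g) \<partial>lborel) = 1"
    using prob_space.emeasure_space_1[OF prob_space_exponential_density[of "L + a"]] \<open>L > 0\<close> a
    by (simp add: emeasure_density exponential_density_def)
  finally show ?thesis by (simp add: L_def)
qed

text \<open>Departures contribute \<open>head_factor\<close>; the arrival contributes at most the
  factor for the present slope plus \<open>exp \<theta>\<close> on a miss. The sample is independent
  of gap and residuals, so it can be averaged with the lengths frozen at the arrival.\<close>

lemma lyap_one_step: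
  assumes n: "n \<ge> 1" and d: "d \<in> {1..n}" and l: "l > 0" and e: "0 < e" "e \<le> real n" and \<theta>: "0 \<le> \<theta>"
  shows "(\<integral>\<^sup>+x. step_weight c k x * (\<integral>\<^sup>+r. ennreal (exp (lyap n \<theta> e (next_len k x m r))) \<partial>famexp) \<partial>M) \<le>
    ennreal (exp (lyap n \<theta> e m)) * ennreal (exp (\<theta> * slope e (idle n m)) + exp \<theta> * (1 - e / real n) ^ d) *
    (\<integral>\<^sup>+x. step_weight c k x * (\<integral>\<^sup>+r. head_factor n \<theta> e m (arr_gap S k x) r \<partial>famexp) \<partial>M)"
proof -
  interpret fam: prob_space famexp by (rule prob_space_famexp)
  interpret Mf: pair_sigma_finite M famexp ..
  note idf = measurable_ident_famexp
  define a where "a = ennreal (exp (\<theta> * slope e (idle n m)))"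
  define b where "b = ennreal (exp \<theta>)"
  define \<eta> where "\<eta> = ennreal ((1 - e / real n) ^ d)"
  define E where "E = ennreal (exp (lyap n \<theta> e m))"
  let ?g = "arr_gap S k"
  define F where "F x r = step_weight c k x * head_factor n \<theta> e m (?g x) r" for x r
  define ms where "ms x x' r = (if miss n e (sampled S k x') (adv_len n (?g x) m r) then 1 else 0 :: ennreal)" for x x' r
  have gM: "?g \<in> borel_measurable M" and DM: "sampled S k \<in> M \<rightarrow>\<^sub>M count_space (samples n d)"
    using stage_inputs_M[of k] by (auto simp: stage_inputs_def)
  have gG: "?g \<in> borel_measurable (src_algebra {Gap k})" and DG: "sampled S k \<in> src_algebra {Sample k} \<rightarrow>\<^sub>M count_space (samples n d)"
    by (rule measurable_src; simp)+
  have pw: "ennreal (exp (lyap n \<theta> e (next_len k x m r))) \<le> E * head_factor n \<theta> e m (?g x) r * (a + b * ms x x r)"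
    if x: "x \<in> space M" for x r
  proof -
    define m' where "m' = adv_len n (?g x) m r"
    have D: "sampled S k x \<in> samples n d" using measurable_space[OF DM x] by simp
    let ?ms = "miss n e (sampled S k x) m'"
    have "lyap n \<theta> e (next_len k x m r) \<le> lyap n \<theta> e m' + \<theta> * (if ?ms then 1 else slope e (idle n m'))"
      unfolding next_len_def m'_def[symmetric] using d by (intro lyap_arrive_len[OF e(1) \<theta> D]) simp
    \<comment> \<open>Departures only increase the number of idle servers, so the slope before the
      gap dominates the one after it.\<close>
    also have "\<dots> \<le> lyap n \<theta> e m' + \<theta> * (if ?ms then 1 else slope e (idle n m))"
      using slope_antimono[OF e(1) idle_adv_len[of n m "?g x" r]] \<theta> by (auto simp: m'_def intro: mult_left_mono)
    also have "lyap n \<theta> e m' \<le> lyap n \<theta> e m - \<theta> * (\<Sum>i=1..card (heads n (?g x) m r). slope e (idle n m + i))"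
      unfolding m'_def by (rule lyap_adv_len[OF e(1) \<theta>])
    finally have "exp (lyap n \<theta> e (next_len k x m r)) \<le>
        exp ((lyap n \<theta> e m + - (\<theta> * (\<Sum>i=1..card (heads n (?g x) m r). slope e (idle n m + i)))) + \<theta> * (if ?ms then 1 else slope e (idle n m)))"
      by simp
    also have "\<dots> \<le> exp (lyap n \<theta> e m) * exp (- (\<theta> * (\<Sum>i=1..card (heads n (?g x) m r). slope e (idle n m + i)))) *
        (exp (\<theta> * slope e (idle n m)) + exp \<theta> * (if ?ms then 1 else 0))"
      unfolding exp_add by (intro mult_left_mono) auto
    finally have "ennreal (exp (lyap n \<theta> e (next_len k x m r))) \<le> ennreal \<dots>" by (rule ennreal_leI)
    also have "\<dots> = E * head_factor n \<theta> e m (?g x) r * (a + b * ms x x r)"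
      unfolding E_def head_factor_def a_def b_def ms_def m'_def[symmetric]
      by (simp add: ennreal_mult ennreal_plus)
    finally show ?thesis .
  qed
  have Fm: "(\<lambda>z. F (x z) (r z)) \<in> borel_measurable N"
    if "x \<in> N \<rightarrow>\<^sub>M M" "r \<in> N \<rightarrow>\<^sub>M res_space" for x r and N :: "('w \<times> (nat \<Rightarrow> nat \<Rightarrow> real)) measure"
    unfolding F_def
    by (intro borel_measurable_times_ennreal measurable_step_weight[OF stage_inputs_M that(1)]
        measurable_head_factor measurable_compose[OF that(1) gM] that(2))
  have msm: "(\<lambda>p. ms (fst p) (fst p) (snd p)) \<in> borel_measurable (M \<Otimes>\<^sub>M famexp)"
  proof -
    have "(\<lambda>p. adv_len n (?g (fst p)) m (snd p)) \<in> M \<Otimes>\<^sub>M famexp \<rightarrow>\<^sub>M len_space"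
      by (rule measurable_adv_len[OF measurable_compose[OF measurable_fst gM] _ measurable_compose[OF measurable_snd idf]]) simp
    from measurable_miss[OF this measurable_compose[OF measurable_fst DM]]
    show ?thesis unfolding ms_def by measurable
  qed
  have Fm1: "(\<lambda>p. F (fst p) (snd p)) \<in> borel_measurable (M \<Otimes>\<^sub>M famexp)"
    by (rule Fm[OF measurable_fst measurable_compose[OF measurable_snd idf]])
  have Fx: "F x \<in> borel_measurable famexp" if "x \<in> space M" for x
    using measurable_compose[OF measurable_Pair1'[OF that] Fm1] by simp
  have msx: "(\<lambda>r. ms x x r) \<in> borel_measurable famexp" if "x \<in> space M" for x
    using measurable_compose[OF measurable_Pair1'[OF that] msm] by simp
  have "(\<integral>\<^sup>+x. step_weight c k x * (\<integral>\<^sup>+r. ennreal (exp (lyap n \<theta> e (next_len k x m r))) \<partial>famexp) \<partial>M) \<le>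
      (\<integral>\<^sup>+x. \<integral>\<^sup>+r. E * (F x r * (a + b * ms x x r)) \<partial>famexp \<partial>M)"
  proof (rule nn_integral_mono)
    fix x assume x: "x \<in> space M"
    have "step_weight c k x * (\<integral>\<^sup>+r. ennreal (exp (lyap n \<theta> e (next_len k x m r))) \<partial>famexp) \<le>
        step_weight c k x * (\<integral>\<^sup>+r. E * head_factor n \<theta> e m (?g x) r * (a + b * ms x x r) \<partial>famexp)"
      by (intro mult_left_mono nn_integral_mono pw x) simp
    also have "\<dots> = (\<integral>\<^sup>+r. step_weight c k x * (E * head_factor n \<theta> e m (?g x) r * (a + b * ms x x r)) \<partial>famexp)"
    proof (rule nn_integral_cmult[symmetric])
      have "(\<lambda>r. head_factor n \<theta> e m (?g x) r) \<in> borel_measurable famexp"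
        by (rule measurable_head_factor[OF _ idf]) simp
      then show "(\<lambda>r. E * head_factor n \<theta> e m (?g x) r * (a + b * ms x x r)) \<in> borel_measurable famexp"
        using msx[OF x] by measurable
    qed
    finally show "step_weight c k x * (\<integral>\<^sup>+r. ennreal (exp (lyap n \<theta> e (next_len k x m r))) \<partial>famexp) \<le>
        (\<integral>\<^sup>+r. E * (F x r * (a + b * ms x x r)) \<partial>famexp)"
      by (simp add: F_def ac_simps)
  qed
  also have "\<dots> = (\<integral>\<^sup>+r. \<integral>\<^sup>+x. E * (F x r * (a + b * ms x x r)) \<partial>M \<partial>famexp)"
    by (rule Mf.Fubini'[symmetric]) (use Fm1 msm in \<open>simp add: split_beta'\<close>)
  also have "\<dots> \<le> (\<integral>\<^sup>+r. \<integral>\<^sup>+x. E * (F x r * (a + b * \<eta>)) \<partial>M \<partial>famexp)"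
  proof (rule nn_integral_mono)
    fix r :: "nat \<Rightarrow> nat \<Rightarrow> real"
    have FG: "(\<lambda>x. F x r) \<in> borel_measurable (src_algebra {Gap k})"
    proof -
      have "step_weight c k \<in> borel_measurable (src_algebra {Gap k})"
        unfolding step_weight_def[abs_def] using gG by measurable
      then show ?thesis
        unfolding F_def by (intro borel_measurable_times_ennreal measurable_head_factor gG) simp_all
    qed
    \<comment> \<open>Freeze the gap, which together with \<open>r\<close> fixes the lengths met by
      the job, and average over its sample.\<close>
    have "(\<integral>\<^sup>+x. E * (F x r * (a + b * ms x x r)) \<partial>M) = (\<integral>\<^sup>+x. \<integral>\<^sup>+x'. E * (F x r * (a + b * ms x x' r)) \<partial>M \<partial>M)"
    proof (rule nn_integral_src_decouple[of "{Gap k}" "{Sample k}"])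
      have "(\<lambda>p. adv_len n (?g (fst p)) m r) \<in> src_algebra {Gap k} \<Otimes>\<^sub>M src_algebra {Sample k} \<rightarrow>\<^sub>M len_space"
        by (rule measurable_adv_len[OF measurable_compose[OF measurable_fst gG]]) simp_all
      from measurable_miss[OF this measurable_compose[OF measurable_snd DG]]
      have "(\<lambda>p. ms (fst p) (snd p) r) \<in> borel_measurable (src_algebra {Gap k} \<Otimes>\<^sub>M src_algebra {Sample k})"
        unfolding ms_def by measurable
      then show "(\<lambda>(x, x'). E * (F x r * (a + b * ms x x' r))) \<in> borel_measurable (src_algebra {Gap k} \<Otimes>\<^sub>M src_algebra {Sample k})"
        using measurable_compose[OF measurable_fst FG] unfolding split_beta' by measurable
    qed (auto simp: sources_def)
    also have "\<dots> \<le> (\<integral>\<^sup>+x. E * (F x r * (a + b * \<eta>)) \<partial>M)"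
    proof (rule nn_integral_mono)
      fix x assume x: "x \<in> space M"
      have "Measurable.pred M (\<lambda>x'. miss n e (sampled S k x') (adv_len n (?g x) m r))"
        by (rule measurable_miss[OF _ DM]) simp
      then have mm: "(\<lambda>x'. ms x x' r) \<in> borel_measurable M" unfolding ms_def by measurable
      have "(\<integral>\<^sup>+x'. E * (F x r * (a + b * ms x x' r)) \<partial>M) = E * (F x r * (\<integral>\<^sup>+x'. a + b * ms x x' r \<partial>M))"
        using mm by (simp add: nn_integral_cmult)
      also have "(\<integral>\<^sup>+x'. a + b * ms x x' r \<partial>M) = a + b * (\<integral>\<^sup>+x'. ms x x' r \<partial>M)"
        using mm emeasure_space_1 by (simp add: nn_integral_add nn_integral_cmult)
      also have "\<dots> \<le> a + b * \<eta>"
        unfolding ms_def \<eta>_def using e by (intro add_left_mono mult_left_mono prob_miss_le[OF n d]) auto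
      finally show "(\<integral>\<^sup>+x'. E * (F x r * (a + b * ms x x' r)) \<partial>M) \<le> E * (F x r * (a + b * \<eta>))"
        by (simp add: mult_left_mono)
    qed
    finally show "(\<integral>\<^sup>+x. E * (F x r * (a + b * ms x x r)) \<partial>M) \<le> (\<integral>\<^sup>+x. E * (F x r * (a + b * \<eta>)) \<partial>M)" .
  qed
  also have "\<dots> = (\<integral>\<^sup>+x. \<integral>\<^sup>+r. E * (F x r * (a + b * \<eta>)) \<partial>famexp \<partial>M)"
    by (rule Mf.Fubini') (use Fm1 in \<open>simp add: split_beta'\<close>)
  also have "\<dots> = (\<integral>\<^sup>+x. (E * (a + b * \<eta>)) * (\<integral>\<^sup>+r. F x r \<partial>famexp) \<partial>M)"
  proof (rule nn_integral_cong)
    fix x assume x: "x \<in> space M"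
    have "E * (F x r * (a + b * \<eta>)) = (E * (a + b * \<eta>)) * F x r" for r
      by (simp only: ac_simps)
    then show "(\<integral>\<^sup>+r. E * (F x r * (a + b * \<eta>)) \<partial>famexp) = (E * (a + b * \<eta>)) * (\<integral>\<^sup>+r. F x r \<partial>famexp)"
      by (simp only: nn_integral_cmult[OF Fx[OF x]])
  qed
  also have "\<dots> = (E * (a + b * \<eta>)) * (\<integral>\<^sup>+x. \<integral>\<^sup>+r. F x r \<partial>famexp \<partial>M)"
    by (rule nn_integral_cmult, rule fam.borel_measurable_nn_integral) (use Fm1 in \<open>simp add: split_beta'\<close>)
  also have "(\<integral>\<^sup>+x. \<integral>\<^sup>+r. F x r \<partial>famexp \<partial>M) = (\<integral>\<^sup>+x. step_weight c k x * (\<integral>\<^sup>+r. head_factor n \<theta> e m (?g x) r \<partial>famexp) \<partial>M)"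
    unfolding F_def
    by (intro nn_integral_cong nn_integral_cmult measurable_head_factor[OF _ idf]) simp
  also have "a + b * \<eta> = ennreal (exp (\<theta> * slope e (idle n m)) + exp \<theta> * (1 - e / real n) ^ d)"
    using e n unfolding a_def b_def \<eta>_def by (simp add: ennreal_mult ennreal_plus)
  finally show ?thesis unfolding E_def .
qed

text \<open>First the Laplace transform of a gap, divided through by \<open>n\<close>, at the joint
  rate of discount and departures; then the probability of a gap longer than \<gamma>; last, a bound
  for the expected number of departures in a gap divided by \<open>K\<close>.\<close>

definition gap_factor :: "real \<Rightarrow> real \<Rightarrow> nat \<Rightarrow> real \<Rightarrow> real" where
  "gap_factor c' \<gamma> K v = l / (l + c' + (1 - \<gamma>) * v) + exp (- (real n * l * \<gamma>)) + 1 / (l * real K)"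

text \<open>For gaps up to \<gamma> the success probability \<open>1 - exp (- g)\<close> is at least
  \<open>(1 - \<gamma>) * g\<close>. The integrand thus becomes exponential in the gap and its mean
  is explicit; longer gaps are exponentially unlikely.\<close>

lemma nn_integral_head_factor_le:
  assumes n: "n \<ge> 1" and l: "l > 0" and \<epsilon>: "0 < \<epsilon>" "2 * \<epsilon> \<le> 1" and \<theta>: "0 \<le> \<theta>" and c': "0 \<le> c'"
    and \<gamma>: "0 < \<gamma>" "\<gamma> \<le> 1" and K: "0 < K"
    and e: "e = \<epsilon> * real n" and p: "p = max 0 (slope e (idle n m) - real K / e)"
  shows "(\<integral>\<^sup>+x. step_weight (real n * c') k x * (\<integral>\<^sup>+r. head_factor n \<theta> e m (arr_gap S k x) r \<partial>famexp) \<partial>M) \<le>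
    ennreal (gap_factor c' \<gamma> K ((1 - 2 * \<epsilon>) * (1 - exp (- (\<theta> * p)))))"
proof -
  let ?g = "arr_gap S k"
  define v where "v = (1 - 2 * \<epsilon>) * (1 - exp (- (\<theta> * p)))"
  have v: "0 \<le> v" using \<epsilon> \<theta> by (simp add: v_def p)
  have e0: "0 < e" using \<epsilon> n by (simp add: e)
  have g [measurable]: "?g \<in> borel_measurable M" using stage_inputs_M[of k] by (simp add: stage_inputs_def)
  have gap: "AE x in M. 0 < ?g x"
    using AE_good_path[OF n l] by eventually_elim (simp add: good_path_def)
  define a where "a = real n * (c' + (1 - \<gamma>) * v)"
  have a: "0 \<le> a" using c' \<gamma> v by (simp add: a_def)
  have ub: "step_weight (real n * c') k x * (\<integral>\<^sup>+r. head_factor n \<theta> e m (?g x) r \<partial>famexp) \<le>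
      ennreal (exp (- (a * ?g x))) + (if \<gamma> < ?g x then 1 else 0) + ennreal (real n / real K) * (1 - ennreal (exp (- (1 * ?g x))))"
    if x: "0 < ?g x" for x
  proof -
    define u where "u = 1 - exp (- ?g x)"
    have u: "0 \<le> u" using x by (simp add: u_def)
    have w: "0 \<le> real n * c' * ?g x" using x c' by simp
    have "step_weight (real n * c') k x * (\<integral>\<^sup>+r. head_factor n \<theta> e m (?g x) r \<partial>famexp) \<le>
        ennreal (exp (- (real n * c' * ?g x))) * ennreal (exp (- ((real n - 2 * e) * (1 - exp (- (\<theta> * p))) * u)) + real n * u / real K)"
      unfolding step_weight_def head_factor_def u_def
      using nn_integral_heads_le[OF e0 \<theta> less_imp_le[OF x] K n p] by (intro mult_left_mono) auto
    also have "\<dots> = ennreal (exp (- (real n * c' * ?g x)) * exp (- (real n * v * u)) + exp (- (real n * c' * ?g x)) * (real n * u / real K))"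
      using u by (subst ennreal_mult[symmetric]) (auto simp: v_def e algebra_simps)
    also have "\<dots> \<le> ennreal ((exp (- (a * ?g x)) + (if \<gamma> < ?g x then 1 else 0)) + real n * u / real K)"
    proof (intro ennreal_leI add_mono)
      show "exp (- (real n * c' * ?g x)) * (real n * u / real K) \<le> real n * u / real K"
        using u w by (intro mult_left_le_one_le) auto
      show "exp (- (real n * c' * ?g x)) * exp (- (real n * v * u)) \<le> exp (- (a * ?g x)) + (if \<gamma> < ?g x then 1 else 0)"
      proof (cases "\<gamma> < ?g x")
        case True
        have "exp (- (real n * c' * ?g x)) * exp (- (real n * v * u)) \<le> 1"
          using w v u by (intro mult_le_one) auto
        then show ?thesis using True by (simp add: add_increasing)
      next
        case False
        \<comment> \<open>From \<open>1 - exp (- g) \<ge> g / (1 + g)\<close> and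
          \<open>(1 - \<gamma>) * (1 + \<gamma>) \<le> 1\<close>.\<close>
        have "(1 - \<gamma>) * ?g x \<le> u"
        proof -
          have "exp (- ?g x) \<le> 1 / (1 + ?g x)"
            using exp_ge_add_one_self[of "?g x"] x by (simp add: exp_minus field_simps)
          then have "?g x / (1 + ?g x) \<le> u" using x by (simp add: u_def field_simps)
          moreover have "(1 - \<gamma>) * (1 + ?g x) \<le> 1"
          proof -
            have "(1 - \<gamma>) * (1 + ?g x) \<le> (1 - \<gamma>) * (1 + \<gamma>)" using False \<gamma> by (intro mult_left_mono) auto
            also have "\<dots> \<le> 1" by (simp add: algebra_simps)
            finally show ?thesis .
          qed
          then have "((1 - \<gamma>) * (1 + ?g x)) * ?g x \<le> 1 * ?g x" using x by (intro mult_right_mono) auto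
          then have "(1 - \<gamma>) * ?g x \<le> ?g x / (1 + ?g x)" using x by (simp add: field_simps)
          ultimately show ?thesis by linarith
        qed
        then have "real n * v * ((1 - \<gamma>) * ?g x) \<le> real n * v * u" using v by (intro mult_left_mono) auto
        then have "a * ?g x \<le> real n * c' * ?g x + real n * v * u" by (simp add: a_def algebra_simps)
        then show ?thesis using False by (simp add: exp_add[symmetric])
      qed
    qed
    also have "\<dots> = ennreal (exp (- (a * ?g x))) + (if \<gamma> < ?g x then 1 else 0) + ennreal (real n * u / real K)"
      using u by (simp add: ennreal_plus)
    also have "ennreal (real n * u / real K) = ennreal (real n / real K) * (1 - ennreal (exp (- (1 * ?g x))))"
      using u by (simp add: u_def ennreal_mult[symmetric] ennreal_1[symmetric] ennreal_minus del: ennreal_1)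
    finally show ?thesis .
  qed
  have "(\<integral>\<^sup>+x. step_weight (real n * c') k x * (\<integral>\<^sup>+r. head_factor n \<theta> e m (?g x) r \<partial>famexp) \<partial>M) \<le>
     (\<integral>\<^sup>+x. ennreal (exp (- (a * ?g x))) + (if \<gamma> < ?g x then 1 else 0) + ennreal (real n / real K) * (1 - ennreal (exp (- (1 * ?g x)))) \<partial>M)"
    using gap by (intro nn_integral_mono_AE, eventually_elim) (rule ub)
  also have "\<dots> = (\<integral>\<^sup>+x. ennreal (exp (- (a * ?g x))) \<partial>M) + (\<integral>\<^sup>+x. (if \<gamma> < ?g x then 1 else 0) \<partial>M) +
     ennreal (real n / real K) * (\<integral>\<^sup>+x. 1 - ennreal (exp (- (1 * ?g x))) \<partial>M)"
    by (simp add: nn_integral_add nn_integral_cmult)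
  also have "(\<integral>\<^sup>+x. (if \<gamma> < ?g x then 1 else 0) \<partial>M) = ennreal (exp (- (real n * l * \<gamma>)))"
  proof -
    have "(\<integral>\<^sup>+x. (if \<gamma> < ?g x then 1 else 0) \<partial>M) = (\<integral>\<^sup>+x. indicator {x \<in> space M. \<gamma> < ?g x} x \<partial>M)"
      by (intro nn_integral_cong) (auto simp: indicator_def)
    also have "\<dots> = ennreal (prob {x \<in> space M. \<gamma> < ?g x})"
      by (simp add: emeasure_eq_measure)
    also have "prob {x \<in> space M. \<gamma> < ?g x} = exp (- (real n * l * \<gamma>))"
      using exponential_distributedD_gt[OF arr_gap[of k], of \<gamma>] n l \<gamma> by (simp add: mult.commute mult.assoc)
    finally show ?thesis .
  qed
  also have "(\<integral>\<^sup>+x. ennreal (exp (- (a * ?g x))) \<partial>M) = ennreal (real n * l / (real n * l + a))"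
    by (rule nn_integral_gap_exp[OF n l a])
  also have "(\<integral>\<^sup>+x. 1 - ennreal (exp (- (1 * ?g x))) \<partial>M) = ennreal (1 - real n * l / (real n * l + 1))"
  proof -
    have "(\<integral>\<^sup>+x. 1 - ennreal (exp (- (1 * ?g x))) \<partial>M) = (\<integral>\<^sup>+x. 1 \<partial>M) - (\<integral>\<^sup>+x. ennreal (exp (- (1 * ?g x))) \<partial>M)"
    proof (rule nn_integral_diff)
      show "AE x in M. ennreal (exp (- (1 * ?g x))) \<le> 1"
        using gap by eventually_elim (simp add: ennreal_le_1)
      show "(\<integral>\<^sup>+x. ennreal (exp (- (1 * ?g x))) \<partial>M) \<noteq> \<infinity>"
        unfolding nn_integral_gap_exp[OF n l zero_le_one] by simp
    qed auto
    moreover have "1 - ennreal y = ennreal (1 - y)" if "0 \<le> y" for y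
      using ennreal_minus[OF that, of 1] by simp
    ultimately show ?thesis
      unfolding nn_integral_gap_exp[OF n l zero_le_one] using emeasure_space_1 n l by simp
  qed
  also have "ennreal (real n * l / (real n * l + a)) + ennreal (exp (- (real n * l * \<gamma>))) +
      ennreal (real n / real K) * ennreal (1 - real n * l / (real n * l + 1)) \<le> ennreal (gap_factor c' \<gamma> K v)"
  proof -
    have "real n * l + a = real n * (l + c' + (1 - \<gamma>) * v)" by (simp add: a_def algebra_simps)
    then have 1: "real n * l / (real n * l + a) = l / (l + c' + (1 - \<gamma>) * v)" using n by simp
    have nl: "0 < real n * l" using n l by simp
    then have "1 - real n * l / (real n * l + 1) = 1 / (real n * l + 1)" by (simp add: field_simps)
    also have "\<dots> \<le> 1 / (real n * l)" using nl by (intro divide_left_mono) auto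
    finally have "real n / real K * (1 - real n * l / (real n * l + 1)) \<le> real n / real K * (1 / (real n * l))"
      by (intro mult_left_mono) auto
    then have 2: "real n / real K * (1 - real n * l / (real n * l + 1)) \<le> 1 / (l * real K)" using n by (simp add: mult.commute)
    have 3: "0 \<le> 1 - real n * l / (real n * l + 1)" using nl by (simp add: field_simps)
    have 4: "0 \<le> l / (l + c' + (1 - \<gamma>) * v)" using l c' v \<gamma> by simp
    have "ennreal (real n * l / (real n * l + a)) + ennreal (exp (- (real n * l * \<gamma>))) + ennreal (real n / real K) * ennreal (1 - real n * l / (real n * l + 1))
       = ennreal (l / (l + c' + (1 - \<gamma>) * v) + exp (- (real n * l * \<gamma>)) + real n / real K * (1 - real n * l / (real n * l + 1)))"
    proof -
      define z where "z = real n / real K * (1 - real n * l / (real n * l + 1))"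
      have z: "0 \<le> z" using 3 by (simp add: z_def)
      have "ennreal (real n / real K) * ennreal (1 - real n * l / (real n * l + 1)) = ennreal z"
        unfolding z_def by (rule ennreal_mult[symmetric]) (use 3 in auto)
      then show ?thesis
        unfolding 1 z_def[symmetric] using z 4 by (simp add: ennreal_plus)
    qed
    also have "\<dots> \<le> ennreal (gap_factor c' \<gamma> K v)"
      unfolding gap_factor_def using 2 by (intro ennreal_leI) simp
    finally show ?thesis .
  qed
  finally show ?thesis by (simp add: v_def)
qed

text \<open>A Markov bound at every arrival. On the event some epoch before \<open>T\<close> has no
  idle server and excess at least \<open>(j - 2) * n\<close>, so the discounted exponential of
  \<open>lyap\<close>, times \<open>C\<close>, reaches 1. The expectations decay geometrically from
  the initial value 1, and their sum over all arrivals is finite.\<close>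

lemma prob_event_V_le:
  assumes n: "n \<ge> 1" and d: "d \<ge> 1" and l: "l > 0" and q: "\<forall>s<n. q s = 1" and j: "j \<ge> 3"
    and \<theta>: "0 \<le> \<theta>" and c: "0 \<le> c" and \<rho>: "0 \<le> \<rho>" "\<rho> < 1"
    and step: "\<And>k m. (\<integral>\<^sup>+x. step_weight c k x * (\<integral>\<^sup>+r. ennreal (exp (lyap n \<theta> e (next_len k x m r))) \<partial>famexp) \<partial>M) \<le>
      ennreal \<rho> * ennreal (exp (lyap n \<theta> e m))"
  shows "prob (event_V M S n q j T) \<le> exp (c * T - \<theta> * ((real j - 2) * real n)) / (1 - \<rho>)"
proof -
  interpret fam: prob_space famexp by (rule prob_space_famexp)
  define C where "C = ennreal (exp (c * T - \<theta> * ((real j - 2) * real n)))"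
  define V where "V m = ennreal (exp (lyap n \<theta> e m))" for m
  have V [measurable]: "V \<in> borel_measurable len_space"
    unfolding V_def[abs_def] using measurable_lyap by measurable
  have ev: "event_V M S n q j T \<in> events"
    by (rule sets_events(2)[OF measurable_inputs_M n]) (use j in simp)
  have "lyap n \<theta> e (\<lambda>s. if s < n then 1 else 0) = 0"
    by (simp add: lyap_def excess_def idle_def)
  then have V0: "V (\<lambda>s. if s < n then 1 else 0) = 1" by (simp add: V_def)
  have avg_le: "avg c k (\<lambda>z. V (fst z)) \<le> ennreal \<rho> ^ k" for k
    using avg_len_decay[OF q n l V, of c "ennreal \<rho>" k] step V0 unfolding V_def by simp
  define U where "U k f \<omega> = weight c k \<omega> * V (fst (sys_state S n f \<omega> k))" for k f \<omega>
  have Um: "(\<lambda>p. U k (fst p) (snd p)) \<in> borel_measurable (famexp \<Otimes>\<^sub>M M)" for k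
    unfolding U_def
    by (intro borel_measurable_times_ennreal measurable_weight[OF measurable_inputs_M measurable_snd]
        measurable_compose[OF measurable_compose[OF measurable_sys_state[OF measurable_inputs_M q
          measurable_compose[OF measurable_fst measurable_ident_famexp] measurable_snd] measurable_fst] V])
  have Uf: "U k f \<in> borel_measurable M" for k f
    using measurable_compose[OF measurable_Pair1' Um, of f k] by simp
  have UI: "(\<lambda>f. \<integral>\<^sup>+\<omega>. U k f \<omega> \<partial>M) \<in> borel_measurable famexp" for k
    using Um by (intro borel_measurable_nn_integral) (simp add: split_beta')
  \<comment> \<open>The event does not involve the fillers, so averaging over them is free and makes
    \<open>avg\<close> applicable.\<close>
  have "emeasure M (event_V M S n q j T) = (\<integral>\<^sup>+f. \<integral>\<^sup>+\<omega>. indicator (event_V M S n q j T) \<omega> \<partial>M \<partial>famexp)"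
    using ev fam.emeasure_space_1 by simp
  also have "\<dots> \<le> (\<integral>\<^sup>+f. \<integral>\<^sup>+\<omega>. (\<Sum>k. C * U (Suc k) f \<omega>) \<partial>M \<partial>famexp)"
  proof (rule nn_integral_mono, rule nn_integral_mono_AE)
    fix f
    show "AE \<omega> in M. indicator (event_V M S n q j T) \<omega> \<le> (\<Sum>k. C * U (Suc k) f \<omega>)"
      using AE_good_path[OF n l]
    proof eventually_elim
      case (elim \<omega>)
      show ?case
      proof (cases "\<omega> \<in> event_V M S n q j T")
        case True
        from event_V_imp[OF elim n d j q True, of f] obtain k where k: "epoch S (Suc k) \<omega> \<le> T"
          "\<forall>s<n. j - 1 \<le> fst (sys_state S n f \<omega> (Suc k)) s" by blast
        let ?m = "fst (sys_state S n f \<omega> (Suc k))"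
        have m: "\<forall>s<n. j - 1 \<le> ?m s" using k(2) .
        have "{s. s < n \<and> ?m s = 0} = {}" using m j by fastforce
        then have idle: "idle n ?m = 0" by (simp add: idle_def del: sys_state.simps)
        have "(\<Sum>s<n. j - 2) \<le> (\<Sum>s<n. ?m s - 1)"
        proof (rule sum_mono)
          fix s assume "s \<in> {..<n}"
          then have "j - 1 \<le> ?m s" using m by blast
          then show "j - 2 \<le> ?m s - 1" by linarith
        qed
        then have "n * (j - 2) \<le> excess n ?m" by (simp add: excess_def)
        then have "real (n * (j - 2)) \<le> real (excess n ?m)" by (rule of_nat_mono)
        moreover have "real (n * (j - 2)) = (real j - 2) * real n" using j by (simp add: of_nat_diff)
        ultimately have "(real j - 2) * real n \<le> real (excess n ?m)" by linarith
        then have "\<theta> * ((real j - 2) * real n) \<le> \<theta> * real (excess n ?m)"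
          using \<theta> by (rule mult_left_mono)
        then have "\<theta> * ((real j - 2) * real n) \<le> lyap n \<theta> e ?m"
          unfolding lyap_def idle by simp
        moreover have "c * epoch S (Suc k) \<omega> \<le> c * T" using k(1) c by (rule mult_left_mono)
        ultimately have "1 \<le> exp ((c * T - \<theta> * ((real j - 2) * real n)) + (- (c * epoch S (Suc k) \<omega>) + lyap n \<theta> e ?m))"
          by simp
        then have "ennreal 1 \<le> ennreal (exp ((c * T - \<theta> * ((real j - 2) * real n)) + (- (c * epoch S (Suc k) \<omega>) + lyap n \<theta> e ?m)))"
          by (rule ennreal_leI)
        also have "\<dots> = C * U (Suc k) f \<omega>"
          unfolding C_def U_def weight_def V_def exp_add by (simp add: ennreal_mult del: sys_state.simps)
        also have "\<dots> \<le> (\<Sum>k. C * U (Suc k) f \<omega>)"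
          using sum_le_suminf[OF summableI, of "{k}" "\<lambda>k. C * U (Suc k) f \<omega>"] by simp
        finally show ?thesis using True by simp
      qed simp
    qed
  qed
  also have "\<dots> = (\<Sum>k. C * avg c (Suc k) (\<lambda>z. V (fst z)))"
  proof -
    have "(\<integral>\<^sup>+\<omega>. (\<Sum>k. C * U (Suc k) f \<omega>) \<partial>M) = (\<Sum>k. C * (\<integral>\<^sup>+\<omega>. U (Suc k) f \<omega> \<partial>M))" for f
      using Uf by (simp add: nn_integral_suminf nn_integral_cmult)
    then have "(\<integral>\<^sup>+f. \<integral>\<^sup>+\<omega>. (\<Sum>k. C * U (Suc k) f \<omega>) \<partial>M \<partial>famexp) = (\<Sum>k. C * (\<integral>\<^sup>+f. \<integral>\<^sup>+\<omega>. U (Suc k) f \<omega> \<partial>M \<partial>famexp))"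
      using UI by (simp add: nn_integral_suminf nn_integral_cmult)
    then show ?thesis unfolding avg_def U_def .
  qed
  also have "\<dots> \<le> (\<Sum>k. C * ennreal (\<rho> ^ k))"
  proof (rule suminf_le[OF _ summableI summableI])
    fix k
    have "avg c (Suc k) (\<lambda>z. V (fst z)) \<le> ennreal (\<rho> ^ Suc k)"
      using avg_le[of "Suc k"] \<rho> by (simp add: ennreal_power del: power_Suc)
    also have "\<dots> \<le> ennreal (\<rho> ^ k)" using \<rho> by (intro ennreal_leI power_decreasing) auto
    finally show "C * avg c (Suc k) (\<lambda>z. V (fst z)) \<le> C * ennreal (\<rho> ^ k)" by (rule mult_left_mono) simp
  qed
  also have "\<dots> = C * (\<Sum>k. ennreal (\<rho> ^ k))" by simp
  also have "(\<Sum>k. ennreal (\<rho> ^ k)) = ennreal (1 / (1 - \<rho>))"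
    using \<rho> geometric_sums[of \<rho>] by (subst suminf_ennreal2) (auto simp: sums_iff)
  also have "C * ennreal (1 / (1 - \<rho>)) = ennreal (exp (c * T - \<theta> * ((real j - 2) * real n)) / (1 - \<rho>))"
    unfolding C_def using \<rho> by (simp add: ennreal_mult[symmetric])
  finally show ?thesis
    using \<rho> by (simp add: emeasure_eq_measure)
qed

end

text \<open>The ideal arrival factor is \<open>X\<close> and the ideal departure factor
  \<open>1 / X\<close>; convexity gives
  \<open>X + 1 / X \<le> exp \<theta> + exp (- \<theta>)\<close> for all intermediate slopes. Hence
  \<open>W\<close> exceeds \<open>l * X\<close> by \<delta> / 2 after the perturbations are
  absorbed, and \<open>s\<close> is that margin relative to the largest possible denominator. The
  remaining errors \<open>s / 8\<close>, \<open>s / 8\<close> and \<open>s / 4\<close> use up half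
  of \<open>s\<close>.\<close>

lemma decay_factor_le:
  fixes \<theta> \<delta> \<epsilon> \<gamma> l \<eta> p0 :: real and n K :: nat
  assumes \<theta>: "0 \<le> \<theta>" and \<delta>: "0 < \<delta>" and \<epsilon>: "0 < \<epsilon>" "2 * \<epsilon> \<le> 1" and \<gamma>: "0 < \<gamma>" "\<gamma> \<le> 1"
    and K: "0 < K" and n: "0 < n" and l: "1 / 2 \<le> l" "l \<le> 2" and \<eta>: "0 \<le> \<eta>" "\<eta> \<le> 1"
    and small: "\<bar>1 - l\<bar> * exp \<theta> \<le> \<delta> / 8" "\<theta> * (real K / (\<epsilon> * real n)) \<le> \<delta> / 8" "\<gamma> + 2 * \<epsilon> \<le> \<delta> / 8"
    and s: "s = (\<delta> / 2) / (2 * exp \<theta> + \<delta> / 2)"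
    and small': "exp \<theta> * \<eta> \<le> s / 8" "2 * exp \<theta> * exp (- (real n * l * \<gamma>)) \<le> s / 8" "4 * exp \<theta> / real K \<le> s / 4"
    and p0: "0 \<le> p0" "p0 \<le> 1" and p: "p = max 0 (p0 - real K / (\<epsilon> * real n))"
  shows "(exp (\<theta> * p0) + exp \<theta> * \<eta>) *
    (l / (l + (exp \<theta> + exp (- \<theta>) - 2 + \<delta>) + (1 - \<gamma>) * ((1 - 2 * \<epsilon>) * (1 - exp (- (\<theta> * p))))) +
      exp (- (real n * l * \<gamma>)) + 1 / (l * real K)) \<le> 1 - s / 2"
proof -
  define X where "X = exp (\<theta> * p0)"
  define Y where "Y = exp (- (\<theta> * p))"
  define A where "A = exp (- (real n * l * \<gamma>)) + 1 / (l * real K)"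
  define W where "W = l + (exp \<theta> + exp (- \<theta>) - 2 + \<delta>) + (1 - \<gamma>) * ((1 - 2 * \<epsilon>) * (1 - Y))"
  have X: "1 \<le> X" "X \<le> exp \<theta>" using \<theta> p0 by (auto simp: X_def mult_left_le)
  have Y: "0 \<le> Y" "Y \<le> 1" using \<theta> by (auto simp: Y_def p)
  have p_le: "0 \<le> p" "p \<le> p0" "p0 - p \<le> real K / (\<epsilon> * real n)" using p0 \<epsilon> by (auto simp: p)
  \<comment> \<open>\<open>p\<close> is the slope \<open>p0\<close> lowered by what \<open>K\<close>
    departures can take away, so \<open>Y\<close> is only slightly above the ideal factor.\<close>
  have "Y - 1 / X \<le> \<theta> * (p0 - p)"
  proof -
    have "1 / X = Y * exp (- (\<theta> * (p0 - p)))"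
      by (simp add: X_def Y_def exp_add[symmetric] exp_minus[symmetric] inverse_eq_divide[symmetric] algebra_simps)
    then have "Y - 1 / X = Y * (1 - exp (- (\<theta> * (p0 - p))))" by (simp add: algebra_simps)
    also have "\<dots> \<le> 1 * (\<theta> * (p0 - p))"
      using Y \<theta> p_le exp_ge_add_one_self[of "- (\<theta> * (p0 - p))"] by (intro mult_mono) auto
    finally show ?thesis by simp
  qed
  also have "\<dots> \<le> \<theta> * (real K / (\<epsilon> * real n))" using \<theta> p_le by (intro mult_left_mono) auto
  also have "\<dots> \<le> \<delta> / 8" by fact
  finally have Y': "Y - 1 / X \<le> \<delta> / 8" .
  \<comment> \<open>The difference of the two sides factors into a product of nonnegative
    terms.\<close>
  have conv: "X + 1 / X \<le> exp \<theta> + exp (- \<theta>)"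
  proof -
    have "0 \<le> (exp \<theta> - X) * (1 - 1 / (X * exp \<theta>))"
    proof -
      have "1 * 1 \<le> X * exp \<theta>" using X \<theta> by (intro mult_mono) auto
      then show ?thesis using X by simp
    qed
    also have "\<dots> = exp \<theta> + exp (- \<theta>) - (X + 1 / X)"
      using X by (simp add: field_simps exp_minus)
    finally show ?thesis by simp
  qed
  have "(1 - \<gamma>) * ((1 - 2 * \<epsilon>) * (1 - Y)) \<ge> (1 - Y) - (\<gamma> + 2 * \<epsilon>)"
  proof -
    have "(1 - \<gamma>) * (1 - 2 * \<epsilon>) = 1 - (\<gamma> + 2 * \<epsilon>) + \<gamma> * (2 * \<epsilon>)" by (simp add: algebra_simps)
    then have "(1 - \<gamma>) * (1 - 2 * \<epsilon>) \<ge> 1 - (\<gamma> + 2 * \<epsilon>)" using \<gamma> \<epsilon> by simp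
    then have "(1 - \<gamma>) * (1 - 2 * \<epsilon>) * (1 - Y) \<ge> (1 - (\<gamma> + 2 * \<epsilon>)) * (1 - Y)"
      using Y by (intro mult_right_mono) auto
    moreover have "(\<gamma> + 2 * \<epsilon>) * (1 - Y) \<le> \<gamma> + 2 * \<epsilon>" using Y \<gamma> \<epsilon> by (intro mult_left_le) auto
    ultimately show ?thesis by (simp add: algebra_simps)
  qed
  moreover have "\<bar>(1 - l) * (X - 1)\<bar> \<le> \<delta> / 8"
  proof -
    have "\<bar>(1 - l) * (X - 1)\<bar> \<le> \<bar>1 - l\<bar> * exp \<theta>" unfolding abs_mult using X by (intro mult_left_mono) auto
    with small(1) show ?thesis by linarith
  qed
  moreover have "l * X + (1 - l) * (X - 1) = X + l - 1" by (simp add: algebra_simps)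
  \<comment> \<open>Of the \<delta> in \<open>W\<close>, three eighths at most are spent: on the
    lowered slope, on \<gamma> and \<epsilon>, and on \<open>l\<close> differing from 1.\<close>
  ultimately have W: "l * X + \<delta> / 2 \<le> W" unfolding W_def using Y' conv small(3) by linarith
  have lX: "0 < l * X" using l X by simp
  have Wpos: "0 < W" using W lX \<delta> by linarith
  have "X * (l / W) \<le> 1 - s"
  proof -
    have "X * (l / W) = l * X / W" by simp
    also have "\<dots> \<le> l * X / (l * X + \<delta> / 2)"
      using W lX \<delta> by (intro divide_left_mono mult_pos_pos) auto
    also have "\<dots> = 1 - (\<delta> / 2) / (l * X + \<delta> / 2)" using lX \<delta> by (simp add: field_simps)
    also have "\<dots> \<le> 1 - s"
    proof -
      have "l * X \<le> 2 * exp \<theta>" using l X by (intro mult_mono) auto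
      then have "s \<le> (\<delta> / 2) / (l * X + \<delta> / 2)"
      proof -
        have "l * X \<le> 2 * exp \<theta>" by fact
        moreover have "0 < 2 * exp \<theta> + \<delta> / 2" "0 < l * X + \<delta> / 2" using lX \<delta> by (auto intro: add_pos_pos)
        ultimately show ?thesis unfolding s using \<delta> by (intro divide_left_mono mult_pos_pos) simp_all
      qed
      then show ?thesis by simp
    qed
    finally show ?thesis .
  qed
  moreover have "exp \<theta> * \<eta> * (l / W) \<le> s / 8"
  proof -
    have "l * 1 \<le> l * X" using l X by (intro mult_left_mono) auto
    then have "l / W \<le> 1" using W Wpos \<delta> by simp
    then have "exp \<theta> * \<eta> * (l / W) \<le> exp \<theta> * \<eta> * 1" using \<eta> by (intro mult_left_mono) auto
    also have "\<dots> = exp \<theta> * \<eta>" by simp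
    also have "\<dots> \<le> s / 8" by fact
    finally show ?thesis .
  qed
  moreover have "(X + exp \<theta> * \<eta>) * A \<le> s / 8 + s / 4"
  proof -
    have "exp \<theta> * \<eta> \<le> exp \<theta>" using \<eta> by (simp add: mult_left_le)
    then have "X + exp \<theta> * \<eta> \<le> 2 * exp \<theta>" using X by linarith
    then have "(X + exp \<theta> * \<eta>) * A \<le> 2 * exp \<theta> * A"
      using l by (intro mult_right_mono) (auto simp: A_def)
    also have "\<dots> = 2 * exp \<theta> * exp (- (real n * l * \<gamma>)) + 2 * exp \<theta> / (l * real K)" by (simp add: A_def algebra_simps)
    also have "2 * exp \<theta> / (l * real K) \<le> 2 * exp \<theta> / (1 / 2 * real K)"
      using l K by (intro divide_left_mono mult_right_mono mult_pos_pos) auto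
    also have "2 * exp \<theta> / (1 / 2 * real K) = 4 * exp \<theta> / real K" by simp
    finally show ?thesis using small' by linarith
  qed
  moreover have "(X + exp \<theta> * \<eta>) * (l / W + A) = X * (l / W) + exp \<theta> * \<eta> * (l / W) + (X + exp \<theta> * \<eta>) * A"
    by (simp add: algebra_simps)
  ultimately have "(X + exp \<theta> * \<eta>) * (l / W + A) \<le> 1 - s / 2" by linarith
  then show ?thesis unfolding X_def[symmetric] Y_def[symmetric] W_def A_def by (simp add: add.assoc)
qed

subsection \<open>Exponential rates\<close>

text \<open>A crude Stirling bound. The shift to \<open>k + 1\<close> makes it an upper bound and
  costs only a term of logarithmic order.\<close>

lemma ln_fact_le: "ln (fact k) \<le> (real k + 1) * ln (real k + 1) - real k"
proof (induction k)
  case (Suc k)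
  have "ln ((real k + 1) / (real k + 2)) \<le> (real k + 1) / (real k + 2) - 1"
    by (rule ln_le_minus_one) simp
  then have "ln (real k + 1) - ln (real k + 2) \<le> (real k + 1) / (real k + 2) - 1"
    by (simp add: ln_div)
  then have "(real k + 2) * (ln (real k + 1) - ln (real k + 2)) \<le> (real k + 2) * ((real k + 1) / (real k + 2) - 1)"
    by (intro mult_left_mono) auto
  also have "\<dots> = -1" by (simp add: field_simps)
  finally have "(real k + 2) * ln (real k + 1) - (real k + 2) * ln (real k + 2) \<le> -1"
    by (simp add: algebra_simps)
  moreover have "ln (fact (Suc k)) = ln (real k + 1) + ln (fact k)"
    by (simp add: ln_mult add.commute)
  ultimately show ?case using Suc by (simp add: algebra_simps)
qed simp

text \<open>The limit equals \<open>- m * ell (\<kappa> / m)\<close>, the Poisson large deviation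
  rate; only a lower bound for the atom is needed.\<close>

lemma poisson_pmf_rate:
  fixes \<mu> :: "nat \<Rightarrow> real" and k :: "nat \<Rightarrow> nat"
  assumes \<mu>: "\<mu> \<longlonglongrightarrow> m" "0 < m" and k: "(\<lambda>n. real (k n) / real n) \<longlonglongrightarrow> \<kappa>" "0 < \<kappa>"
  shows "\<exists>f. f \<longlonglongrightarrow> - m + \<kappa> * ln m - \<kappa> * ln \<kappa> + \<kappa> \<and>
    (\<forall>\<^sub>F n in sequentially. exp (real n * f n) \<le> exp (- (real n * \<mu> n)) * (real n * \<mu> n) ^ k n / fact (k n))"
proof -
  define x where "x n = real (k n) / real n" for n
  define y where "y n = x n + 1 / real n" for n
  define f where "f n = - \<mu> n + x n * ln (\<mu> n) - y n * ln (y n) + x n - ln (real n) / real n" for n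
  have x: "x \<longlonglongrightarrow> \<kappa>" using k by (simp add: x_def[abs_def])
  have "(\<lambda>n. 1 / real n) \<longlonglongrightarrow> 0" by real_asymp
  from tendsto_add[OF x this] have y: "y \<longlonglongrightarrow> \<kappa>" by (simp add: y_def[abs_def])
  have "(\<lambda>n. ln (real n) / real n) \<longlonglongrightarrow> 0" by real_asymp
  then have "f \<longlonglongrightarrow> - m + \<kappa> * ln m - \<kappa> * ln \<kappa> + \<kappa> - 0"
    unfolding f_def[abs_def] using \<mu> k(2) by (intro tendsto_intros x y) auto
  moreover have "\<forall>\<^sub>F n in sequentially. exp (real n * f n) \<le> exp (- (real n * \<mu> n)) * (real n * \<mu> n) ^ k n / fact (k n)"
    using order_tendstoD(1)[OF \<mu>] eventually_gt_at_top[of 0]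
  proof eventually_elim
    case (elim n)
    then have n: "0 < real n" and mu: "0 < \<mu> n" by auto
    have k': "real (k n) = real n * x n" "real (k n) + 1 = real n * y n"
      using n by (simp_all add: x_def y_def field_simps)
    have y: "0 < y n" using n by (simp add: y_def x_def add_nonneg_pos)
    have lnx: "ln (real n * \<mu> n) = ln (real n) + ln (\<mu> n)" and lny: "ln (real n * y n) = ln (real n) + ln (y n)"
      using n mu y by (simp_all add: ln_mult)
    \<comment> \<open>The terms with \<open>ln n\<close> from power and factorial cancel except for
      one, which appears in \<open>f\<close> divided by \<open>n\<close>.\<close>
    have "real n * y n = real n * x n + 1" using k' by simp
    then have ny: "real n * (y n * ln (real n)) = real n * (x n * ln (real n)) + ln (real n)"
      by (metis distrib_right mult.assoc mult_1)
    have "real n * f n = - (real n * \<mu> n) + real n * x n * ln (real n * \<mu> n) - (real n * y n * ln (real n * y n) - real n * x n)"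
      unfolding lnx lny f_def using n ny by (simp add: algebra_simps)
    then have "real n * f n = - (real n * \<mu> n) + real (k n) * ln (real n * \<mu> n) - ((real (k n) + 1) * ln (real (k n) + 1) - real (k n))"
      by (simp only: k'(2)) (simp only: k'(1))
    then have "real n * f n \<le> - (real n * \<mu> n) + real (k n) * ln (real n * \<mu> n) - ln (fact (k n))"
      using ln_fact_le[of "k n"] by simp
    also have "\<dots> = ln (exp (- (real n * \<mu> n)) * (real n * \<mu> n) ^ k n / fact (k n))"
      using n mu by (simp add: ln_mult ln_div ln_realpow)
    finally show ?case
      using n mu by (subst (asm) ln_ge_iff) simp_all
  qed
  ultimately show ?thesis by (intro exI[of _ f]) simp
qed

lemma eln_scaled_le:
  assumes "0 \<le> p" "p \<le> exp x" "0 \<le> t"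
  shows "0 < t \<Longrightarrow> ereal t * eln p \<le> ereal (t * x)"
proof (cases "p = 0")
  case False
  assume "0 < t"
  have "ln p \<le> x" using assms False by (metis exp_gt_zero ln_exp ln_le_cancel_iff order_le_less)
  then show ?thesis using False \<open>0 < t\<close> by (simp add: eln_def)
qed (simp add: eln_def)

lemma eln_scaled_ge:
  assumes "exp x \<le> p" "0 \<le> t"
  shows "ereal (t * x) \<le> ereal t * eln p"
proof -
  have "0 < p" using assms(1) by (meson exp_gt_zero less_le_trans)
  moreover have "x \<le> ln p" using assms(1) calculation by (simp add: ln_ge_iff)
  ultimately show ?thesis using assms(2) by (simp add: eln_def mult_left_mono)
qed

lemma eln_mono: "0 \<le> p \<Longrightarrow> p \<le> p' \<Longrightarrow> eln p \<le> eln p'"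
  by (auto simp: eln_def)

text \<open>The arguments of \<open>ell\<close> are reciprocal, as their product is
  \<open>((4 + c\<^sup>2) - c\<^sup>2) / 4\<close>. Therefore \<open>ln b = - ln a\<close>, and the
  sum of two Poisson costs turns into the Legendre form that the upper bound produces.\<close>

lemma rate_eq:
  assumes "T > 0" and "c = (real j - 2) / T" and "a = (c + sqrt (4 + c\<^sup>2)) / 2" and "b = (- c + sqrt (4 + c\<^sup>2)) / 2"
  shows "0 < a" "0 < b" "a * b = 1" "a - b = c" "rate j T = T * ell a + T * ell b"
    "rate j T = (real j - 2) * ln a - T * (a + b - 2)"
proof -
  have s: "\<bar>c\<bar> < sqrt (4 + c\<^sup>2)" by (rule real_less_rsqrt) simp
  then show a: "0 < a" and b: "0 < b" unfolding assms(3,4) by (simp_all add: abs_less_iff)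
  show ab: "a * b = 1"
  proof -
    have "a * b = ((sqrt (4 + c\<^sup>2))\<^sup>2 - c\<^sup>2) / 4"
      unfolding assms(3,4) by (simp add: power2_eq_square algebra_simps)
    then show ?thesis by simp
  qed
  show ac: "a - b = c" unfolding assms(3,4) by (simp add: field_simps)
  show r: "rate j T = T * ell a + T * ell b"
    unfolding rate_def Let_def assms(2)[symmetric] assms(3)[symmetric] assms(4)[symmetric] ..
  have "ln b = - ln a" using ab a b by (metis eq_neg_iff_add_eq_0 ln_mult ln_one add.commute less_numeral_extra(3) order_less_irrefl)
  then have "rate j T = T * (a - b) * ln a - T * (a + b - 2)"
    unfolding r ell_def by (simp add: algebra_simps)
  also have "T * (a - b) = real j - 2" using assms ac by simp
  finally show "rate j T = (real j - 2) * ln a - T * (a + b - 2)" .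
qed

text \<open>For large T both arguments are 1 plus or minus c / 2 to first order, and ell (1 + x)
  behaves like half the square of x. Hence \<open>T * rate j T\<close> approaches (T c / 2) squared,
  where T c = j - 2.\<close>

lemma scaled_rate_limit:
  assumes "j \<ge> 3"
  shows "((\<lambda>T. T * rate j T) \<longlongrightarrow> (real j - 2)\<^sup>2 / 4) at_top"
proof -
  define D where "D = real j - 2"
  have "0 < D" using assms by (simp add: D_def)
  then have "((\<lambda>T. T * (T * ((D / T + sqrt (4 + (D / T)\<^sup>2)) / 2 * ln ((D / T + sqrt (4 + (D / T)\<^sup>2)) / 2) - (D / T + sqrt (4 + (D / T)\<^sup>2)) / 2 + 1) +
    T * ((- (D / T) + sqrt (4 + (D / T)\<^sup>2)) / 2 * ln ((- (D / T) + sqrt (4 + (D / T)\<^sup>2)) / 2) - (- (D / T) + sqrt (4 + (D / T)\<^sup>2)) / 2 + 1))) \<longlongrightarrow> D * D / 4) at_top"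
    by real_asymp
  then show ?thesis
    by (simp add: rate_def ell_def Let_def D_def power2_eq_square)
qed

lemma one_initial_job:
  assumes "jsq_system M S n d l q" and n: "n \<ge> 1" and l: "l > 0"
    and occ: "AE \<omega> in M. \<forall>i\<ge>1. occupancy S n q i 0 \<omega> = (if i = 1 then 1 else 0)"
  shows "\<forall>s<n. q s = 1"
proof -
  interpret jsq_system M S n d l q by fact
  have "AE \<omega> in M. \<forall>s<n. q s = 1"
    using AE_good_path[OF n l] occ by eventually_elim (rule one_job_per_server[OF _ n])
  \<comment> \<open>The statement does not mention the outcome, so in a probability space it holds
    outright.\<close>
  then show ?thesis by simp
qed

lemma event_U_rate:
  fixes M :: "nat \<Rightarrow> 'w measure" and lam :: "nat \<Rightarrow> real"
  assumes sys: "\<And>n. n \<ge> 1 \<Longrightarrow> jsq_system (M n) (S n) n (d n) (lam n) (q n)"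
    and d: "\<And>n. n \<ge> 1 \<Longrightarrow> d n \<in> {1..n}" and lam: "\<And>n. n \<ge> 1 \<Longrightarrow> lam n > 0" "lam \<longlonglongrightarrow> 1"
    and q: "\<And>n s. n \<ge> 1 \<Longrightarrow> s < n \<Longrightarrow> q n s = 1" and j: "j \<ge> 3" and T: "T > 0"
  shows "liminf (\<lambda>n. ereal (1 / real n) * eln (measure (M n) (event_U (M n) (S n) n (q n) j T))) \<ge> ereal (- rate j T)"
proof -
  define c where "c = (real j - 2) / T"
  define a where "a = (c + sqrt (4 + c\<^sup>2)) / 2"
  define b where "b = (- c + sqrt (4 + c\<^sup>2)) / 2"
  note ab = rate_eq[OF T c_def a_def b_def]
  \<comment> \<open>Departures at the optimal speed \<open>b\<close>. The arrivals \<open>K\<close>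
    then automatically have the speed \<open>a\<close>, because \<open>a - b = c\<close>.\<close>
  define m where "m n = nat \<lfloor>b * T * real n\<rfloor>" for n
  define K where "K n = m n + (j - 2) * n + 1" for n
  have bT: "0 < b * T" and aT: "0 < a * T" using ab T by auto
  have m: "(\<lambda>n. real (m n) / real n) \<longlonglongrightarrow> b * T"
    unfolding m_def using bT by real_asymp
  have K1: "(\<lambda>n. real (m n) / real n + real (j - 2) + 1 / real n) \<longlonglongrightarrow> b * T + real (j - 2) + 0"
    by (intro tendsto_add m tendsto_const lim_1_over_n)
  have K2: "b * T + real (j - 2) + 0 = a * T"
  proof -
    have "c * T = real j - 2" using T by (simp add: c_def)
    then have "a * T - b * T = real j - 2" using ab(4) by (metis left_diff_distrib)
    then show ?thesis using j by (simp add: of_nat_diff)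
  qed
  have K3: "\<forall>\<^sub>F n in sequentially. real (m n) / real n + real (j - 2) + 1 / real n = real (K n) / real n"
    using eventually_gt_at_top[of 0] by eventually_elim (simp add: K_def field_simps)
  have K: "(\<lambda>n. real (K n) / real n) \<longlonglongrightarrow> a * T"
    using Lim_transform_eventually[OF K1 K3] unfolding K2 .
  have lamT: "(\<lambda>n. lam n * T) \<longlonglongrightarrow> 1 * T" by (intro tendsto_intros lam)
  obtain f where f: "f \<longlonglongrightarrow> - (1 * T) + a * T * ln (1 * T) - a * T * ln (a * T) + a * T"
    "\<forall>\<^sub>F n in sequentially. exp (real n * f n) \<le> exp (- (real n * (lam n * T))) * (real n * (lam n * T)) ^ K n / fact (K n)"
    using poisson_pmf_rate[OF lamT _ K aT] T by auto
  obtain g where g: "g \<longlonglongrightarrow> - T + b * T * ln T - b * T * ln (b * T) + b * T"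
    "\<forall>\<^sub>F n in sequentially. exp (real n * g n) \<le> exp (- (real n * T)) * (real n * T) ^ m n / fact (m n)"
    using poisson_pmf_rate[OF tendsto_const T m bT] by auto
  \<comment> \<open>The two exponents are \<open>- T * ell a\<close> and \<open>- T * ell b\<close>;
    the terms with \<open>ln T\<close> cancel.\<close>
  have "- (1 * T) + a * T * ln (1 * T) - a * T * ln (a * T) + a * T + (- T + b * T * ln T - b * T * ln (b * T) + b * T) = - rate j T"
    unfolding ab(5) ell_def using ab(1,2) T by (simp add: ln_mult algebra_simps)
  then have fg: "(\<lambda>n. f n + g n) \<longlonglongrightarrow> - rate j T" using tendsto_add[OF f(1) g(1)] by simp
  have "\<forall>\<^sub>F n in sequentially. ereal (f n + g n) \<le> ereal (1 / real n) * eln (measure (M n) (event_U (M n) (S n) n (q n) j T))"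
    using f(2) g(2) eventually_ge_at_top[of 1]
  proof eventually_elim
    case (elim n)
    interpret jsq_system "M n" "S n" n "d n" "lam n" "q n" using sys elim by simp
    have "exp (real n * (f n + g n)) = exp (real n * f n) * exp (real n * g n)"
      by (simp add: exp_add[symmetric] algebra_simps)
    also have "\<dots> \<le> (exp (- (real n * (lam n * T))) * (real n * (lam n * T)) ^ K n / fact (K n)) *
        (exp (- (real n * T)) * (real n * T) ^ m n / fact (m n))"
      using elim lam(1)[of n] T by (intro mult_mono) auto
    also have "\<dots> \<le> measure (M n) (event_U (M n) (S n) n (q n) j T)"
      using prob_event_U_ge[of j T "K n" "m n"] elim(3) d[of n] lam(1)[of n] q[of n] j T
      by (simp add: K_def mult.assoc)
    finally have "ereal (1 / real n * (real n * (f n + g n))) \<le> ereal (1 / real n) * eln (measure (M n) (event_U (M n) (S n) n (q n) j T))"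
      by (rule eln_scaled_ge) simp
    then show ?case using elim(3) by simp
  qed
  then have "liminf (\<lambda>n. ereal (f n + g n)) \<le> liminf (\<lambda>n. ereal (1 / real n) * eln (measure (M n) (event_U (M n) (S n) n (q n) j T)))"
    by (rule Liminf_mono)
  moreover have "liminf (\<lambda>n. ereal (f n + g n)) = ereal (- rate j T)"
    using fg by (intro lim_imp_Liminf) auto
  ultimately show ?thesis by simp
qed

lemma event_V_rate:
  fixes M :: "nat \<Rightarrow> 'w measure" and lam :: "nat \<Rightarrow> real"
  assumes sys: "\<And>n. n \<ge> 1 \<Longrightarrow> jsq_system (M n) (S n) n (d n) (lam n) (q n)"
    and d: "\<And>n. n \<ge> 1 \<Longrightarrow> d n \<in> {1..n}" "filterlim d at_top sequentially"
    and lam: "\<And>n. n \<ge> 1 \<Longrightarrow> lam n > 0" "lam \<longlonglongrightarrow> 1"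
    and q: "\<And>n s. n \<ge> 1 \<Longrightarrow> s < n \<Longrightarrow> q n s = 1" and j: "j \<ge> 3" and T: "T > 0"
  shows "limsup (\<lambda>n. ereal (1 / real n) * eln (measure (M n) (event_V (M n) (S n) n (q n) j T))) \<le> ereal (- rate j T)"
proof (rule ereal_le_epsilon2)
  fix \<Delta> :: real assume "0 < \<Delta>"
  define c where "c = (real j - 2) / T"
  define a where "a = (c + sqrt (4 + c\<^sup>2)) / 2"
  define b where "b = (- c + sqrt (4 + c\<^sup>2)) / 2"
  note ab = rate_eq[OF T c_def a_def b_def]
  define \<theta> where "\<theta> = ln a"
  have c: "0 < c" using j T by (simp add: c_def)
  have "1 \<le> a"
  proof (rule ccontr)
    assume "\<not> 1 \<le> a"
    then have "b < 1" using ab(4) c by linarith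
    with \<open>\<not> 1 \<le> a\<close> have "a * b < 1 * 1" using ab(1,2) by (intro mult_strict_mono) auto
    with ab(3) show False by simp
  qed
  then have \<theta>: "0 \<le> \<theta>" by (simp add: \<theta>_def)
  have e\<theta>: "exp \<theta> = a" "exp (- \<theta>) = b"
    using ab(1,3) by (simp_all add: \<theta>_def exp_minus inverse_unique)
  \<comment> \<open>The extra discount \<open>n * \<delta>\<close> over a time \<open>T\<close>
    costs exactly \<Delta> in the exponent per \<open>n\<close>.\<close>
  define \<delta> where "\<delta> = \<Delta> / T"
  have \<delta>: "0 < \<delta>" using \<open>0 < \<Delta>\<close> T by (simp add: \<delta>_def)
  define s where "s = (\<delta> / 2) / (2 * exp \<theta> + \<delta> / 2)"
  have s: "0 < s" "s < 1" using \<delta> by (auto simp: s_def divide_simps add_pos_pos)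
  \<comment> \<open>All constants depend on \<delta> and \<theta> alone and are fixed before
    \<open>n\<close> grows. A share of \<delta> / 32 for each of \<epsilon> and \<gamma> keeps
    \<open>\<gamma> + 2 * \<epsilon>\<close> below \<delta> / 8.\<close>
  define \<epsilon> where "\<epsilon> = min (1 / 2) (\<delta> / 32)"
  define \<gamma> where "\<gamma> = min 1 (\<delta> / 32)"
  have \<epsilon>: "0 < \<epsilon>" "2 * \<epsilon> \<le> 1" and \<gamma>: "0 < \<gamma>" "\<gamma> \<le> 1" and \<gamma>\<epsilon>: "\<gamma> + 2 * \<epsilon> \<le> \<delta> / 8"
    using \<delta> by (auto simp: \<epsilon>_def \<gamma>_def)
  \<comment> \<open>The 16 yields the error \<open>s / 4\<close> required by
    \<open>decay_factor_le\<close>. As \<open>K\<close> is independent of \<open>n\<close>, the loss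
    of slope \<open>K / (\<epsilon> * n)\<close> vanishes.\<close>
  define K where "K = nat \<lceil>16 * exp \<theta> / s\<rceil> + 1"
  have K: "0 < K" by (simp add: K_def)
  have "16 * exp \<theta> / s \<le> real K" unfolding K_def by linarith
  then have K4: "4 * exp \<theta> / real K \<le> s / 4"
    using s K by (simp add: field_simps)
  define c' where "c' = exp \<theta> + exp (- \<theta>) - 2 + \<delta>"
  have c': "0 \<le> c'"
  proof -
    have "0 \<le> (exp (\<theta> / 2) - exp (- (\<theta> / 2)))\<^sup>2" by simp
    also have "\<dots> = exp \<theta> + exp (- \<theta>) - 2"
    proof -
      have "exp (\<theta> / 2) * exp (\<theta> / 2) = exp \<theta>" "exp (- (\<theta> / 2)) * exp (- (\<theta> / 2)) = exp (- \<theta>)"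
        "exp (\<theta> / 2) * exp (- (\<theta> / 2)) = 1"
        by (simp_all add: exp_add[symmetric])
      then show ?thesis by (simp add: power2_eq_square algebra_simps)
    qed
    finally show ?thesis using \<delta> by (simp add: c'_def)
  qed
  have ev1: "\<forall>\<^sub>F n in sequentially. 1 / 2 < lam n" "\<forall>\<^sub>F n in sequentially. lam n < 2"
    using order_tendstoD(1)[OF lam(2), of "1 / 2"] order_tendstoD(2)[OF lam(2), of 2] by simp_all
  have "(\<lambda>n. \<bar>1 - lam n\<bar> * exp \<theta>) \<longlonglongrightarrow> \<bar>1 - 1\<bar> * exp \<theta>" by (intro tendsto_intros lam)
  then have ev2: "\<forall>\<^sub>F n in sequentially. \<bar>1 - lam n\<bar> * exp \<theta> < \<delta> / 8"
    by (rule order_tendstoD(2)) (use \<delta> in simp)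
  have "(\<lambda>n. \<theta> * (real K / (\<epsilon> * real n))) \<longlonglongrightarrow> 0" using \<epsilon> by real_asymp
  then have ev3: "\<forall>\<^sub>F n in sequentially. \<theta> * (real K / (\<epsilon> * real n)) < \<delta> / 8"
    by (rule order_tendstoD(2)) (use \<delta> in simp)
  have "(\<lambda>i. exp \<theta> * (1 - \<epsilon>) ^ i) \<longlonglongrightarrow> exp \<theta> * 0"
    using \<epsilon> by (intro tendsto_mult tendsto_const LIMSEQ_power_zero) auto
  then have "(\<lambda>n. exp \<theta> * (1 - \<epsilon>) ^ d n) \<longlonglongrightarrow> 0"
    using filterlim_compose[OF _ d(2), of "\<lambda>i. exp \<theta> * (1 - \<epsilon>) ^ i"] by simp
  then have ev4: "\<forall>\<^sub>F n in sequentially. exp \<theta> * (1 - \<epsilon>) ^ d n < s / 8"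
    by (rule order_tendstoD(2)) (use s in simp)
  have "(\<lambda>n. 2 * exp \<theta> * exp (- (real n * (1 / 2) * \<gamma>))) \<longlonglongrightarrow> 0" using \<gamma> by real_asymp
  then have ev5: "\<forall>\<^sub>F n in sequentially. 2 * exp \<theta> * exp (- (real n * (1 / 2) * \<gamma>)) < s / 8"
    by (rule order_tendstoD(2)) (use s in simp)
  \<comment> \<open>The last term is the geometric series, with sum \<open>2 / s\<close> independent
    of \<open>n\<close>; it disappears in the limit.\<close>
  let ?x = "\<lambda>n. c' * T - \<theta> * (real j - 2) - ln (s / 2) / real n"
  have "\<forall>\<^sub>F n in sequentially. ereal (1 / real n) * eln (measure (M n) (event_V (M n) (S n) n (q n) j T)) \<le> ereal (?x n)"
    using ev1 ev2 ev3 ev4 ev5 eventually_ge_at_top[of 1]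
  proof eventually_elim
    case (elim n)
    interpret jsq_system "M n" "S n" n "d n" "lam n" "q n" using sys elim by simp
    have n: "n \<ge> 1" and n0: "0 < n" and l: "lam n > 0" and dn: "d n \<in> {1..n}" using elim lam d by auto
    have qn: "\<forall>s<n. q n s = 1" using q n by blast
    define e where "e = \<epsilon> * real n"
    have e: "0 < e" "e \<le> real n" using \<epsilon> n by (auto simp: e_def intro: mult_left_le_one_le)
    have en: "e / real n = \<epsilon>" using n by (simp add: e_def)
    have ex: "2 * exp \<theta> * exp (- (real n * lam n * \<gamma>)) \<le> s / 8"
    proof -
      have "real n * (1 / 2) * \<gamma> \<le> real n * lam n * \<gamma>"
        using elim(1) \<gamma> by (intro mult_right_mono mult_left_mono) auto
      then have "2 * exp \<theta> * exp (- (real n * lam n * \<gamma>)) \<le> 2 * exp \<theta> * exp (- (real n * (1 / 2) * \<gamma>))" by simp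
      with elim show ?thesis by linarith
    qed
    have step: "(\<integral>\<^sup>+x. step_weight (real n * c') k x * (\<integral>\<^sup>+r. ennreal (exp (lyap n \<theta> e (next_len k x m r))) \<partial>famexp) \<partial>M n) \<le>
      ennreal (1 - s / 2) * ennreal (exp (lyap n \<theta> e m))" for k m
    proof -
      define p where "p = max 0 (slope e (idle n m) - real K / e)"
      define A where "A = exp (\<theta> * slope e (idle n m)) + exp \<theta> * (1 - \<epsilon>) ^ d n"
      define G where "G = gap_factor c' \<gamma> K ((1 - 2 * \<epsilon>) * (1 - exp (- (\<theta> * p))))"
      have AG: "A * G \<le> 1 - s / 2"
        unfolding A_def G_def gap_factor_def c'_def
      proof (rule decay_factor_le[OF \<theta> \<delta> \<epsilon> \<gamma> K n0])
        show "p = max 0 (slope e (idle n m) - real K / (\<epsilon> * real n))" by (simp add: p_def e_def)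
      qed (use elim \<epsilon> ex \<gamma>\<epsilon> K4 in \<open>auto simp: s_def slope_nonneg slope_le_1 power_le_one\<close>)
      have A0: "0 \<le> A" using \<epsilon> by (simp add: A_def)
      have "(\<integral>\<^sup>+x. step_weight (real n * c') k x * (\<integral>\<^sup>+r. ennreal (exp (lyap n \<theta> e (next_len k x m r))) \<partial>famexp) \<partial>M n) \<le>
        ennreal (exp (lyap n \<theta> e m)) * ennreal A * ennreal G"
      proof (rule order_trans)
        show "(\<integral>\<^sup>+x. step_weight (real n * c') k x * (\<integral>\<^sup>+r. ennreal (exp (lyap n \<theta> e (next_len k x m r))) \<partial>famexp) \<partial>M n) \<le>
            ennreal (exp (lyap n \<theta> e m)) * ennreal A *
            (\<integral>\<^sup>+x. step_weight (real n * c') k x * (\<integral>\<^sup>+r. head_factor n \<theta> e m (arr_gap (S n) k x) r \<partial>famexp) \<partial>M n)"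
          unfolding A_def en[symmetric] by (rule lyap_one_step[OF n dn l e \<theta>])
        show "\<dots> \<le> ennreal (exp (lyap n \<theta> e m)) * ennreal A * ennreal G"
          unfolding G_def
          by (rule mult_left_mono[OF nn_integral_head_factor_le[OF n l \<epsilon> \<theta> c' \<gamma> K e_def p_def]]) simp
      qed
      also have "\<dots> = ennreal (A * G) * ennreal (exp (lyap n \<theta> e m))"
        using A0 by (simp add: ennreal_mult' ac_simps)
      also have "\<dots> \<le> ennreal (1 - s / 2) * ennreal (exp (lyap n \<theta> e m))"
        by (intro mult_right_mono ennreal_leI AG) simp
      finally show ?thesis .
    qed
    have "measure (M n) (event_V (M n) (S n) n (q n) j T) \<le> exp (real n * c' * T - \<theta> * ((real j - 2) * real n)) / (1 - (1 - s / 2))"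
      using dn c' s by (intro prob_event_V_le[OF n _ l qn j \<theta> _ _ _ step]) auto
    also have "\<dots> = exp (real n * ?x n)"
    proof -
      have "real n * ?x n = (real n * c' * T - \<theta> * ((real j - 2) * real n)) - ln (s / 2)"
        using n by (simp add: algebra_simps)
      then show ?thesis using s by (simp add: exp_diff)
    qed
    finally have "ereal (1 / real n) * eln (measure (M n) (event_V (M n) (S n) n (q n) j T)) \<le> ereal (1 / real n * (real n * ?x n))"
      using n by (intro eln_scaled_le) auto
    then show ?case using n by simp
  qed
  then have "limsup (\<lambda>n. ereal (1 / real n) * eln (measure (M n) (event_V (M n) (S n) n (q n) j T))) \<le> limsup (\<lambda>n. ereal (?x n))"
    by (rule Limsup_mono)
  also have "limsup (\<lambda>n. ereal (?x n)) = ereal (c' * T - \<theta> * (real j - 2))"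
  proof (rule lim_imp_Limsup)
    have "?x \<longlonglongrightarrow> c' * T - \<theta> * (real j - 2) - 0"
      by (intro tendsto_diff tendsto_const lim_const_over_n)
    then show "(\<lambda>n. ereal (?x n)) \<longlonglongrightarrow> ereal (c' * T - \<theta> * (real j - 2))" by simp
  qed simp
  also have "c' * T - \<theta> * (real j - 2) = - rate j T + \<Delta>"
    unfolding c'_def ab(6) e\<theta> \<theta>_def[symmetric] using T by (simp add: \<delta>_def algebra_simps)
  finally show "limsup (\<lambda>n. ereal (1 / real n) * eln (measure (M n) (event_V (M n) (S n) n (q n) j T))) \<le> ereal (- rate j T) + ereal \<Delta>"
    by simp
qed

theorem corollary2p1:
  fixes M :: "nat \<Rightarrow> 'w measure" and S :: "nat \<Rightarrow> 'w jsq_input"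
    and d :: "nat \<Rightarrow> nat" and lam :: "nat \<Rightarrow> real" and q :: "nat \<Rightarrow> nat \<Rightarrow> nat" and j :: nat
  defines "PU \<equiv> \<lambda>n T. measure (M n) (event_U (M n) (S n) n (q n) j T)"
    and "PV \<equiv> \<lambda>n T. measure (M n) (event_V (M n) (S n) n (q n) j T)"
  assumes "\<And>n. n \<ge> 1 \<Longrightarrow> d n \<in> {1..n}"
    and "filterlim d at_top sequentially"
    and "\<And>n. n \<ge> 1 \<Longrightarrow> lam n > 0"
    and "lam \<longlonglongrightarrow> 1"
    and "\<And>n. n \<ge> 1 \<Longrightarrow> jsq_system (M n) (S n) n (d n) (lam n) (q n)"
    and "\<And>n. n \<ge> 1 \<Longrightarrow>
           AE \<omega> in M n. \<forall>i\<ge>1. occupancy (S n) n (q n) i 0 \<omega> = (if i = 1 then 1 else 0)"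
    and "j \<ge> 3"
  shows "(\<forall>T>0. liminf (\<lambda>n. ereal (1 / real n) * eln (PU n T)) \<ge> ereal (- rate j T)
              \<and> limsup (\<lambda>n. ereal (1 / real n) * eln (PV n T)) \<le> ereal (- rate j T))
       \<and> ((\<forall>n\<ge>1. d n = n) \<longrightarrow>
            (\<forall>T>0. (\<lambda>n. ereal (1 / real n) * eln (PU n T)) \<longlonglongrightarrow> ereal (- rate j T)
                 \<and> (\<lambda>n. ereal (1 / real n) * eln (PV n T)) \<longlonglongrightarrow> ereal (- rate j T))
          \<and> (\<exists>L. (\<forall>T>0. (\<lambda>n. ereal (T / real n) * eln (PU n T)) \<longlonglongrightarrow> L T)
                 \<and> (L \<longlongrightarrow> ereal (- ((real j - 2)\<^sup>2 / 4))) at_top)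
          \<and> (\<exists>L. (\<forall>T>0. (\<lambda>n. ereal (T / real n) * eln (PV n T)) \<longlonglongrightarrow> L T)
                 \<and> (L \<longlongrightarrow> ereal (- ((real j - 2)\<^sup>2 / 4))) at_top))"
proof -
  have q: "q n s = 1" if "n \<ge> 1" "s < n" for n s
    using one_initial_job[OF assms(7)[OF that(1)] that(1) assms(5)[OF that(1)] assms(8)[OF that(1)]] that(2) by blast
  have U: "liminf (\<lambda>n. ereal (1 / real n) * eln (PU n T)) \<ge> ereal (- rate j T)" if "T > 0" for T
    unfolding PU_def by (rule event_U_rate[OF assms(7) assms(3) assms(5) assms(6) q assms(9) that])
  have V: "limsup (\<lambda>n. ereal (1 / real n) * eln (PV n T)) \<le> ereal (- rate j T)" if "T > 0" for T
    unfolding PV_def by (rule event_V_rate[OF assms(7) assms(3) assms(4) assms(5) assms(6) q assms(9) that])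
  have lim: "(\<lambda>n. ereal (1 / real n) * eln (PU n T)) \<longlonglongrightarrow> ereal (- rate j T) \<and>
      (\<lambda>n. ereal (1 / real n) * eln (PV n T)) \<longlonglongrightarrow> ereal (- rate j T)"
    if dn: "\<forall>n\<ge>1. d n = n" and T: "T > 0" for T
  proof -
    let ?u = "\<lambda>n. ereal (1 / real n) * eln (PU n T)" and ?v = "\<lambda>n. ereal (1 / real n) * eln (PV n T)"
    have "PU n T \<le> PV n T" if n: "n \<ge> 1" for n
    proof -
      interpret jsq_system "M n" "S n" n "d n" "lam n" "q n" by (rule assms(7)[OF n])
      have j2: "j \<ge> 2" using assms(9) by simp
      show ?thesis
        unfolding PU_def PV_def
      proof (rule finite_measure_mono_AE)
        show "event_V (M n) (S n) n (q n) j T \<in> events"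
          by (rule sets_events(2)[OF measurable_inputs_M n j2])
        show "AE \<omega> in M n. \<omega> \<in> event_U (M n) (S n) n (q n) j T \<longrightarrow> \<omega> \<in> event_V (M n) (S n) n (q n) j T"
          using AE_good_path[OF n assms(5)[OF n]]
        proof eventually_elim
          case (elim \<omega>)
          then have good: "good_path (S n) n n (q n) \<omega>" using dn n by simp
          have qn: "\<forall>s<n. q n s = 1" using q[OF n] by simp
          show ?case by (rule impI) (rule event_U_imp_event_V[OF good n j2 qn])
        qed
      qed
    qed
    then have "\<forall>\<^sub>F n in sequentially. ?u n \<le> ?v n"
      by (intro eventually_mono[OF eventually_ge_at_top[of 1]] ereal_mult_left_mono eln_mono)
        (auto simp: PU_def)
    \<comment> \<open>The four limits are squeezed between the lower bound for \<open>?u\<close> and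
      the upper bound for \<open>?v\<close>, so all coincide.\<close>
    then have "liminf ?u \<le> liminf ?v" "limsup ?u \<le> limsup ?v"
      by (auto intro: Liminf_mono Limsup_mono)
    moreover have "liminf ?u \<le> limsup ?u" "liminf ?v \<le> limsup ?v" by (auto intro: Liminf_le_Limsup)
    ultimately have "liminf ?u = ereal (- rate j T)" "limsup ?u = ereal (- rate j T)"
      "liminf ?v = ereal (- rate j T)" "limsup ?v = ereal (- rate j T)"
      using U[OF T] V[OF T] by (meson antisym order_trans)+
    then show ?thesis by (simp add: Liminf_eq_Limsup)
  qed
  have scaled: "(\<lambda>n. ereal (T / real n) * eln (p n)) \<longlonglongrightarrow> ereal (- (T * rate j T))"
    if "(\<lambda>n. ereal (1 / real n) * eln (p n)) \<longlonglongrightarrow> ereal (- rate j T)" for p :: "nat \<Rightarrow> real" and T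
  proof -
    have "(\<lambda>n. ereal T * (ereal (1 / real n) * eln (p n))) \<longlonglongrightarrow> ereal T * ereal (- rate j T)"
      by (intro tendsto_cmult_ereal that) simp
    moreover have "ereal T * (ereal (1 / real n) * x) = ereal (T / real n) * x" for n and x :: ereal
      by (simp add: mult.assoc[symmetric])
    ultimately show ?thesis by simp
  qed
  have L: "((\<lambda>T. ereal (- (T * rate j T))) \<longlongrightarrow> ereal (- ((real j - 2)\<^sup>2 / 4))) at_top"
    using tendsto_minus[OF scaled_rate_limit[OF assms(9)]] by simp
  show ?thesis
  proof (intro conjI impI allI)
    assume dn: "\<forall>n\<ge>1. d n = n"
    show "\<exists>L. (\<forall>T>0. (\<lambda>n. ereal (T / real n) * eln (PU n T)) \<longlonglongrightarrow> L T) \<and> (L \<longlongrightarrow> ereal (- ((real j - 2)\<^sup>2 / 4))) at_top"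
    proof (intro exI conjI allI impI)
      show "(\<lambda>n. ereal (T / real n) * eln (PU n T)) \<longlonglongrightarrow> ereal (- (T * rate j T))" if "T > 0" for T
        by (rule scaled[OF conjunct1[OF lim[OF dn that]]])
    qed (rule L)
    show "\<exists>L. (\<forall>T>0. (\<lambda>n. ereal (T / real n) * eln (PV n T)) \<longlonglongrightarrow> L T) \<and> (L \<longlongrightarrow> ereal (- ((real j - 2)\<^sup>2 / 4))) at_top"
    proof (intro exI conjI allI impI)
      show "(\<lambda>n. ereal (T / real n) * eln (PV n T)) \<longlonglongrightarrow> ereal (- (T * rate j T))" if "T > 0" for T
        by (rule scaled[OF conjunct2[OF lim[OF dn that]]])
    qed (rule L)
    show "(\<lambda>n. ereal (1 / real n) * eln (PU n T)) \<longlonglongrightarrow> ereal (- rate j T)" if "T > 0" for T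
      by (rule conjunct1[OF lim[OF dn that]])
    show "(\<lambda>n. ereal (1 / real n) * eln (PV n T)) \<longlonglongrightarrow> ereal (- rate j T)" if "T > 0" for T
      by (rule conjunct2[OF lim[OF dn that]])
  qed (rule U V, assumption)+
qed

end
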